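(* For a (complex) Banach space $X$ and $2\leq q<\infty$ the following statements are equivalent: (a) $X$ has cotype $q$; (b) for some (every) $1\le p<\infty$, there exist constants $C\geq1$ and $0<r<1$ such that every vector-valued Dirichlet series $D=\sum a_nn^{-s}\in\mathcal{H}_p(X)$ satisfies \[ \Big(\sum_{n=1}^\infty r^{\Omega(n)}\|a_n\|^q\Big)^{1/q}\leq C\|D\|_{\mathcal{H}_p(X)}; \] (c) for some (every) $1\le p<\infty$, there exist constants $C\geq1$ and $0<r<1$ such that every function $f\in H_p(\mathbb{T}^\infty,X)$ satisfies \[ \Big(\sum_{\alpha\in\mathbb{N}_0^{(\mathbb{N})}}r^{|\alpha|}\|\hat f(\alpha)\|^q\Big)^{1/q}\leq C\|f\|_{H_p(\mathbb{T}^\infty,X)}. \] In addition, the next statement (d) implies (a), (b) and (c), and is equivalent to them whenever $X$ is $K$-convex: (d) for some (every) $1<p<\infty$, there exist constants $C\geq1$ and $0<r<1$ such that every function $f\in L_p(\{-1,1\}^\infty,X)$ satisfies \[ \Big(\sum_{A\subset\mathbb{N},\ A\text{ finite}}r^{|A|}\|\hat f(A)\|^q\Big)^{1/q}\leq C\|f\|_{L_p(\{-1,1\}^\infty,X)}. \]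
   Context: "For some (every) $p$" means that the theorem holds both when the condition is read as "for some $p$" and when it is read as "for every $p$". $X$ has cotype $q$ ($2\le q<\infty$) if there is a constant $C\geq1$ such that for every $N\in\mathbb{N}$ and all $x_1,\dots,x_N\in X$, $\big(\sum_{n=1}^N\|x_n\|^q\big)^{1/q}\leq C\big(\int_{\mathbb{T}^N}\|\sum_{n=1}^Nx_nz_n\|^qdz\big)^{1/q}$, where $\mathbb{T}$ is the unit circle in $\mathbb{C}$ with normalized Lebesgue measure. $\Omega(n)$ is the number of prime divisors of $n$ counted with multiplicity ($\Omega(1)=0$). $\mathbb{T}^\infty=\prod_{k=1}^\infty\mathbb{T}$ carries the product of the normalized Lebesgue measures, denoted $dz$. $\mathbb{Z}^{(\mathbb{N})}$ is the set of finitely supported sequences of integers, $\mathbb{N}_0^{(\mathbb{N})}$ the subset of those with all entries $\geq0$, and $|\alpha|=\sum_i\alpha_i$ for $\alpha\in\mathbb{N}_0^{(\mathbb{N})}$. For $f\in L_1(\mathbb{T}^\infty,X)$ (Bochner) and $\alpha\in\mathbb{Z}^{(\mathbb{N})}$, $\hat f(\alpha)=\int_{\mathbb{T}^\infty}f(z)z^{-\alpha}dz$. For $1\le p<\infty$, $H_p(\mathbb{T}^\infty,X)=\{f\in L_p(\mathbb{T}^\infty,X):\hat f(\alpha)=0\ \forall\alpha\in\mathbb{Z}^{(\mathbb{N})}\setminus\mathbb{N}_0^{(\mathbb{N})}\}$ with the $L_p$ norm. The Bohr transform $\mathfrak{B}_X$ assigns to $f\in H_p(\mathbb{T}^\infty,X)$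 the (formal) Dirichlet series $\sum a_nn^{-s}$ with $a_n=\hat f(\alpha)$ whenever $n=\mathfrak p_1^{\alpha_1}\cdots\mathfrak p_k^{\alpha_k}$ is the prime factorization of $n$ ($\mathfrak p_1<\mathfrak p_2<\dots$ the primes). $\mathcal{H}_p(X)$ is the image of $H_p(\mathbb{T}^\infty,X)$ under the (injective) map $\mathfrak{B}_X$, with norm $\|D\|_{\mathcal{H}_p(X)}=\|\mathfrak{B}_X^{-1}(D)\|_{H_p(\mathbb{T}^\infty,X)}$. $\{-1,1\}^\infty$ carries the infinite product of the uniform probability $(\delta_1+\delta_{-1})/2$, with expectation $\mathbb{E}$. For finite $A\subset\mathbb{N}$, $\varepsilon_A=\prod_{n\in A}\varepsilon_n$, and for $f\in L_1(\{-1,1\}^\infty,X)$, $\hat f(A)=\mathbb{E}[f(\varepsilon)\varepsilon_A]$. $X$ is $K$-convex if the mapping $\sum_Ax_A\varepsilon_A\mapsto\sum_{|A|=1}x_A\varepsilon_A$, defined on finite sums, extends to a bounded linear operator on $L_2(\{-1,1\}^\infty,X)$. *)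

theory Defs
  imports "HOL-Probability.Probability"
begin

(* The scalar multiplication by complex numbers extends the real one given by banach. *)
class complex_banach = banach +
  fixes scaleC :: "complex \<Rightarrow> 'a \<Rightarrow> 'a"  (infixr \<open>*\<^sub>C\<close> 75)
  assumes scaleC_add_right: "c *\<^sub>C (x + y) = c *\<^sub>C x + c *\<^sub>C y"
    and scaleC_add_left: "(c + d) *\<^sub>C x = c *\<^sub>C x + d *\<^sub>C x"
    and scaleC_scaleC: "c *\<^sub>C d *\<^sub>C x = (c * d) *\<^sub>C x"
    and scaleR_scaleC: "t *\<^sub>R x = complex_of_real t *\<^sub>C x"
    and norm_scaleC: "norm (c *\<^sub>C x) = cmod c * norm x"

instantiation complex :: complex_banach
begin
definition scaleC_complex :: "complex \<Rightarrow> complex \<Rightarrow> complex" where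
  "scaleC_complex c x = c * x"
instance
  by standard (simp_all add: scaleC_complex_def algebra_simps norm_mult scaleR_conv_of_real)
end


section \<open>Bochner integration and Lebesgue-Bochner spaces\<close>

(* The library's has_bochner_integral and integral require a second countable codomain, which
   would restrict X to separable spaces.  The following is the same construction, with Borel
   measurability replaced by strong measurability; see strong_integral_eq_lebesgue_integral. *)

definition strongly_measurable :: "'m measure \<Rightarrow> ('m \<Rightarrow> 'a::real_normed_vector) \<Rightarrow> bool" where
  "strongly_measurable M f \<longleftrightarrow>
     (\<exists>s. (\<forall>i::nat. simple_function M (s i)) \<and> (\<forall>x\<in>space M. (\<lambda>i. s i x) \<longlonglongrightarrow> f x))"

definition has_strong_integral :: "'m measure \<Rightarrow> ('m \<Rightarrow> 'a) \<Rightarrow> 'a::real_normed_vector \<Rightarrow> bool" where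
  "has_strong_integral M f x \<longleftrightarrow> strongly_measurable M f \<and>
     (\<exists>s. (\<forall>i::nat. Bochner_Integration.simple_bochner_integrable M (s i)) \<and>
          (\<lambda>i. \<integral>\<^sup>+ y. ennreal (norm (f y - s i y)) \<partial>M) \<longlonglongrightarrow> 0 \<and>
          (\<lambda>i. Bochner_Integration.simple_bochner_integral M (s i)) \<longlonglongrightarrow> x)"

definition strong_integral :: "'m measure \<Rightarrow> ('m \<Rightarrow> 'a::real_normed_vector) \<Rightarrow> 'a" where
  "strong_integral M f =
     (if \<exists>x. has_strong_integral M f x then THE x. has_strong_integral M f x else 0)"

lemma strongly_measurable_iff_borel_measurable:
  fixes f :: "'m \<Rightarrow> 'a::{real_normed_vector, second_countable_topology}"
  shows "strongly_measurable M f \<longleftrightarrow> f \<in> borel_measurable M"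
proof
  assume "strongly_measurable M f"
  then obtain s where s: "\<And>i. simple_function M (s i)"
      "\<And>x. x \<in> space M \<Longrightarrow> (\<lambda>i. s i x) \<longlonglongrightarrow> f x"
    unfolding strongly_measurable_def by blast
  show "f \<in> borel_measurable M"
    by (rule borel_measurable_LIMSEQ_metric[OF borel_measurable_simple_function s(2)])
       (auto intro: s(1))
next
  assume "f \<in> borel_measurable M"
  from borel_measurable_implies_sequence_metric[OF this, of 0] show "strongly_measurable M f"
    unfolding strongly_measurable_def by blast
qed

lemma strong_integral_eq_lebesgue_integral:
  fixes f :: "'m \<Rightarrow> 'a::{banach, second_countable_topology}"
  shows "strong_integral M f = integral\<^sup>L M f"
proof -
  have "has_strong_integral M f = has_bochner_integral M f"
    unfolding has_strong_integral_def has_bochner_integral.simps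
      strongly_measurable_iff_borel_measurable by blast
  then show ?thesis
    unfolding strong_integral_def lebesgue_integral_def by auto
qed

(* Elements of Lp are functions, not classes modulo null sets; every class has a representative
   that is strongly measurable everywhere. *)
definition Lp :: "'m measure \<Rightarrow> real \<Rightarrow> ('m \<Rightarrow> 'a::real_normed_vector) set" where
  "Lp M p = {f. strongly_measurable M f \<and> integrable M (\<lambda>x. norm (f x) powr p)}"

definition Lp_norm :: "'m measure \<Rightarrow> real \<Rightarrow> ('m \<Rightarrow> 'a::real_normed_vector) \<Rightarrow> real" where
  "Lp_norm M p f = (\<integral>x. norm (f x) powr p \<partial>M) powr (1 / p)"


section \<open>Tori and cotype\<close>

definition circle_measure :: "complex measure" where
  "circle_measure =
     distr (uniform_measure lborel {0..<2 * pi}) (restrict_space borel (sphere 0 1)) cis"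

definition cotype :: "'a::complex_banach itself \<Rightarrow> real \<Rightarrow> bool" where
  "cotype X q \<longleftrightarrow> (\<exists>C\<ge>1. \<forall>(N::nat) (x::nat \<Rightarrow> 'a).
     (\<Sum>n=1..N. norm (x n) powr q) powr (1 / q)
       \<le> C * (\<integral>z. norm (\<Sum>n=1..N. z n *\<^sub>C x n) powr q \<partial>(Pi\<^sub>M {1..N} (\<lambda>_. circle_measure)))
             powr (1 / q))"

(* The coordinates of the infinite torus are numbered from 0. *)
definition torus :: "(nat \<Rightarrow> complex) measure" where
  "torus = Pi\<^sub>M UNIV (\<lambda>_. circle_measure)"


section \<open>Hardy spaces on the infinite torus\<close>

definition int_multiindices :: "(nat \<Rightarrow> int) set" where
  "int_multiindices = {\<alpha>. finite {i. \<alpha> i \<noteq> 0}}"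

definition nonneg_multiindices :: "(nat \<Rightarrow> int) set" where
  "nonneg_multiindices = {\<alpha> \<in> int_multiindices. \<forall>i. 0 \<le> \<alpha> i}"

definition multiindex_size :: "(nat \<Rightarrow> int) \<Rightarrow> int" where
  "multiindex_size \<alpha> = (\<Sum>i | \<alpha> i \<noteq> 0. \<alpha> i)"

definition torus_coeff :: "((nat \<Rightarrow> complex) \<Rightarrow> 'a) \<Rightarrow> (nat \<Rightarrow> int) \<Rightarrow> 'a::complex_banach" where
  "torus_coeff f \<alpha> = strong_integral torus (\<lambda>z. (\<Prod>i | \<alpha> i \<noteq> 0. z i powi (- \<alpha> i)) *\<^sub>C f z)"

definition torus_Hp :: "real \<Rightarrow> ((nat \<Rightarrow> complex) \<Rightarrow> 'a::complex_banach) set" where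
  "torus_Hp p =
     {f \<in> Lp torus p. \<forall>\<alpha> \<in> int_multiindices - nonneg_multiindices. torus_coeff f \<alpha> = 0}"


section \<open>Dirichlet series\<close>

(* A formal Dirichlet series is its sequence of coefficients; index 0 carries no coefficient and
   is set to 0. *)
definition bohr_transform :: "((nat \<Rightarrow> complex) \<Rightarrow> 'a) \<Rightarrow> nat \<Rightarrow> 'a::complex_banach" where
  "bohr_transform f n =
     (if n = 0 then 0
      else torus_coeff f (\<lambda>i. int (multiplicity (enumerate {p::nat. prime p} i) n)))"

definition dirichlet_Hp :: "real \<Rightarrow> (nat \<Rightarrow> 'a::complex_banach) set" where
  "dirichlet_Hp p = bohr_transform ` torus_Hp p"

(* As bohr_transform is injective up to equality almost everywhere, the norm does not depend on
   the preimage that inv_into chooses. *)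
definition dirichlet_norm :: "real \<Rightarrow> (nat \<Rightarrow> 'a::complex_banach) \<Rightarrow> real" where
  "dirichlet_norm p D = Lp_norm torus p (inv_into (torus_Hp p) bohr_transform D)"

definition big_omega :: "nat \<Rightarrow> nat" where
  "big_omega n = size (prime_factorization n)"


section \<open>The infinite Boolean cube and K-convexity\<close>

definition cube :: "(nat \<Rightarrow> real) measure" where
  "cube = Pi\<^sub>M UNIV (\<lambda>_. uniform_count_measure {-1, 1})"

definition walsh :: "nat set \<Rightarrow> (nat \<Rightarrow> real) \<Rightarrow> real" where
  "walsh A \<epsilon> = (\<Prod>n\<in>A. \<epsilon> n)"

definition walsh_coeff :: "((nat \<Rightarrow> real) \<Rightarrow> 'a) \<Rightarrow> nat set \<Rightarrow> 'a::complex_banach" where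
  "walsh_coeff f A = strong_integral cube (\<lambda>\<epsilon>. walsh A \<epsilon> *\<^sub>R f \<epsilon>)"

(* T is an operator on the classes modulo null sets: by linearity and boundedness it respects
   equality almost everywhere. *)
definition K_convex :: "'a::complex_banach itself \<Rightarrow> bool" where
  "K_convex X \<longleftrightarrow> (\<exists>T :: ((nat \<Rightarrow> real) \<Rightarrow> 'a) \<Rightarrow> ((nat \<Rightarrow> real) \<Rightarrow> 'a).
     (\<forall>f \<in> Lp cube 2. T f \<in> Lp cube 2) \<and>
     (\<forall>f \<in> Lp cube 2. \<forall>g \<in> Lp cube 2. AE \<epsilon> in cube. T (\<lambda>\<eta>. f \<eta> + g \<eta>) \<epsilon> = T f \<epsilon> + T g \<epsilon>) \<and>
     (\<forall>c. \<forall>f \<in> Lp cube 2. AE \<epsilon> in cube. T (\<lambda>\<eta>. c *\<^sub>C f \<eta>) \<epsilon> = c *\<^sub>C T f \<epsilon>) \<and>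
     (\<exists>K. \<forall>f \<in> Lp cube 2. Lp_norm cube 2 (T f) \<le> K * Lp_norm cube 2 f) \<and>
     (\<forall>F (x :: nat set \<Rightarrow> 'a). finite F \<and> (\<forall>A\<in>F. finite A) \<longrightarrow>
        (AE \<epsilon> in cube. T (\<lambda>\<eta>. \<Sum>A\<in>F. walsh A \<eta> *\<^sub>R x A) \<epsilon>
                         = (\<Sum>A \<in> {A\<in>F. card A = 1}. walsh A \<epsilon> *\<^sub>R x A))))"


section \<open>The three coefficient inequalities\<close>

definition dirichlet_inequality :: "'a::complex_banach itself \<Rightarrow> real \<Rightarrow> real \<Rightarrow> bool" where
  "dirichlet_inequality X q p \<longleftrightarrow> (\<exists>C r. C \<ge> 1 \<and> 0 < r \<and> r < 1 \<and>
     (\<forall>a \<in> (dirichlet_Hp p :: (nat \<Rightarrow> 'a) set).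
        (\<lambda>n. r ^ big_omega n * norm (a n) powr q) summable_on {1..} \<and>
        (\<Sum>\<^sub>\<infinity>n\<in>{1..}. r ^ big_omega n * norm (a n) powr q) powr (1 / q)
          \<le> C * dirichlet_norm p a))"

definition torus_inequality :: "'a::complex_banach itself \<Rightarrow> real \<Rightarrow> real \<Rightarrow> bool" where
  "torus_inequality X q p \<longleftrightarrow> (\<exists>C r. C \<ge> 1 \<and> 0 < r \<and> r < 1 \<and>
     (\<forall>f \<in> (torus_Hp p :: ((nat \<Rightarrow> complex) \<Rightarrow> 'a) set).
        (\<lambda>\<alpha>. r powi multiindex_size \<alpha> * norm (torus_coeff f \<alpha>) powr q)
           summable_on nonneg_multiindices \<and>
        (\<Sum>\<^sub>\<infinity>\<alpha>\<in>nonneg_multiindices.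
            r powi multiindex_size \<alpha> * norm (torus_coeff f \<alpha>) powr q) powr (1 / q)
          \<le> C * Lp_norm torus p f))"

definition cube_inequality :: "'a::complex_banach itself \<Rightarrow> real \<Rightarrow> real \<Rightarrow> bool" where
  "cube_inequality X q p \<longleftrightarrow> (\<exists>C r. C \<ge> 1 \<and> 0 < r \<and> r < 1 \<and>
     (\<forall>f \<in> (Lp cube p :: ((nat \<Rightarrow> real) \<Rightarrow> 'a) set).
        (\<lambda>A. r ^ card A * norm (walsh_coeff f A) powr q) summable_on {A. finite A} \<and>
        (\<Sum>\<^sub>\<infinity>A\<in>{A. finite A}. r ^ card A * norm (walsh_coeff f A) powr q) powr (1 / q)
          \<le> C * Lp_norm cube p f))"

end

theory Submission
  imports Defs
begin

text \<open>
  Kahane's inequality, obtained from hypercontractivity on the finite cube, and the contraction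
  principle allow one to replace Steinhaus variables by random signs and all exponents by \<open>1\<close>, so that
  cotype becomes an inequality for \<open>L\<^sub>1\<close> averages over signs.  Testing the coefficient inequalities
  on linear functions gives cotype.

  Conversely, integrating \<open>f\<close> against the positive kernel \<open>\<Prod>i. 1 + Re (z i * w i powi (- d i))\<close> produces,
  without increase of the norm, a polynomial in \<open>z\<close> of degree at most one in each variable whose
  coefficients are those coefficients of \<open>f\<close> that have all entries \<open>0\<close> or \<open>d i\<close>.  It may be
  restricted to roots of unity, so that only finite averages remain.  If a random set of variables
  catches exactly one variable of a monomial, which happens with probability at least \<open>1/3\<close>
  for a suitable density, cotype can be applied to these variables with the others fixed; iterating this, the
  coefficients of degree \<open>n\<close> are bounded with a constant \<open>K ^ n\<close>, which is absorbed by \<open>r\<close>.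
  Geometrically distributed random exponents \<open>d i\<close> then reach all multiindices.  On the cube, Riesz
  products take the role of the kernel, K-convexity that of the projection onto the part of degree
  one, and hypercontractivity reduces \<open>p < 2\<close> to \<open>p = 2\<close>.  The inequality for Dirichlet series is the
  one on the torus, since Fourier coefficients determine a function up to a null set.
\<close>

section \<open>Strong integrals\<close>

text \<open>Cotype speaks about sums of single variables, so the sufficiency part has to isolate the
  part of degree one of a polynomial with controlled norm, and this projection is the obstacle. For
  polynomials in \<open>z\<close> without conjugates it is harmless: all degrees are nonnegative,
  hence an average over a common rotation of the variables removes every other degree and does not
  increase the L1 norm. On the cube a common change of sign distinguishes degrees only by parity,
  and boundedness of the projection is K-convexity itself, a statement in L2. The induction on the
  degree is the same in both cases, so it is carried out once, with the inequality for degree one as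
  a hypothesis and with exponent 1 on the torus and 2 on the cube.

  Polynomials of degree at most one in each variable are the right class for it: freezing some
  variables leaves a polynomial of the same kind, and the degree in a set of variables is the number
  of those variables that occur.

  Passing to finitely many points early keeps all exchanges of vector-valued averages finite. The
  Bochner integral only enters through coefficients and through integration against bounded
  kernels.\<close>

lemma scaleC_zero_left [simp]: "0 *\<^sub>C (x::'a::complex_banach) = 0"
  using norm_scaleC[of 0 x] by simp

lemma scaleC_zero_right [simp]: "c *\<^sub>C (0::'a::complex_banach) = 0"
  using norm_scaleC[of c 0] by simp

lemma scaleC_one [simp]: "1 *\<^sub>C (x::'a::complex_banach) = x"
  using scaleR_scaleC[of 1 x] by simp

lemma scaleR_scaleC_right: "t *\<^sub>R (c *\<^sub>C x) = c *\<^sub>C (t *\<^sub>R (x::'a::complex_banach))"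
  by (simp add: scaleR_scaleC scaleC_scaleC mult.commute)

lemma bounded_linear_scaleC_right: "bounded_linear (\<lambda>x::'a::complex_banach. c *\<^sub>C x)"
  by (rule bounded_linear_intro[where K="cmod c"])
    (simp_all add: scaleC_add_right scaleR_scaleC_right norm_scaleC mult.commute)

lemma bounded_linear_scaleC_left: "bounded_linear (\<lambda>c. c *\<^sub>C (x::'a::complex_banach))"
  by (rule bounded_linear_intro[where K="norm x"])
    (simp_all add: scaleC_add_left scaleR_scaleC[of _ "_ *\<^sub>C _"] scaleC_scaleC norm_scaleC scaleR_conv_of_real)

lemma scaleC_sum_right: "c *\<^sub>C (\<Sum>i\<in>A. f i :: 'a::complex_banach) = (\<Sum>i\<in>A. c *\<^sub>C f i)"
  by (rule linear_sum) (rule bounded_linear.linear[OF bounded_linear_scaleC_right])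

lemma scaleC_sum_left: "(\<Sum>i\<in>A. f i) *\<^sub>C (x :: 'a::complex_banach) = (\<Sum>i\<in>A. f i *\<^sub>C x)"
  using linear_sum[OF bounded_linear.linear[OF bounded_linear_scaleC_left[of x]], of f A] by simp

lemma scaleC_diff_right: "c *\<^sub>C (x - y :: 'a::complex_banach) = c *\<^sub>C x - c *\<^sub>C y"
  using linear_diff[OF bounded_linear.linear[OF bounded_linear_scaleC_right]] by blast

lemma strongly_measurable_simple: "simple_function M f \<Longrightarrow> strongly_measurable M f"
  unfolding strongly_measurable_def by (rule exI[of _ "\<lambda>_. f"]) auto

lemma strongly_measurable_cong:
  "(\<And>x. x \<in> space M \<Longrightarrow> f x = g x) \<Longrightarrow> strongly_measurable M f = strongly_measurable M g"
  unfolding strongly_measurable_def by auto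

lemma strongly_measurable_compose2:
  assumes "strongly_measurable M f" "strongly_measurable M g"
    and "\<And>a b x y. a \<longlonglongrightarrow> x \<Longrightarrow> b \<longlonglongrightarrow> y \<Longrightarrow> (\<lambda>i. h (a i) (b i)) \<longlonglongrightarrow> h x y"
  shows "strongly_measurable M (\<lambda>x. h (f x) (g x))"
proof -
  obtain s t where st: "\<And>i::nat. simple_function M (s i)" "\<And>i::nat. simple_function M (t i)"
    "\<And>x. x \<in> space M \<Longrightarrow> (\<lambda>i. s i x) \<longlonglongrightarrow> f x" "\<And>x. x \<in> space M \<Longrightarrow> (\<lambda>i. t i x) \<longlonglongrightarrow> g x"
    using assms(1,2) unfolding strongly_measurable_def by blast
  have "(\<lambda>i. h (s i x) (t i x)) \<longlonglongrightarrow> h (f x) (g x)" if "x \<in> space M" for x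
    using assms(3)[OF st(3,4)[OF that]] .
  then show ?thesis
    unfolding strongly_measurable_def using st(1,2)
    by (intro exI[of _ "\<lambda>i x. h (s i x) (t i x)"]) (auto intro: simple_function_compose2)
qed

lemma strongly_measurable_add:
  "strongly_measurable M f \<Longrightarrow> strongly_measurable M g \<Longrightarrow> strongly_measurable M (\<lambda>x. f x + g x)"
  by (rule strongly_measurable_compose2[where h="(+)"]) (auto intro: tendsto_intros)

lemma strongly_measurable_diff:
  "strongly_measurable M f \<Longrightarrow> strongly_measurable M g \<Longrightarrow> strongly_measurable M (\<lambda>x. f x - g x)"
  by (rule strongly_measurable_compose2[where h="(-)"]) (auto intro: tendsto_intros)

lemma strongly_measurable_bounded_linear:
  assumes "bounded_linear T" "strongly_measurable M f"
  shows "strongly_measurable M (\<lambda>x. T (f x))"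
  by (rule strongly_measurable_compose2[where h="\<lambda>x y. T x" and g=f])
    (use assms in \<open>auto intro: bounded_linear.tendsto\<close>)

lemma bounded_bilinear_scaleC: "bounded_bilinear (\<lambda>c (x::'a::complex_banach). c *\<^sub>C x)"
proof
  show "\<exists>K. \<forall>c (x::'a). norm (c *\<^sub>C x) \<le> norm c * norm x * K"
    by (rule exI[of _ 1]) (simp add: norm_scaleC)
qed (simp_all add: scaleC_add_left scaleC_add_right scaleR_conv_of_real scaleR_scaleC[where 'a='a] scaleC_scaleC mult.commute)

lemma strongly_measurable_scaleC:
  fixes f :: "'m \<Rightarrow> 'a::complex_banach"
  assumes "g \<in> borel_measurable M" "strongly_measurable M f"
  shows "strongly_measurable M (\<lambda>x. g x *\<^sub>C f x)"
  using assms
  by (intro strongly_measurable_compose2[where h="\<lambda>c x. c *\<^sub>C x"])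
    (auto simp: strongly_measurable_iff_borel_measurable
       intro: bounded_bilinear.tendsto[OF bounded_bilinear_scaleC])

lemma strongly_measurable_sum:
  "(\<And>i. i \<in> I \<Longrightarrow> strongly_measurable M (f i)) \<Longrightarrow> strongly_measurable M (\<lambda>x. \<Sum>i\<in>I. f i x)"
  by (induction I rule: infinite_finite_induct)
    (auto intro: strongly_measurable_simple strongly_measurable_add)

lemma strongly_measurable_norm:
  assumes "strongly_measurable M f"
  shows "(\<lambda>x. norm (f x)) \<in> borel_measurable M"
proof -
  have "strongly_measurable M (\<lambda>x. norm (f x))"
    by (rule strongly_measurable_compose2[OF assms assms, where h="\<lambda>x y. norm x"]) (rule tendsto_norm)
  then show ?thesis by (simp add: strongly_measurable_iff_borel_measurable)
qed

definition bochner :: "'m measure \<Rightarrow> ('m \<Rightarrow> 'a::real_normed_vector) \<Rightarrow> bool" where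
  "bochner M f \<longleftrightarrow> strongly_measurable M f \<and> integrable M (\<lambda>x. norm (f x))"

lemma bochner_add:
  assumes "bochner M f" "bochner M g"
  shows "bochner M (\<lambda>x. f x + g x)"
proof -
  have sm: "strongly_measurable M (\<lambda>x. f x + g x)"
    using assms by (simp add: bochner_def strongly_measurable_add)
  have "integrable M (\<lambda>x. norm (f x) + norm (g x))" using assms by (simp add: bochner_def)
  then have "integrable M (\<lambda>x. norm (f x + g x))"
    by (rule Bochner_Integration.integrable_bound)
      (simp_all add: strongly_measurable_norm[OF sm] norm_triangle_ineq)
  with sm show ?thesis by (simp add: bochner_def)
qed

lemma bochner_diff:
  assumes "bochner M f" "bochner M g"
  shows "bochner M (\<lambda>x. f x - g x)"
proof -
  have sm: "strongly_measurable M (\<lambda>x. f x - g x)"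
    using assms by (simp add: bochner_def strongly_measurable_diff)
  have "integrable M (\<lambda>x. norm (f x) + norm (g x))" using assms by (simp add: bochner_def)
  then have "integrable M (\<lambda>x. norm (f x - g x))"
    by (rule Bochner_Integration.integrable_bound)
      (simp_all add: strongly_measurable_norm[OF sm] norm_triangle_ineq4)
  with sm show ?thesis by (simp add: bochner_def)
qed

lemma bochner_sum:
  "(\<And>i. i \<in> I \<Longrightarrow> bochner M (f i)) \<Longrightarrow> bochner M (\<lambda>x. \<Sum>i\<in>I. f i x)"
proof (induction I rule: infinite_finite_induct)
  case (insert i I)
  then show ?case by (simp add: bochner_add)
qed (auto simp: bochner_def strongly_measurable_simple)

lemma bochner_bounded_linear:
  assumes "bounded_linear T" "bochner M f"
  shows "bochner M (\<lambda>x. T (f x))"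
proof -
  obtain K where K: "K > 0" "\<forall>x. norm (T x) \<le> norm x * K"
    using bounded_linear.pos_bounded[OF assms(1)] by (elim exE conjE)
  have sm: "strongly_measurable M (\<lambda>x. T (f x))"
    using assms by (simp add: strongly_measurable_bounded_linear bochner_def)
  have "integrable M (\<lambda>x. norm (f x) * K)" using assms(2) by (auto simp: bochner_def)
  then have "integrable M (\<lambda>x. norm (T (f x)))"
    by (rule Bochner_Integration.integrable_bound)
      (use K strongly_measurable_norm[OF sm] in \<open>simp_all add: abs_mult\<close>)
  with sm show ?thesis by (simp add: bochner_def)
qed

lemma bochner_scaleC_bounded:
  fixes f :: "'m \<Rightarrow> 'a::complex_banach"
  assumes "bochner M f" "g \<in> borel_measurable M" "\<And>x. x \<in> space M \<Longrightarrow> cmod (g x) \<le> B"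
  shows "bochner M (\<lambda>x. g x *\<^sub>C f x)"
proof -
  have sm: "strongly_measurable M (\<lambda>x. g x *\<^sub>C f x)"
    using assms by (auto simp: bochner_def strongly_measurable_scaleC)
  have "integrable M (\<lambda>x. \<bar>B\<bar> * norm (f x))" using assms(1) by (auto simp: bochner_def)
  then have "integrable M (\<lambda>x. norm (g x *\<^sub>C f x))"
  proof (rule Bochner_Integration.integrable_bound)
    show "AE x in M. norm (norm (g x *\<^sub>C f x)) \<le> norm (\<bar>B\<bar> * norm (f x))"
      using order_trans[OF assms(3) abs_ge_self]
      by (intro AE_I2) (simp add: norm_scaleC abs_mult mult_right_mono)
  qed (rule strongly_measurable_norm[OF sm])
  with sm show ?thesis by (simp add: bochner_def)
qed

lemma bochner_scaleC_const:
  fixes x :: "'a::complex_banach"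
  assumes "integrable M g"
  shows "bochner M (\<lambda>w. g w *\<^sub>C x)"
  by (rule bochner_bounded_linear[OF bounded_linear_scaleC_left])
    (use assms in \<open>auto simp: bochner_def strongly_measurable_iff_borel_measurable\<close>)

section \<open>The Bochner integral on a finite measure space\<close>

context finite_measure
begin

abbreviation (input) "SBI \<equiv> Bochner_Integration.simple_bochner_integral M"

lemma simple_bochner_integrable_simple:
  "simple_function M s \<Longrightarrow> Bochner_Integration.simple_bochner_integrable M s"
  using emeasure_finite by (auto simp: Bochner_Integration.simple_bochner_integrable.simps)

lemma bochner_simple: "simple_function M s \<Longrightarrow> bochner M s"
  unfolding bochner_def
  by (intro conjI strongly_measurable_simple integrableI_simple_bochner_integrable
        simple_bochner_integrable_simple simple_function_compose1[where g=norm])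

lemma norm_simple_integral_le:
  assumes "simple_function M s"
  shows "norm (SBI s) \<le> (\<integral>x. norm (s x) \<partial>M)"
proof -
  have "norm (SBI s) \<le> SBI (\<lambda>x. norm (s x))"
    using assms by (intro simple_bochner_integral_norm_bound simple_bochner_integrable_simple)
  also have "\<dots> = (\<integral>x. norm (s x) \<partial>M)"
    using assms
    by (intro simple_bochner_integrable_eq_integral simple_bochner_integrable_simple simple_function_compose1[where g=norm])
  finally show ?thesis .
qed

text \<open>Since \<open>norm (f x)\<close> is not simple, the cutoff uses simple functions increasing to it.\<close>

lemma bochner_approx:
  assumes "bochner M f"
  shows "\<exists>s. (\<forall>i::nat. simple_function M (s i)) \<and> (\<lambda>i. \<integral>x. norm (f x - s i x) \<partial>M) \<longlonglongrightarrow> 0"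
proof -
  obtain s where s: "\<And>i::nat. simple_function M (s i)" "\<And>x. x \<in> space M \<Longrightarrow> (\<lambda>i. s i x) \<longlonglongrightarrow> f x"
    using assms unfolding bochner_def strongly_measurable_def by blast
  have nf: "(\<lambda>x. norm (f x)) \<in> borel_measurable M" "integrable M (\<lambda>x. norm (f x))"
    using assms by (auto simp: bochner_def)
  obtain g where g: "\<And>i. simple_function M (g i)" "\<And>x. x \<in> space M \<Longrightarrow> (\<lambda>i. g i x) \<longlonglongrightarrow> norm (f x)"
      "\<And>i x. x \<in> space M \<Longrightarrow> norm (g i x) \<le> 2 * norm (norm (f x))"
    using borel_measurable_implies_sequence_metric[OF nf(1), of 0] unfolding dist_0_norm dist_norm diff_zero by blast
  define t where "t i x = (if norm (s i x) \<le> 2 * g i x then s i x else 0)" for i x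
  have t: "simple_function M (t i)" for i
    unfolding t_def by (rule simple_function_compose2[OF s(1) g(1), where h="\<lambda>a b. if norm a \<le> 2 * b then a else 0"])
  have lim: "(\<lambda>i. t i x) \<longlonglongrightarrow> f x" if x: "x \<in> space M" for x
  proof (cases "f x = 0")
    case True
    have "(\<lambda>i. norm (s i x)) \<longlonglongrightarrow> 0" using s(2)[OF x] True tendsto_norm by fastforce
    then have "(\<lambda>i. norm (t i x)) \<longlonglongrightarrow> 0"
      by (rule Lim_null_comparison[rotated]) (auto simp: t_def)
    then show ?thesis using True tendsto_norm_zero_iff by fastforce
  next
    case False
    have "(\<lambda>i. 2 * g i x - norm (s i x)) \<longlonglongrightarrow> 2 * norm (f x) - norm (f x)"
      by (intro tendsto_intros g(2) s(2) x)
    then have "eventually (\<lambda>i. 2 * g i x - norm (s i x) > 0) sequentially"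
      using False by (intro order_tendstoD(1)) auto
    then have "eventually (\<lambda>i. s i x = t i x) sequentially"
      by eventually_elim (auto simp: t_def)
    then show ?thesis using s(2)[OF x] by (rule Lim_transform_eventually[rotated])
  qed
  \<comment> \<open>The dominating function: \<open>g i x\<close> stays below
    \<open>2 * norm (f x)\<close>, so the cutoff at \<open>2 * g i x\<close> leaves at most
    \<open>4 * norm (f x)\<close> for \<open>t i x\<close>.\<close>
  have tb: "norm (f x - t i x) \<le> 5 * norm (f x)" if "x \<in> space M" for i x
  proof -
    have "norm (t i x) \<le> 4 * norm (f x)"
      using g(3)[OF that, of i] by (auto simp: t_def)
    then show ?thesis using norm_triangle_ineq4[of "f x" "t i x"] by simp
  qed
  have "(\<lambda>i. \<integral>x. norm (f x - t i x) \<partial>M) \<longlonglongrightarrow> (\<integral>x. 0 \<partial>M)"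
  proof (rule integral_dominated_convergence[where w="\<lambda>x. 5 * norm (f x)"])
    show "AE x in M. (\<lambda>i. norm (f x - t i x)) \<longlonglongrightarrow> 0"
    proof (intro AE_I2 tendsto_norm_zero)
      fix x assume "x \<in> space M"
      from tendsto_diff[OF tendsto_const[of "f x"] lim[OF this]]
      show "(\<lambda>i. f x - t i x) \<longlonglongrightarrow> 0" by simp
    qed
    show "(\<lambda>x. norm (f x - t i x)) \<in> borel_measurable M" for i
      using assms t by (intro strongly_measurable_norm strongly_measurable_diff) (auto simp: bochner_def strongly_measurable_simple)
  qed (use nf tb in auto)
  then show ?thesis using t by auto
qed

text \<open>On a finite measure space every simple function is integrable and all the errors are
  finite, so the extended integrals of the definition turn into real ones. The rules below are
  derived from this form.\<close>

lemma has_strong_integral_iff: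
  assumes "bochner M f"
  shows "has_strong_integral M f x \<longleftrightarrow> (\<exists>s. (\<forall>i::nat. simple_function M (s i)) \<and>
    (\<lambda>i. \<integral>y. norm (f y - s i y) \<partial>M) \<longlonglongrightarrow> 0 \<and> (\<lambda>i. SBI (s i)) \<longlonglongrightarrow> x)"
proof -
  have *: "(\<integral>\<^sup>+ y. ennreal (norm (f y - s y)) \<partial>M) = ennreal (\<integral>y. norm (f y - s y) \<partial>M)"
    if "simple_function M s" for s
    using bochner_diff[OF assms bochner_simple[OF that]]
    by (intro nn_integral_eq_integral) (auto simp: bochner_def)
  have **: "Bochner_Integration.simple_bochner_integrable M s \<longleftrightarrow> simple_function M s" for s :: "'a \<Rightarrow> 'b"
    using simple_bochner_integrable_simple by (auto simp: Bochner_Integration.simple_bochner_integrable.simps)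
  have ***: "(\<lambda>i. ennreal (a i)) \<longlonglongrightarrow> 0 \<longleftrightarrow> a \<longlonglongrightarrow> 0" if "\<And>i. 0 \<le> a i" for a :: "nat \<Rightarrow> real"
    using tendsto_ennreal_iff[of a sequentially 0] that by simp
  show ?thesis
    using assms unfolding has_strong_integral_def bochner_def **
    by (auto simp: * ***)
qed

text \<open>Serves twice: with two members of one approximating sequence it gives the Cauchy
  property, hence existence of the integral; with \<open>t\<close> equal to zero it gives the norm
  bound.\<close>

lemma SBI_diff_le:
  assumes "bochner M f" "simple_function M s" "simple_function M t"
  shows "norm (SBI s - SBI t) \<le> (\<integral>x. norm (f x - s x) \<partial>M) + (\<integral>x. norm (f x - t x) \<partial>M)"
proof -
  note b = bochner_diff[OF assms(1) bochner_simple[OF assms(2)]] bochner_diff[OF assms(1) bochner_simple[OF assms(3)]]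
  have st: "simple_function M (\<lambda>x. s x - t x)" using simple_function_compose2[OF assms(2,3), of "(-)"] .
  have "SBI s - SBI t = SBI (\<lambda>x. s x - t x)"
    using assms by (simp add: simple_bochner_integral_diff simple_bochner_integrable_simple)
  also have "norm \<dots> \<le> (\<integral>x. norm (s x - t x) \<partial>M)"
    by (intro norm_simple_integral_le st)
  also have "\<dots> \<le> (\<integral>x. norm (f x - s x) + norm (f x - t x) \<partial>M)"
    using bochner_simple[OF st] b unfolding bochner_def
    by (intro integral_mono Bochner_Integration.integrable_add) (auto, metis norm_diff_triangle_le norm_minus_commute order.refl)
  also have "\<dots> = (\<integral>x. norm (f x - s x) \<partial>M) + (\<integral>x. norm (f x - t x) \<partial>M)"
    using b by (intro Bochner_Integration.integral_add) (auto simp: bochner_def)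
  finally show ?thesis .
qed

lemma has_strong_integral_ex:
  fixes f :: "'a \<Rightarrow> 'b::banach"
  assumes "bochner M f"
  shows "\<exists>x. has_strong_integral M f x"
proof -
  obtain s where s: "\<And>i::nat. simple_function M (s i)" "(\<lambda>i. \<integral>x. norm (f x - s i x) \<partial>M) \<longlonglongrightarrow> 0"
    using bochner_approx[OF assms] by blast
  have "Cauchy (\<lambda>i. SBI (s i))"
  proof (rule metric_CauchyI)
    fix e :: real assume "e > 0"
    then obtain N where N: "\<And>n. n \<ge> N \<Longrightarrow> (\<integral>x. norm (f x - s n x) \<partial>M) < e / 2"
      using order_tendstoD(2)[OF s(2), of "e/2"] by (auto simp: eventually_sequentially)
    have "dist (SBI (s m)) (SBI (s n)) < e" if "m \<ge> N" "n \<ge> N" for m n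
      using SBI_diff_le[OF assms s(1) s(1), of m n] N[OF that(1)] N[OF that(2)] by (simp add: dist_norm)
    then show "\<exists>N. \<forall>m\<ge>N. \<forall>n\<ge>N. dist (SBI (s m)) (SBI (s n)) < e" by blast
  qed
  then obtain x where "(\<lambda>i. SBI (s i)) \<longlonglongrightarrow> x"
    using Cauchy_convergent_iff convergent_def by blast
  then show ?thesis using s by (auto simp: has_strong_integral_iff[OF assms])
qed

lemma has_strong_integral_norm_le:
  assumes "bochner M f" "has_strong_integral M f x"
  shows "norm x \<le> (\<integral>y. norm (f y) \<partial>M)"
proof -
  obtain s where s: "\<And>i::nat. simple_function M (s i)" "(\<lambda>i. \<integral>x. norm (f x - s i x) \<partial>M) \<longlonglongrightarrow> 0"
      "(\<lambda>i. SBI (s i)) \<longlonglongrightarrow> x"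
    using assms by (auto simp: has_strong_integral_iff[OF assms(1)])
  have "norm (SBI (s i)) \<le> (\<integral>x. norm (f x - s i x) \<partial>M) + (\<integral>y. norm (f y) \<partial>M)" for i
    using SBI_diff_le[OF assms(1) s(1), of "\<lambda>_. 0" i]
    by (simp add: simple_bochner_integral_def sum.neutral)
  then have "norm x \<le> 0 + (\<integral>y. norm (f y) \<partial>M)"
    by (intro LIMSEQ_le[OF tendsto_norm[OF s(3)] tendsto_add[OF s(2) tendsto_const]]) auto
  then show ?thesis by simp
qed

lemma has_strong_integral_add:
  assumes "bochner M f" "bochner M g" "has_strong_integral M f x" "has_strong_integral M g y"
  shows "has_strong_integral M (\<lambda>w. f w + g w) (x + y)"
proof -
  obtain s where s: "\<And>i::nat. simple_function M (s i)" "(\<lambda>i. \<integral>x. norm (f x - s i x) \<partial>M) \<longlonglongrightarrow> 0"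
      "(\<lambda>i. SBI (s i)) \<longlonglongrightarrow> x"
    using assms by (auto simp: has_strong_integral_iff)
  obtain t where t: "\<And>i::nat. simple_function M (t i)" "(\<lambda>i. \<integral>x. norm (g x - t i x) \<partial>M) \<longlonglongrightarrow> 0"
      "(\<lambda>i. SBI (t i)) \<longlonglongrightarrow> y"
    using assms by (auto simp: has_strong_integral_iff)
  have st: "simple_function M (\<lambda>w. s i w + t i w)" for i
    using simple_function_compose2[OF s(1) t(1), of "(+)"] .
  note b = bochner_diff[OF assms(1) bochner_simple[OF s(1)]] bochner_diff[OF assms(2) bochner_simple[OF t(1)]]
    bochner_diff[OF bochner_add[OF assms(1,2)] bochner_simple[OF st]]
  have le: "(\<integral>w. norm (f w + g w - (s i w + t i w)) \<partial>M)
      \<le> (\<integral>w. norm (f w - s i w) \<partial>M) + (\<integral>w. norm (g w - t i w) \<partial>M)" for i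
  proof -
    have "(\<integral>w. norm (f w + g w - (s i w + t i w)) \<partial>M)
        \<le> (\<integral>w. norm (f w - s i w) + norm (g w - t i w) \<partial>M)"
      using b unfolding bochner_def
      by (intro integral_mono Bochner_Integration.integrable_add norm_diff_triangle_ineq) auto
    then show ?thesis
      using b by (simp add: bochner_def Bochner_Integration.integral_add)
  qed
  have "(\<lambda>i. \<integral>w. norm (f w + g w - (s i w + t i w)) \<partial>M) \<longlonglongrightarrow> 0"
    by (rule Lim_null_comparison[OF _ tendsto_add_zero[OF s(2) t(2)]]) (use le in auto)
  moreover have "(\<lambda>i. SBI (\<lambda>w. s i w + t i w)) \<longlonglongrightarrow> x + y"
    using tendsto_add[OF s(3) t(3)] s(1) t(1)
    by (simp add: simple_bochner_integral_add simple_bochner_integrable_simple)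
  ultimately show ?thesis
    using st unfolding has_strong_integral_iff[OF bochner_add[OF assms(1,2)]]
    by (intro exI[of _ "\<lambda>i w. s i w + t i w"]) simp
qed

lemma has_strong_integral_bounded_linear:
  assumes "bounded_linear T" "bochner M f" "has_strong_integral M f x"
  shows "has_strong_integral M (\<lambda>w. T (f w)) (T x)"
proof -
  obtain K where K: "K > 0" "\<forall>x. norm (T x) \<le> norm x * K"
    using bounded_linear.pos_bounded[OF assms(1)] by (elim exE conjE)
  interpret T: bounded_linear T by fact
  obtain s where s: "\<And>i::nat. simple_function M (s i)" "(\<lambda>i. \<integral>x. norm (f x - s i x) \<partial>M) \<longlonglongrightarrow> 0"
      "(\<lambda>i. SBI (s i)) \<longlonglongrightarrow> x"
    using assms by (auto simp: has_strong_integral_iff)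
  have Ts: "simple_function M (\<lambda>w. T (s i w))" for i using s(1) by (rule simple_function_compose1)
  note b = bochner_diff[OF assms(2) bochner_simple[OF s(1)]]
    bochner_diff[OF bochner_bounded_linear[OF assms(1,2)] bochner_simple[OF Ts]]
  have le: "(\<integral>w. norm (T (f w) - T (s i w)) \<partial>M) \<le> (\<integral>w. norm (f w - s i w) \<partial>M) * K" for i
  proof -
    have "(\<integral>w. norm (T (f w) - T (s i w)) \<partial>M) \<le> (\<integral>w. norm (f w - s i w) * K \<partial>M)"
      using b K unfolding bochner_def
      by (intro integral_mono) (auto simp flip: T.diff)
    then show ?thesis by simp
  qed
  have "(\<lambda>i. \<integral>w. norm (T (f w) - T (s i w)) \<partial>M) \<longlonglongrightarrow> 0"
    by (rule Lim_null_comparison[OF _ tendsto_mult_left_zero[OF s(2), of K]]) (use le in auto)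
  moreover have "(\<lambda>i. SBI (\<lambda>w. T (s i w))) \<longlonglongrightarrow> T x"
    using T.tendsto[OF s(3)] s(1)
    by (simp add: simple_bochner_integral_linear T.linear_axioms simple_bochner_integrable_simple)
  ultimately show ?thesis
    using Ts unfolding has_strong_integral_iff[OF bochner_bounded_linear[OF assms(1,2)]]
    by (intro exI[of _ "\<lambda>i w. T (s i w)"]) simp
qed

text \<open>The difference of two values is a value of the integral of \<open>f w + - f w\<close>,
  to which the norm bound applies.\<close>

lemma has_strong_integral_unique:
  assumes "bochner M f" "has_strong_integral M f x" "has_strong_integral M f y"
  shows "x = y"
proof -
  have n: "bounded_linear (\<lambda>x::'b. - x)" by (simp add: bounded_linear_minus bounded_linear_ident)
  have "has_strong_integral M (\<lambda>w. f w + - f w) (x + - y)"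
    by (rule has_strong_integral_add[OF assms(1) bochner_bounded_linear[OF n assms(1)] assms(2)
          has_strong_integral_bounded_linear[OF n assms(1,3)]])
  from has_strong_integral_norm_le[OF bochner_add[OF assms(1) bochner_bounded_linear[OF n assms(1)]] this]
  have "norm (x + - y) \<le> (\<integral>w. norm (f w + - f w) \<partial>M)" .
  then show ?thesis by simp
qed

lemma strong_integral_eqI:
  "bochner M f \<Longrightarrow> has_strong_integral M f x \<Longrightarrow> strong_integral M f = x"
  unfolding strong_integral_def using has_strong_integral_unique by auto

lemma has_strong_integral_strong_integral:
  "bochner M (f :: 'a \<Rightarrow> 'b::banach) \<Longrightarrow> has_strong_integral M f (strong_integral M f)"
  using has_strong_integral_ex strong_integral_eqI by metis

lemma strong_integral_add:
  "bochner M (f :: 'a \<Rightarrow> 'b::banach) \<Longrightarrow> bochner M g \<Longrightarrow>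
    strong_integral M (\<lambda>w. f w + g w) = strong_integral M f + strong_integral M g"
  by (intro strong_integral_eqI has_strong_integral_add bochner_add has_strong_integral_strong_integral)

lemma strong_integral_bounded_linear:
  "bounded_linear T \<Longrightarrow> bochner M (f :: 'a \<Rightarrow> 'b::banach) \<Longrightarrow>
    strong_integral M (\<lambda>w. T (f w)) = T (strong_integral M f)"
  by (metis strong_integral_eqI has_strong_integral_bounded_linear bochner_bounded_linear has_strong_integral_strong_integral)

lemma strong_integral_norm_le:
  "bochner M (f :: 'a \<Rightarrow> 'b::banach) \<Longrightarrow> norm (strong_integral M f) \<le> (\<integral>w. norm (f w) \<partial>M)"
  by (intro has_strong_integral_norm_le has_strong_integral_strong_integral)

lemma strong_integral_zero [simp]: "strong_integral M (\<lambda>_. 0 :: 'b::banach) = 0"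
  using strong_integral_norm_le[of "\<lambda>_. 0 :: 'b"] by (simp add: bochner_simple)

lemma strong_integral_diff:
  assumes "bochner M (f :: 'a \<Rightarrow> 'b::banach)" "bochner M g"
  shows "strong_integral M (\<lambda>w. f w - g w) = strong_integral M f - strong_integral M g"
  using strong_integral_add[OF bochner_diff[OF assms] assms(2)] by simp

lemma strong_integral_sum:
  "(\<And>i. i \<in> I \<Longrightarrow> bochner M (f i :: 'a \<Rightarrow> 'b::banach)) \<Longrightarrow>
    strong_integral M (\<lambda>w. \<Sum>i\<in>I. f i w) = (\<Sum>i\<in>I. strong_integral M (f i))"
  by (induction I rule: infinite_finite_induct) (auto simp: strong_integral_add bochner_sum)

lemma strong_integral_scaleC:
  "bochner M (f :: 'a \<Rightarrow> 'b::complex_banach) \<Longrightarrow>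
    strong_integral M (\<lambda>w. c *\<^sub>C f w) = c *\<^sub>C strong_integral M f"
  by (rule strong_integral_bounded_linear[OF bounded_linear_scaleC_right])

lemma strong_integral_scaleC_const:
  fixes x :: "'b::complex_banach"
  assumes "integrable M g"
  shows "strong_integral M (\<lambda>w. g w *\<^sub>C x) = (\<integral>w. g w \<partial>M) *\<^sub>C x"
proof -
  have "bochner M g" using assms by (auto simp: bochner_def strongly_measurable_iff_borel_measurable)
  then show ?thesis
    using strong_integral_bounded_linear[OF bounded_linear_scaleC_left, of g x]
    by (simp add: strong_integral_eq_lebesgue_integral)
qed

lemma strong_integral_cong:
  assumes "\<And>w. w \<in> space M \<Longrightarrow> f w = g w"
  shows "strong_integral M f = strong_integral M g"
proof -
  have "has_strong_integral M f x = has_strong_integral M g x" for x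
    unfolding has_strong_integral_def using assms
    by (simp add: strongly_measurable_cong[OF assms] cong: nn_integral_cong_simp)
  then have "has_strong_integral M f = has_strong_integral M g" by blast
  then show ?thesis by (simp add: strong_integral_def)
qed

text \<open>A simple \<open>s\<close> close to \<open>F\<close> in mean has almost vanishing integral over each of its level
  sets, so that the integral of \<open>norm s\<close> is small.\<close>

lemma integral_norm_eq_0:
  fixes F :: "'a \<Rightarrow> 'b::complex_banach"
  assumes F: "bochner M F"
    and 0: "\<And>E. E \<in> sets M \<Longrightarrow> strong_integral M (\<lambda>w. indicator E w *\<^sub>C F w) = 0"
  shows "(\<integral>w. norm (F w) \<partial>M) = 0"
proof -
  obtain s where s: "\<And>i::nat. simple_function M (s i)" "(\<lambda>i. \<integral>x. norm (F x - s i x) \<partial>M) \<longlonglongrightarrow> 0"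
    using bochner_approx[OF F] by blast
  have sF: "bochner M (\<lambda>w. F w - s i w)" for i
    by (intro bochner_diff F bochner_simple s(1))
  have key: "(\<integral>w. norm (s i w) \<partial>M) \<le> (\<integral>w. norm (F w - s i w) \<partial>M)" for i
  proof -
    define E where "E v = {w \<in> space M. s i w = v}" for v
    have E: "E v \<in> sets M" for v
      unfolding E_def using simple_functionD(2)[OF s(1), of i "{v}"] by (simp add: vimage_def Int_def conj_commute)
    have fin: "finite (s i ` space M)" using s(1) by (rule simple_functionD)
    have ind: "(\<lambda>w. indicator (E v) w :: complex) \<in> borel_measurable M" for v
      using E by measurable
    have 1: "(\<integral>w. indicator (E v) w * norm (s i w) \<partial>M) \<le> (\<integral>w. indicator (E v) w * norm (F w - s i w) \<partial>M)" for v
    proof -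
      have sv: "(\<lambda>w. indicator (E v) w *\<^sub>C s i w) = (\<lambda>w. indicator (E v) w *\<^sub>C v)"
        by (auto simp: fun_eq_iff E_def indicator_def)
      have b: "bochner M (\<lambda>w. indicator (E v) w *\<^sub>C F w)" "bochner M (\<lambda>w. indicator (E v) w *\<^sub>C s i w)"
         "bochner M (\<lambda>w. indicator (E v) w *\<^sub>C (F w - s i w))"
        by (intro bochner_scaleC_bounded[where B=1] F bochner_simple s(1) ind sF; auto simp: indicator_def)+
      have "(\<integral>w. indicator (E v) w * norm (s i w) \<partial>M) = (\<integral>w. indicator (E v) w * norm v \<partial>M)"
        by (rule Bochner_Integration.integral_cong) (auto simp: E_def indicator_def)
      also have "\<dots> = measure M (E v) * norm v"
        using E by simp
      also have "\<dots> = norm ((\<integral>w. indicator (E v) w \<partial>M :: complex) *\<^sub>C v)"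
      proof -
        have "(\<integral>w. indicator (E v) w \<partial>M :: complex) = (\<integral>w. complex_of_real (indicator (E v) w) \<partial>M)"
          by (rule Bochner_Integration.integral_cong) (auto simp: indicator_def)
        also have "\<dots> = complex_of_real (measure M (E v))"
          using E by (subst integral_complex_of_real) simp
        finally show ?thesis by (simp add: norm_scaleC)
      qed
      also have "\<dots> = norm (strong_integral M (\<lambda>w. indicator (E v) w *\<^sub>C s i w))"
      proof -
        have "integrable M (\<lambda>w. indicator (E v) w :: complex)"
          using ind by (rule integrable_const_bound[where B=1, rotated]) (simp add: indicator_def)
        from strong_integral_scaleC_const[OF this, of v] show ?thesis unfolding sv by simp
      qed
      also have "\<dots> = norm (strong_integral M (\<lambda>w. indicator (E v) w *\<^sub>C F w)
           - strong_integral M (\<lambda>w. indicator (E v) w *\<^sub>C s i w))"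
        using 0[OF E] by simp
      also have "\<dots> = norm (strong_integral M (\<lambda>w. indicator (E v) w *\<^sub>C (F w - s i w)))"
      proof -
        have "(\<lambda>w. indicator (E v) w *\<^sub>C (F w - s i w))
            = (\<lambda>w. indicator (E v) w *\<^sub>C F w - indicator (E v) w *\<^sub>C s i w)"
          by (simp add: scaleC_diff_right)
        then show ?thesis by (simp add: strong_integral_diff[OF b(1,2)])
      qed
      also have "\<dots> \<le> (\<integral>w. norm (indicator (E v) w *\<^sub>C (F w - s i w)) \<partial>M)"
        by (rule strong_integral_norm_le[OF b(3)])
      also have "\<dots> = (\<integral>w. indicator (E v) w * norm (F w - s i w) \<partial>M)"
        by (rule Bochner_Integration.integral_cong) (auto simp: norm_scaleC indicator_def)
      finally show ?thesis .
    qed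
    have 2: "(\<integral>w. h w \<partial>M) = (\<Sum>v\<in>s i ` space M. \<integral>w. indicator (E v) w * h w \<partial>M)"
      if "integrable M h" for h :: "'a \<Rightarrow> real"
    proof -
      have "(\<integral>w. h w \<partial>M) = (\<integral>w. (\<Sum>v\<in>s i ` space M. indicator (E v) w * h w) \<partial>M)"
      proof (rule Bochner_Integration.integral_cong)
        fix w assume "w \<in> space M"
        then have "(\<Sum>v\<in>s i ` space M. indicator (E v) w * h w) = (\<Sum>v\<in>{s i w}. h w)"
          by (intro sum.mono_neutral_cong_right fin) (auto simp: E_def indicator_def)
        then show "h w = (\<Sum>v\<in>s i ` space M. indicator (E v) w * h w)" by simp
      qed simp
      also have "\<dots> = (\<Sum>v\<in>s i ` space M. \<integral>w. indicator (E v) w * h w \<partial>M)"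
        using E that by (intro Bochner_Integration.integral_sum) (auto intro: integrable_real_mult_indicator simp: mult.commute)
      finally show ?thesis .
    qed
    show ?thesis
      using bochner_simple[OF s(1)] sF 1 unfolding bochner_def
      by (subst (1 2) 2) (auto intro!: sum_mono)
  qed
  have "(\<integral>w. norm (F w) \<partial>M) \<le> 2 * (\<integral>w. norm (F w - s i w) \<partial>M)" for i
  proof -
    have "(\<integral>w. norm (F w) \<partial>M) \<le> (\<integral>w. norm (F w - s i w) + norm (s i w) \<partial>M)"
      using F sF[of i] bochner_simple[OF s(1)] unfolding bochner_def
      by (intro integral_mono Bochner_Integration.integrable_add) (auto, metis norm_triangle_sub add.commute)
    also have "\<dots> = (\<integral>w. norm (F w - s i w) \<partial>M) + (\<integral>w. norm (s i w) \<partial>M)"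
      using sF[of i] bochner_simple[OF s(1)] by (simp add: bochner_def)
    finally show ?thesis using key[of i] by simp
  qed
  then have "(\<integral>w. norm (F w) \<partial>M) \<le> 2 * 0"
    by (intro LIMSEQ_le[OF tendsto_const tendsto_mult[OF tendsto_const s(2)]]) auto
  then show ?thesis by (simp add: antisym integral_nonneg)
qed

end

section \<open>Averages over finite sets\<close>

definition avg :: "'b set \<Rightarrow> ('b \<Rightarrow> real) \<Rightarrow> real" where
  "avg W F = (\<Sum>w\<in>W. F w) / real (card W)"

lemma avg_mono: "(\<And>w. w \<in> W \<Longrightarrow> F w \<le> G w) \<Longrightarrow> avg W F \<le> avg W G"
  unfolding avg_def by (intro divide_right_mono sum_mono) auto

lemma avg_cong: "(\<And>w. w \<in> W \<Longrightarrow> F w = G w) \<Longrightarrow> avg W F = avg W G"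
  unfolding avg_def by simp

lemma avg_nonneg: "(\<And>w. w \<in> W \<Longrightarrow> 0 \<le> F w) \<Longrightarrow> 0 \<le> avg W F"
  unfolding avg_def by (intro divide_nonneg_nonneg sum_nonneg) auto

lemma avg_const: "finite W \<Longrightarrow> W \<noteq> {} \<Longrightarrow> avg W (\<lambda>_. c) = c"
  unfolding avg_def by simp

lemma avg_add: "avg W (\<lambda>w. F w + G w) = avg W F + avg W G"
  unfolding avg_def by (simp add: sum.distrib add_divide_distrib)

lemma avg_cmult: "avg W (\<lambda>w. c * F w) = c * avg W F"
  unfolding avg_def by (simp add: sum_distrib_left)

lemma avg_sum: "avg W (\<lambda>w. \<Sum>i\<in>I. F i w) = (\<Sum>i\<in>I. avg W (F i))"
  unfolding avg_def by (simp add: sum_divide_distrib sum.swap[of _ I])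

lemma avg_swap: "avg W (\<lambda>w. avg W' (\<lambda>w'. F w w')) = avg W' (\<lambda>w'. avg W (\<lambda>w. F w w'))"
  unfolding avg_def by (simp add: sum_divide_distrib[symmetric] sum.swap[of _ W'] mult.commute)

lemma avg_bij: "bij_betw g W W \<Longrightarrow> avg W (\<lambda>w. F (g w)) = avg W F"
  unfolding avg_def by (simp add: sum.reindex_bij_betw)

lemma avg_reindex: "bij_betw g W W' \<Longrightarrow> avg W (\<lambda>w. F (g w)) = avg W' F"
  unfolding avg_def by (simp add: sum.reindex_bij_betw bij_betw_same_card)

lemma norm_sum_le_avg:
  "norm ((1 / real (card W)) *\<^sub>R (\<Sum>w\<in>W. f w)) \<le> avg W (\<lambda>w. norm (f w))"
  by (simp add: avg_def divide_right_mono norm_sum)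

text \<open>Convexity of the power through its tangent at \<open>b\<close>. Taken at a mean value
  and averaged, it yields Jensen's inequality for sums, for integrals and for weighted integrals
  alike.\<close>

lemma powr_tangent:
  fixes a b t :: real
  assumes "a \<ge> 0" "b \<ge> 0" "t \<ge> 1"
  shows "b powr t + t * b powr (t - 1) * (a - b) \<le> a powr t"
proof (cases "b = 0")
  case False
  then have b: "b > 0" using assms by simp
  \<comment> \<open>Bernoulli's inequality, from Young's inequality with weights
    \<open>1 / t\<close> and \<open>1 - 1 / t\<close> applied to \<open>x powr t\<close> and 1. The
    general case follows by scaling with \<open>b\<close>.\<close>
  have *: "1 + t * (x - 1) \<le> x powr t" if "x \<ge> 0" for x :: real
  proof (cases "x = 0")
    case False
    then have "(x powr t) powr (1 / t) * 1 powr (1 - 1 / t) \<le> (1 / t) * (x powr t) + (1 - 1 / t) * 1"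
      using that assms by (intro Youngs_inequality_0) auto
    then have "x \<le> (1 / t) * (x powr t) + (1 - 1 / t)"
      using that assms False by (simp add: powr_powr)
    then have "t * x \<le> t * ((1 / t) * (x powr t) + (1 - 1 / t))"
      using assms by (intro mult_left_mono) auto
    also have "\<dots> = x powr t + (t - 1)" using assms by (simp add: distrib_left right_diff_distrib)
    finally show ?thesis by (simp add: algebra_simps)
  qed (use assms in auto)
  have "b powr t * (1 + t * (a / b - 1)) \<le> b powr t * (a / b) powr t"
    using assms b by (intro mult_left_mono *) auto
  moreover have "b powr t * (a / b) powr t = a powr t"
    using assms b by (simp add: powr_divide)
  moreover have "b powr t * (1 + t * (a / b - 1)) = b powr t + t * b powr (t - 1) * (a - b)"
    using b by (simp add: powr_diff field_simps)
  ultimately show ?thesis by simp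
\<comment> \<open>For \<open>b = 0\<close> the left side is 0, because \<open>0 powr _\<close> is 0
  even for the exponent 0 that occurs when \<open>t = 1\<close>.\<close>
qed (use assms in auto)

text \<open>Jensen's inequality: at the weighted mean the linear terms of the tangents
  cancel.\<close>

lemma powr_sum_le:
  fixes w a :: "'b \<Rightarrow> real"
  assumes "\<And>i. i \<in> A \<Longrightarrow> w i \<ge> 0" "\<And>i. i \<in> A \<Longrightarrow> a i \<ge> 0" "sum w A = 1" "t \<ge> 1"
  shows "(\<Sum>i\<in>A. w i * a i) powr t \<le> (\<Sum>i\<in>A. w i * a i powr t)"
proof -
  define b where "b = (\<Sum>i\<in>A. w i * a i)"
  have b: "b \<ge> 0" unfolding b_def using assms by (intro sum_nonneg) auto
  have "b powr t = (\<Sum>i\<in>A. w i * (b powr t + t * b powr (t - 1) * (a i - b)))"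
  proof -
    have "(\<Sum>i\<in>A. w i * (b powr t + t * b powr (t - 1) * (a i - b)))
        = sum w A * b powr t + t * b powr (t - 1) * ((\<Sum>i\<in>A. w i * a i) - sum w A * b)"
      by (simp add: sum.distrib sum_subtractf sum_distrib_left sum_distrib_right algebra_simps)
    then show ?thesis using assms by (simp add: b_def)
  qed
  also have "\<dots> \<le> (\<Sum>i\<in>A. w i * a i powr t)"
    using assms b by (intro sum_mono mult_left_mono powr_tangent) auto
  finally show ?thesis unfolding b_def .
qed

lemma avg_powr_le:
  assumes "finite W" "W \<noteq> {}" "\<And>w. w \<in> W \<Longrightarrow> F w \<ge> 0" "t \<ge> 1"
  shows "(avg W F) powr t \<le> avg W (\<lambda>w. F w powr t)"
proof -
  have "(\<Sum>w\<in>W. (1 / card W) * F w) powr t \<le> (\<Sum>w\<in>W. (1 / card W) * F w powr t)"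
    using assms by (intro powr_sum_le) auto
  then show ?thesis by (simp add: avg_def sum_divide_distrib)
qed

lemma avg_powr_mono_exponent:
  assumes "finite W" "W \<noteq> {}" "\<And>w. w \<in> W \<Longrightarrow> F w \<ge> 0" "0 < s" "s \<le> t"
  shows "(avg W (\<lambda>w. F w powr s)) powr (1 / s) \<le> (avg W (\<lambda>w. F w powr t)) powr (1 / t)"
proof -
  have "(avg W (\<lambda>w. F w powr s)) powr (t / s) \<le> avg W (\<lambda>w. (F w powr s) powr (t / s))"
    using assms by (intro avg_powr_le) auto
  also have "\<dots> = avg W (\<lambda>w. F w powr t)"
    using assms by (intro avg_cong) (simp add: powr_powr)
  finally have "((avg W (\<lambda>w. F w powr s)) powr (t / s)) powr (1 / t) \<le> (avg W (\<lambda>w. F w powr t)) powr (1 / t)"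
    using assms by (intro powr_mono2) auto
  then show ?thesis using assms by (simp add: powr_powr)
qed

text \<open>Minkowski's inequality: the norm of an average in the sequence space with exponent
  \<open>t\<close> is at most the average of the norms. It lets a sum over index sets pass inside an
  average over frozen variables.\<close>

lemma avg_minkowski:
  fixes a :: "'b \<Rightarrow> 'c \<Rightarrow> real"
  assumes W: "finite W" "W \<noteq> {}" and B: "finite B"
    and a: "\<And>b w. 0 \<le> a b w" and t: "t \<ge> 1"
  shows "(\<Sum>b\<in>B. (avg W (a b)) powr t) \<le> (avg W (\<lambda>w. (\<Sum>b\<in>B. a b w powr t) powr (1 / t))) powr t"
proof -
  define N where "N w = (\<Sum>b\<in>B. a b w powr t) powr (1 / t)" for w
  define m where "m = avg W N"
  have N0: "N w \<ge> 0" for w by (simp add: N_def)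
  have Nt: "N w powr t = (\<Sum>b\<in>B. a b w powr t)" for w
    using t by (simp add: N_def powr_powr sum_nonneg)
  have aN: "a b w = 0" if "N w = 0" "b \<in> B" for b w
  proof -
    have "(\<Sum>b\<in>B. a b w powr t) = 0" using Nt[of w] that t by simp
    then show ?thesis using that B by (simp add: sum_nonneg_eq_0_iff)
  qed
  have m0: "m \<ge> 0" unfolding m_def by (intro avg_nonneg N0)
  show ?thesis
  proof (cases "m = 0")
    case True
    have "N w = 0" if "w \<in> W" for w
      using True W N0 that by (simp add: m_def avg_def sum_nonneg_eq_0_iff)
    then have "avg W (a b) = 0" if "b \<in> B" for b
      unfolding avg_def using aN that by simp
    then show ?thesis using t by simp
  next
    case False
    \<comment> \<open>The average divided by \<open>m\<close> is a convex combination with weights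
      \<open>l w\<close>, proportional to the norms \<open>N w\<close>, of the normalised vectors
      \<open>c _ w\<close>; convexity of the power then suffices.\<close>
    define l where "l w = N w / (card W * m)" for w
    define c where "c b w = a b w / N w" for b w
    have l: "sum l W = 1"
      using False W by (simp add: l_def m_def avg_def sum_divide_distrib[symmetric])
    have l0: "l w \<ge> 0" for w using N0 m0 by (simp add: l_def)
    have c0: "c b w \<ge> 0" for b w using N0 a by (simp add: c_def)
    have eq: "avg W (a b) / m = (\<Sum>w\<in>W. l w * c b w)" if "b \<in> B" for b
    proof -
      have "l w * c b w = a b w / (card W * m)" for w
        using aN[OF _ that, of w] by (cases "N w = 0") (simp_all add: l_def c_def)
      then show ?thesis by (simp add: avg_def sum_divide_distrib)
    qed
    have "(\<Sum>b\<in>B. (avg W (a b) / m) powr t) \<le> (\<Sum>b\<in>B. \<Sum>w\<in>W. l w * c b w powr t)"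
      using l l0 c0 t by (intro sum_mono) (simp add: eq powr_sum_le)
    also have "\<dots> = (\<Sum>w\<in>W. l w * (\<Sum>b\<in>B. c b w powr t))"
      by (subst sum.swap) (simp add: sum_distrib_left)
    also have "\<dots> \<le> (\<Sum>w\<in>W. l w * 1)"
    proof (intro sum_mono mult_left_mono l0)
      fix w
      have "(\<Sum>b\<in>B. c b w powr t) = (\<Sum>b\<in>B. a b w powr t) / N w powr t"
        using a N0 by (simp add: c_def powr_divide sum_divide_distrib)
      also have "\<dots> \<le> 1" unfolding Nt by simp
      finally show "(\<Sum>b\<in>B. c b w powr t) \<le> 1" .
    qed
    also have "\<dots> = 1" using l by simp
    finally have "(\<Sum>b\<in>B. (avg W (a b) / m) powr t) * m powr t \<le> 1 * m powr t"
      by (intro mult_right_mono) auto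
    moreover have "(avg W (a b) / m) powr t * m powr t = avg W (a b) powr t" for b
      using False m0 avg_nonneg[of W "a b"] a by (simp add: powr_divide)
    ultimately show ?thesis
      by (simp add: sum_distrib_right m_def N_def[abs_def])
  qed
qed

section \<open>Coefficients of tetrahedral polynomials\<close>

text \<open>The embedding \<open>e\<close> of the point values into the complex numbers is
  \<open>id\<close> for roots of unity and \<open>complex_of_real\<close> for signs, so that both
  settings share one argument.\<close>

definition chi :: "('v \<Rightarrow> complex) \<Rightarrow> 'i set \<Rightarrow> ('i \<Rightarrow> 'v) \<Rightarrow> complex" where
  "chi e A z = (\<Prod>j\<in>A. e (z j))"

definition tpoly :: "('v \<Rightarrow> complex) \<Rightarrow> 'i set \<Rightarrow> ('i set \<Rightarrow> 'a) \<Rightarrow> ('i \<Rightarrow> 'v) \<Rightarrow> 'a::complex_banach" where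
  "tpoly e R y z = (\<Sum>A\<in>Pow R. chi e A z *\<^sub>C y A)"

definition mix :: "'i set \<Rightarrow> ('i \<Rightarrow> 'v) \<Rightarrow> ('i \<Rightarrow> 'v) \<Rightarrow> 'i \<Rightarrow> 'v" where
  "mix S z z' i = (if i \<in> S then z i else z' i)"

definition one_step :: "'a::complex_banach itself \<Rightarrow> ('v \<Rightarrow> complex) \<Rightarrow> 'v set \<Rightarrow> 'i set \<Rightarrow> real \<Rightarrow> real \<Rightarrow> real \<Rightarrow> bool" where
  "one_step X e V I q s K \<longleftrightarrow> (\<forall>S (y :: 'i set \<Rightarrow> 'a). S \<subseteq> I \<longrightarrow>
     (\<Sum>j\<in>S. norm (y {j}) powr q)
       \<le> K * (avg (PiE I (\<lambda>_. V)) (\<lambda>z. norm (tpoly e S y z) powr s)) powr (q / s))"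

lemma chi_cong: "(\<And>j. j \<in> A \<Longrightarrow> z j = z' j) \<Longrightarrow> chi e A z = chi e A z'"
  unfolding chi_def by simp

text \<open>The involution \<open>g\<close> exchanges the coordinates outside \<open>S\<close>
  between two independent points. Hence drawing these coordinates afresh does not change the
  distribution.\<close>

lemma avg_mix:
  fixes F :: "('i \<Rightarrow> 'v) \<Rightarrow> real"
  shows "avg (PiE I V) (\<lambda>z. avg (PiE I V) (\<lambda>z'. F (mix S z z'))) = avg (PiE I V) F"
proof -
  let ?O = "PiE I V"
  define g :: "('i \<Rightarrow> 'v) \<times> ('i \<Rightarrow> 'v) \<Rightarrow> ('i \<Rightarrow> 'v) \<times> ('i \<Rightarrow> 'v)"
    where "g = (\<lambda>(z, z'). (mix S z z', mix S z' z))"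
  have gg: "g (g p) = p" for p by (auto simp: g_def mix_def fun_eq_iff split: prod.split)
  have g: "g ` (?O \<times> ?O) \<subseteq> ?O \<times> ?O"
    by (auto simp: g_def mix_def PiE_iff extensional_def)
  have bij: "bij_betw g (?O \<times> ?O) (?O \<times> ?O)"
    by (rule bij_betw_byWitness[where f'=g]) (use g gg in auto)
  have "(\<Sum>z\<in>?O. \<Sum>z'\<in>?O. F (mix S z z')) = (\<Sum>p\<in>?O \<times> ?O. F (fst (g p)))"
    by (simp add: sum.cartesian_product g_def case_prod_beta)
  also have "\<dots> = (\<Sum>p\<in>?O \<times> ?O. F (fst p))"
    by (rule sum.reindex_bij_betw[OF bij])
  also have "\<dots> = (\<Sum>z\<in>?O. \<Sum>z'\<in>?O. F z)"
    unfolding sum.cartesian_product by (intro sum.cong) auto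
  also have "\<dots> = card ?O * (\<Sum>z\<in>?O. F z)"
    by (simp add: sum_distrib_left)
  finally show ?thesis
    by (cases "card ?O = 0") (simp_all add: avg_def sum_divide_distrib[symmetric])
qed

lemma sum_chi_eq_0:
  assumes "finite I" "A \<subseteq> I" "A \<noteq> {}" "finite V" "(\<Sum>v\<in>V. e v) = 0"
  shows "(\<Sum>z\<in>PiE I (\<lambda>_. V). chi e A z) = 0"
proof -
  have "(\<Sum>z\<in>PiE I (\<lambda>_. V). chi e A z) = (\<Sum>z\<in>PiE I (\<lambda>_. V). \<Prod>i\<in>I. if i \<in> A then e (z i) else 1)"
    using assms by (simp add: chi_def prod.If_cases Int_absorb1)
  also have "\<dots> = (\<Prod>i\<in>I. \<Sum>v\<in>V. if i \<in> A then e v else 1)"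
    using assms by (subst prod_sum_PiE) auto
  also have "\<dots> = 0"
  proof -
    obtain a where a: "a \<in> A" using assms by auto
    then have "(\<Sum>v\<in>V. if a \<in> A then e v else 1) = 0" using assms by simp
    moreover have "a \<in> I" using a assms by auto
    ultimately show ?thesis using assms(1) unfolding prod_zero_iff[OF assms(1)] by blast
  qed
  finally show ?thesis .
qed

text \<open>The probability that a random subset of \<open>R\<close>, with inclusion probability \<open>\<theta>\<close>, meets \<open>A\<close>
  exactly in \<open>j\<close>.\<close>

lemma random_subset_hits_once:
  fixes \<theta> :: real
  assumes "finite R" "A \<subseteq> R" "j \<in> A"
  shows "(\<Sum>S\<in>Pow R. if A \<inter> S = {j} then \<theta> ^ card S * (1 - \<theta>) ^ card (R - S) else 0)
    = \<theta> * (1 - \<theta>) ^ (card A - 1)"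
proof -
  \<comment> \<open>\<open>f i\<close> is the weight for \<open>i\<close> lying in \<open>S\<close>
    and \<open>g i\<close> the weight for \<open>i\<close> lying outside; the two zero values
    exclude \<open>A - {j}\<close> from \<open>S\<close> and force \<open>j\<close> into it. The sum
    over \<open>S\<close> is then an expanded product.\<close>
  define f where "f i = (if i \<in> A - {j} then 0 else \<theta>)" for i
  define g where "g i = (if i = j then 0 else 1 - \<theta>)" for i
  have "(\<Sum>S\<in>Pow R. if A \<inter> S = {j} then \<theta> ^ card S * (1 - \<theta>) ^ card (R - S) else 0)
      = (\<Sum>S\<in>Pow R. (\<Prod>i\<in>S. f i) * (\<Prod>i\<in>R-S. g i))"
  proof (rule sum.cong[OF refl])
    fix S assume S: "S \<in> Pow R"
    then have fin: "finite S" "finite (R - S)" using assms finite_subset by auto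
    show "(if A \<inter> S = {j} then \<theta> ^ card S * (1 - \<theta>) ^ card (R - S) else 0) = (\<Prod>i\<in>S. f i) * (\<Prod>i\<in>R-S. g i)"
    proof (cases "A \<inter> S = {j}")
      case True
      then have "(\<Prod>i\<in>S. f i) = (\<Prod>i\<in>S. \<theta>)" "(\<Prod>i\<in>R-S. g i) = (\<Prod>i\<in>R-S. 1 - \<theta>)"
        by (intro prod.cong refl; auto simp: f_def g_def)+
      then show ?thesis using True by simp
    next
      case False
      show ?thesis
      proof (cases "j \<in> S")
        case True
        then obtain i where "i \<in> A - {j}" "i \<in> S" using False assms by auto
        then have "(\<Prod>i\<in>S. f i) = 0" using fin by (auto simp: prod_zero_iff f_def)
        then show ?thesis using False by simp
      next
        case j: False
        then have "(\<Prod>i\<in>R-S. g i) = 0" using fin assms by (auto simp: prod_zero_iff g_def)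
        then show ?thesis using False by simp
      qed
    qed
  qed
  also have "\<dots> = (\<Prod>i\<in>R. f i + g i)" by (rule prod_add[OF assms(1), symmetric])
  also have "\<dots> = (\<Prod>i\<in>A. f i + g i) * (\<Prod>i\<in>R-A. f i + g i)"
    using assms by (metis prod.subset_diff mult.commute)
  also have "(\<Prod>i\<in>R-A. f i + g i) = 1"
    using assms by (intro prod.neutral) (auto simp: f_def g_def)
  also have "(\<Prod>i\<in>A. f i + g i) = (f j + g j) * (\<Prod>i\<in>A-{j}. f i + g i)"
    using assms finite_subset by (intro prod.remove) auto
  also have "(\<Prod>i\<in>A-{j}. f i + g i) = (\<Prod>i\<in>A-{j}. 1 - \<theta>)"
    by (intro prod.cong) (auto simp: f_def g_def)
  finally show ?thesis using assms by (simp add: f_def g_def)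
qed

text \<open>The reciprocal of the left side is \<open>(1 + 1 / n) ^ n\<close>, which stays below the
  value of \<open>exp\<close> at 1, hence below 3. This is where the uniform probability comes
  from.\<close>

lemma one_minus_inverse_Suc_power_ge: "(1 - 1 / real (Suc n)) ^ n \<ge> 1 / 3"
proof (cases "n = 0")
  case False
  have "(1 + 1 / real n) ^ n \<le> exp (1 / real n) ^ n"
    using exp_ge_add_one_self[of "1 / real n"] by (intro power_mono) auto
  also have "\<dots> = exp 1" using False by (simp add: exp_of_nat_mult[symmetric])
  also have "\<dots> \<le> 3" by (rule exp_le)
  finally have *: "(1 + 1 / real n) ^ n \<le> 3" .
  have "1 - 1 / real (Suc n) = 1 / (1 + 1 / real n)" using False by (simp add: field_simps)
  then have "(1 - 1 / real (Suc n)) ^ n = 1 / (1 + 1 / real n) ^ n" by (simp add: power_one_over)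
  moreover have "(1 + 1 / real n) ^ n > 0" by (intro zero_less_power) (auto simp: add_pos_nonneg)
  ultimately show ?thesis using * by (simp add: field_simps)
qed simp

text \<open>Decoupling by a random subset \<open>S\<close>: for fixed values of the variables outside \<open>S\<close> the
  one-step inequality controls the coefficients of degree one in \<open>S\<close>.  A set of \<open>n + 1\<close> elements
  meets \<open>S\<close> in exactly one point with probability at least \<open>1/3\<close>, so each degree costs only a
  constant factor.\<close>

lemma tpoly_coefficients:
  fixes y :: "'i set \<Rightarrow> 'a::complex_banach"
  assumes I: "finite I" and V: "finite V" "V \<noteq> {}" "(\<Sum>v\<in>V. e v) = 0"
    and sq: "1 \<le> s" "s \<le> q" and K: "K \<ge> 0" and os: "one_step TYPE('a) e V I q s K" and R: "R \<subseteq> I"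
  shows "(\<Sum>A | A \<subseteq> R \<and> card A = n. norm (y A) powr q)
    \<le> (3 * K) ^ n * (avg (PiE I (\<lambda>_. V)) (\<lambda>z. norm (tpoly e R y z) powr s)) powr (q / s)"
  using R
proof (induction n arbitrary: R y)
  case 0
  let ?W = "PiE I (\<lambda>_. V)"
  have finR: "finite R" using 0 I finite_subset by auto
  have W: "finite ?W" "?W \<noteq> {}" using I V by (auto simp: finite_PiE PiE_eq_empty_iff)
  have "A = {}" if "A \<subseteq> R" "card A = 0" for A
    using that finite_subset[OF _ finR] by simp
  then have empty: "{A. A \<subseteq> R \<and> card A = 0} = {{}}" by auto
  have "norm (y {}) \<le> avg ?W (\<lambda>z. norm (tpoly e R y z))"
  proof -
    have "(\<Sum>z\<in>?W. tpoly e R y z) = (\<Sum>A\<in>Pow R. (\<Sum>z\<in>?W. chi e A z) *\<^sub>C y A)"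
      unfolding tpoly_def by (subst sum.swap) (simp add: scaleC_sum_left)
    also have "\<dots> = (\<Sum>A\<in>{{}}. (\<Sum>z\<in>?W. chi e A z) *\<^sub>C y A)"
    proof (intro sum.mono_neutral_right ballI)
      fix A assume "A \<in> Pow R - {{}}"
      then have "(\<Sum>z\<in>?W. chi e A z) = 0" using 0 V I by (intro sum_chi_eq_0) auto
      then show "(\<Sum>z\<in>?W. chi e A z) *\<^sub>C y A = 0" by simp
    qed (use finR in auto)
    also have "\<dots> = real (card ?W) *\<^sub>R y {}"
      by (simp add: chi_def scaleR_scaleC)
    finally have "y {} = (1 / real (card ?W)) *\<^sub>R (\<Sum>z\<in>?W. tpoly e R y z)"
      using W by simp
    then show ?thesis using norm_sum_le_avg by metis
  qed
  then have "norm (y {}) powr q \<le> ((avg ?W (\<lambda>z. norm (tpoly e R y z))) powr s) powr (q / s)"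
    using sq by (simp add: powr_powr powr_mono2)
  also have "\<dots> \<le> (avg ?W (\<lambda>z. norm (tpoly e R y z) powr s)) powr (q / s)"
    using sq W by (intro powr_mono2 avg_powr_le) auto
  finally show ?case by (simp add: empty)
next
  case (Suc n)
  let ?W = "PiE I (\<lambda>_. V)"
  have finR: "finite R" using Suc.prems I finite_subset by auto
  have W: "finite ?W" "?W \<noteq> {}" using I V by (auto simp: finite_PiE PiE_eq_empty_iff)
  define N where "N = avg ?W (\<lambda>z. norm (tpoly e R y z) powr s)"
  have N0: "N \<ge> 0" unfolding N_def by (intro avg_nonneg) auto
  define f where "f A = norm (y A) powr q" for A
  define G where "G S = (\<Sum>A | A \<subseteq> R \<and> card A = Suc n. if card (A \<inter> S) = 1 then f A else 0)" for S
  have G: "G S \<le> K * (3 * K) ^ n * N powr (q / s)" if S: "S \<subseteq> R" for S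
  proof -
    define R' where "R' = R - S"
    have fin: "finite S" "finite R'" using S finR finite_subset by (auto simp: R'_def)
    define BB where "BB = {B. B \<subseteq> R' \<and> card B = n}"
    have finB: "finite BB" using fin by (auto simp: BB_def)
    \<comment> \<open>With the variables in \<open>S\<close> frozen at \<open>z\<close>, this is the
      coefficient at \<open>B\<close> of a polynomial in the remaining variables. As a function of
      \<open>z\<close> it is itself a polynomial in the variables of \<open>S\<close>, and its
      coefficients of degree one are the \<open>y ({j} \<union> B)\<close>. The first view serves
      the induction hypothesis, the second the one-step inequality.\<close>
    define y' where "y' z B = (\<Sum>A\<in>Pow S. chi e A z *\<^sub>C y (A \<union> B))" for z B
    have mixeq: "tpoly e R y (mix S z z') = tpoly e R' (y' z) z'" for z z'
    proof -
      have bij: "bij_betw (\<lambda>(A, B). A \<union> B) (Pow S \<times> Pow R') (Pow R)"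
        by (rule bij_betw_byWitness[where f'="\<lambda>C. (C \<inter> S, C \<inter> R')"]) (use S in \<open>auto simp: R'_def\<close>)
      have "tpoly e R y (mix S z z') = (\<Sum>p\<in>Pow S \<times> Pow R'.
          chi e (case p of (A, B) \<Rightarrow> A \<union> B) (mix S z z') *\<^sub>C y (case p of (A, B) \<Rightarrow> A \<union> B))"
        unfolding tpoly_def by (rule sum.reindex_bij_betw[OF bij, symmetric])
      also have "\<dots> = (\<Sum>p\<in>Pow S \<times> Pow R'. (chi e (fst p) z * chi e (snd p) z') *\<^sub>C y (fst p \<union> snd p))"
      proof (rule sum.cong[OF refl])
        fix p assume p: "p \<in> Pow S \<times> Pow R'"
        have "chi e (fst p \<union> snd p) (mix S z z') = chi e (fst p) (mix S z z') * chi e (snd p) (mix S z z')"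
        proof -
          have sub: "fst p \<subseteq> S" "snd p \<subseteq> R'" using p by auto
          moreover have "S \<inter> R' = {}" by (auto simp: R'_def)
          ultimately have "fst p \<inter> snd p = {}" by blast
          with finite_subset[OF sub(1) fin(1)] finite_subset[OF sub(2) fin(2)]
          have "finite (fst p)" "finite (snd p)" "fst p \<inter> snd p = {}" by auto
          then show ?thesis unfolding chi_def by (rule prod.union_disjoint)
        qed
        also have "chi e (fst p) (mix S z z') = chi e (fst p) z"
          using p by (intro chi_cong) (auto simp: mix_def)
        also have "chi e (snd p) (mix S z z') = chi e (snd p) z'"
          using p by (intro chi_cong) (auto simp: mix_def R'_def)
        finally show "chi e (case p of (A, B) \<Rightarrow> A \<union> B) (mix S z z') *\<^sub>C y (case p of (A, B) \<Rightarrow> A \<union> B)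
            = (chi e (fst p) z * chi e (snd p) z') *\<^sub>C y (fst p \<union> snd p)"
          by (simp add: case_prod_beta)
      qed
      also have "\<dots> = (\<Sum>A\<in>Pow S. \<Sum>B\<in>Pow R'. (chi e A z * chi e B z') *\<^sub>C y (A \<union> B))"
        by (simp add: sum.cartesian_product case_prod_beta)
      also have "\<dots> = (\<Sum>B\<in>Pow R'. \<Sum>A\<in>Pow S. (chi e A z * chi e B z') *\<^sub>C y (A \<union> B))"
        by (rule sum.swap)
      also have "\<dots> = tpoly e R' (y' z) z'"
        unfolding tpoly_def y'_def by (simp add: scaleC_sum_right scaleC_scaleC mult.commute)
      finally show ?thesis .
    qed
    have "G S = (\<Sum>B\<in>BB. \<Sum>j\<in>S. f ({j} \<union> B))"
    proof -
      have "G S = (\<Sum>A | A \<subseteq> R \<and> card A = Suc n \<and> card (A \<inter> S) = 1. f A)"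
        unfolding G_def using finR by (subst sum.inter_filter[symmetric]) (auto intro: sum.cong)
      also have "\<dots> = (\<Sum>p\<in>BB \<times> S. f ({snd p} \<union> fst p))"
      proof (rule sum.reindex_bij_witness[where j="\<lambda>A. (A - S, the_elem (A \<inter> S))" and i="\<lambda>p. {snd p} \<union> fst p"])
        fix A assume A: "A \<in> {A. A \<subseteq> R \<and> card A = Suc n \<and> card (A \<inter> S) = 1}"
        then obtain j where j: "A \<inter> S = {j}" by (auto simp: card_1_singleton_iff)
        show "{snd (A - S, the_elem (A \<inter> S))} \<union> fst (A - S, the_elem (A \<inter> S)) = A"
          using j by auto
        have finA: "finite A" using A finR finite_subset by auto
        have "card (A - S) = n"
          using A j finA by (simp add: card_Diff_subset_Int)
        then show "(A - S, the_elem (A \<inter> S)) \<in> BB \<times> S"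
          using A j by (auto simp: BB_def R'_def)
        show "f ({snd (A - S, the_elem (A \<inter> S))} \<union> fst (A - S, the_elem (A \<inter> S))) = f A"
          using \<open>{snd (A - S, the_elem (A \<inter> S))} \<union> fst (A - S, the_elem (A \<inter> S)) = A\<close> by simp
      next
        fix p assume p: "p \<in> BB \<times> S"
        then have *: "({snd p} \<union> fst p) \<inter> S = {snd p}" "({snd p} \<union> fst p) - S = fst p"
          by (auto simp: BB_def R'_def)
        then show "(({snd p} \<union> fst p) - S, the_elem (({snd p} \<union> fst p) \<inter> S)) = p" by simp
        have "fst p \<subseteq> R'" "snd p \<in> S" using p by (auto simp: BB_def)
        then have "finite (fst p)" "snd p \<notin> fst p"
          using finite_subset[OF _ fin(2)] by (auto simp: R'_def)
        then show "{snd p} \<union> fst p \<in> {A. A \<subseteq> R \<and> card A = Suc n \<and> card (A \<inter> S) = 1}"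
          using p S unfolding mem_Collect_eq * by (auto simp: BB_def R'_def)
      qed
      also have "\<dots> = (\<Sum>B\<in>BB. \<Sum>j\<in>S. f ({j} \<union> B))"
        by (simp add: sum.cartesian_product case_prod_beta)
      finally show ?thesis .
    qed
    also have "\<dots> \<le> (\<Sum>B\<in>BB. K * (avg ?W (\<lambda>z. norm (y' z B) powr s)) powr (q / s))"
    proof (rule sum_mono)
      fix B
      have "S \<subseteq> I" using S Suc.prems by auto
      from os[unfolded one_step_def, rule_format, OF this, of "\<lambda>A. y (A \<union> B)"]
      show "(\<Sum>j\<in>S. f ({j} \<union> B)) \<le> K * (avg ?W (\<lambda>z. norm (y' z B) powr s)) powr (q / s)"
        by (simp add: f_def y'_def tpoly_def)
    qed
    also have "\<dots> = K * (\<Sum>B\<in>BB. (avg ?W (\<lambda>z. norm (y' z B) powr s)) powr (q / s))"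
      by (simp add: sum_distrib_left)
    also have "\<dots> \<le> K * ((3 * K) ^ n * N powr (q / s))"
    proof (intro mult_left_mono K)
      \<comment> \<open>Minkowski with the exponent \<open>q / s\<close>, which is at least 1 since
        \<open>s \<le> q\<close>. Afterwards the induction hypothesis is available for each fixed
        \<open>z\<close>, and \<open>avg_mix\<close> recombines the two averages.\<close>
      have "(\<Sum>B\<in>BB. (avg ?W (\<lambda>z. norm (y' z B) powr s)) powr (q / s))
          \<le> (avg ?W (\<lambda>z. (\<Sum>B\<in>BB. (norm (y' z B) powr s) powr (q / s)) powr (1 / (q / s)))) powr (q / s)"
        using W finB sq by (intro avg_minkowski) auto
      also have "\<dots> \<le> (avg ?W (\<lambda>z. ((3 * K) ^ n) powr (s / q) * avg ?W (\<lambda>z'. norm (tpoly e R y (mix S z z')) powr s))) powr (q / s)"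
      proof (intro powr_mono2 avg_mono avg_nonneg)
        fix z assume "z \<in> ?W"
        have "(\<Sum>B\<in>BB. (norm (y' z B) powr s) powr (q / s)) = (\<Sum>B\<in>BB. norm (y' z B) powr q)"
          using sq by (simp add: powr_powr)
        also have "\<dots> \<le> (3 * K) ^ n * (avg ?W (\<lambda>z'. norm (tpoly e R' (y' z) z') powr s)) powr (q / s)"
          unfolding BB_def using Suc.prems by (intro Suc.IH) (auto simp: R'_def)
        finally have "(\<Sum>B\<in>BB. (norm (y' z B) powr s) powr (q / s)) powr (1 / (q / s))
           \<le> ((3 * K) ^ n * (avg ?W (\<lambda>z'. norm (tpoly e R' (y' z) z') powr s)) powr (q / s)) powr (1 / (q / s))"
          using sq by (intro powr_mono2) (auto intro: sum_nonneg)
        also have "\<dots> = ((3 * K) ^ n) powr (s / q) * avg ?W (\<lambda>z'. norm (tpoly e R' (y' z) z') powr s)"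
          using sq K by (simp add: powr_mult powr_powr avg_nonneg)
        finally show "(\<Sum>B\<in>BB. (norm (y' z B) powr s) powr (q / s)) powr (1 / (q / s))
          \<le> ((3 * K) ^ n) powr (s / q) * avg ?W (\<lambda>z'. norm (tpoly e R y (mix S z z')) powr s)"
          by (simp add: mixeq)
      qed (use sq in auto)
      also have "\<dots> = (((3 * K) ^ n) powr (s / q) * N) powr (q / s)"
        unfolding avg_cmult N_def by (simp add: avg_mix[where F="\<lambda>z. norm (tpoly e R y z) powr s"])
      also have "\<dots> = (3 * K) ^ n * N powr (q / s)"
        using sq K N0 by (simp add: powr_mult powr_powr)
      finally show "(\<Sum>B\<in>BB. (avg ?W (\<lambda>z. norm (y' z B) powr s)) powr (q / s)) \<le> (3 * K) ^ n * N powr (q / s)" .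
    qed
    finally show ?thesis by (simp add: mult_ac)
  qed
  \<comment> \<open>The inclusion probability that maximises
    \<open>(n + 1) * \<theta> * (1 - \<theta>) ^ n\<close>, the chance of meeting a set of
    \<open>n + 1\<close> elements exactly once. At this value the first two factors cancel.\<close>
  define \<theta> where "\<theta> = 1 / real (Suc n)"
  define w where "w S = \<theta> ^ card S * (1 - \<theta>) ^ card (R - S)" for S
  have w0: "w S \<ge> 0" for S by (simp add: w_def \<theta>_def)
  have w1: "(\<Sum>S\<in>Pow R. w S) = 1"
    using prod_add[OF finR, of "\<lambda>_. \<theta>" "\<lambda>_. 1 - \<theta>"] by (simp add: w_def)
  have hit: "(\<Sum>S\<in>Pow R. w S * (if card (A \<inter> S) = 1 then f A else 0)) = (1 - \<theta>) ^ n * f A"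
    if A: "A \<subseteq> R" "card A = Suc n" for A
  proof -
    have finA: "finite A" using A finR finite_subset by auto
    have "w S * (if card (A \<inter> S) = 1 then f A else 0)
        = (\<Sum>j\<in>A. if A \<inter> S = {j} then w S else 0) * f A" for S
    proof (cases "card (A \<inter> S) = 1")
      case True
      then obtain j where j: "A \<inter> S = {j}" by (auto simp: card_1_singleton_iff)
      then have "j \<in> A" by auto
      then have "(\<Sum>i\<in>A. if A \<inter> S = {i} then w S else 0) = w S"
        using finA j by (simp add: sum.delta)
      then show ?thesis using True by simp
    next
      case False
      then have "A \<inter> S \<noteq> {j}" for j by auto
      then show ?thesis using False by simp
    qed
    then have "(\<Sum>S\<in>Pow R. w S * (if card (A \<inter> S) = 1 then f A else 0))
        = (\<Sum>j\<in>A. \<Sum>S\<in>Pow R. if A \<inter> S = {j} then w S else 0) * f A"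
      by (subst sum.swap) (simp add: sum_distrib_right)
    also have "\<dots> = (\<Sum>j\<in>A. \<theta> * (1 - \<theta>) ^ n) * f A"
    proof -
      have "(\<Sum>S\<in>Pow R. if A \<inter> S = {j} then w S else 0) = \<theta> * (1 - \<theta>) ^ n" if "j \<in> A" for j
        using random_subset_hits_once[OF finR A(1) that, of \<theta>] A(2) unfolding w_def by simp
      then show ?thesis by simp
    qed
    also have "\<dots> = (1 - \<theta>) ^ n * f A" using A(2) by (simp add: \<theta>_def)
    finally show ?thesis .
  qed
  have "(1 / 3) * (\<Sum>A | A \<subseteq> R \<and> card A = Suc n. f A) \<le> (\<Sum>A | A \<subseteq> R \<and> card A = Suc n. (1 - \<theta>) ^ n * f A)"
    unfolding sum_distrib_left using one_minus_inverse_Suc_power_ge[of n]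
    by (intro sum_mono mult_right_mono) (auto simp: f_def \<theta>_def)
  also have "\<dots> = (\<Sum>A | A \<subseteq> R \<and> card A = Suc n. \<Sum>S\<in>Pow R. w S * (if card (A \<inter> S) = 1 then f A else 0))"
    using hit by (intro sum.cong) auto
  also have "\<dots> = (\<Sum>S\<in>Pow R. w S * G S)"
    unfolding G_def by (subst sum.swap) (simp add: sum_distrib_left)
  also have "\<dots> \<le> (\<Sum>S\<in>Pow R. w S * (K * (3 * K) ^ n * N powr (q / s)))"
    using G w0 by (intro sum_mono mult_left_mono) auto
  also have "\<dots> = K * (3 * K) ^ n * N powr (q / s)"
    using w1 by (simp add: sum_distrib_right[symmetric])
  finally show ?case by (simp add: f_def N_def)
qed

section \<open>Hypercontractivity on the finite cube\<close>

abbreviation signs :: "nat set \<Rightarrow> (nat \<Rightarrow> real) set" where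
  "signs I \<equiv> PiE I (\<lambda>_. {- 1, 1})"

definition rpoly :: "nat set \<Rightarrow> (nat set \<Rightarrow> 'a::real_vector) \<Rightarrow> (nat \<Rightarrow> real) \<Rightarrow> 'a" where
  "rpoly I y \<epsilon> = (\<Sum>A\<in>Pow I. walsh A \<epsilon> *\<^sub>R y A)"

text \<open>One kernel in three roles: with arbitrary \<open>a\<close> of modulus at most one it
  gives the contraction principle, with \<open>a\<close> equal to \<rho> times signs the noise
  operator, and with \<open>a\<close> equal to signs the projection onto finitely many
  coordinates.\<close>

definition riesz :: "nat set \<Rightarrow> (nat \<Rightarrow> real) \<Rightarrow> (nat \<Rightarrow> real) \<Rightarrow> real" where
  "riesz I a \<eta> = (\<Prod>i\<in>I. 1 + a i * \<eta> i)"

lemma signs_finite_nonempty: "finite I \<Longrightarrow> finite (signs I)" "signs I \<noteq> {}"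
  by (auto simp: finite_PiE PiE_eq_empty_iff)

lemma signs_square: "\<epsilon> \<in> signs I \<Longrightarrow> i \<in> I \<Longrightarrow> \<epsilon> i * \<epsilon> i = 1"
  by (auto dest!: PiE_mem)

lemma signs_abs: "\<epsilon> \<in> signs I \<Longrightarrow> i \<in> I \<Longrightarrow> \<bar>\<epsilon> i\<bar> = 1"
  by (auto dest!: PiE_mem)

lemma avg_walsh_mult:
  assumes "finite I" "A \<subseteq> I" "B \<subseteq> I"
  shows "avg (signs I) (\<lambda>\<epsilon>. walsh A \<epsilon> * walsh B \<epsilon>) = (if A = B then 1 else 0)"
proof -
  define f :: "nat \<Rightarrow> real \<Rightarrow> real" where
    "f i v = (if i \<in> A then v else 1) * (if i \<in> B then v else 1)" for i v
  have "walsh A \<epsilon> * walsh B \<epsilon> = (\<Prod>i\<in>I. f i (\<epsilon> i))" for \<epsilon>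
    using assms by (simp add: f_def walsh_def prod.distrib prod.If_cases Int_absorb1)
  then have "(\<Sum>\<epsilon>\<in>signs I. walsh A \<epsilon> * walsh B \<epsilon>) = (\<Prod>i\<in>I. \<Sum>v\<in>{-1, 1}. f i v)"
    using assms by (simp only: prod_sum_PiE finite.intros)
  also have "\<dots> = (\<Prod>i\<in>I. if (i \<in> A) = (i \<in> B) then 2 else 0)"
    by (intro prod.cong) (auto simp: f_def)
  also have "\<dots> = (if A = B then 2 ^ card I else 0)"
  proof (cases "A = B")
    case False
    then obtain i where "i \<in> I" "(i \<in> A) \<noteq> (i \<in> B)" using assms by blast
    then have "(\<Prod>i\<in>I. if (i \<in> A) = (i \<in> B) then 2 else 0 :: real) = 0"
      using assms(1) by (intro prod_zero) auto
    then show ?thesis using False by simp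
  qed simp
  finally show ?thesis
    using assms by (simp add: avg_def card_PiE)
qed

lemma sum_Pow_singletons:
  assumes "finite I"
  shows "(\<Sum>A\<in>Pow I. if card A = 1 then g A else 0) = (\<Sum>j\<in>I. g {j})"
proof -
  have "(\<Sum>A\<in>Pow I. if card A = 1 then g A else 0) = (\<Sum>A\<in>(\<lambda>j. {j}) ` I. g A)"
    using assms by (intro sum.mono_neutral_cong_right) (auto simp: card_1_singleton_iff)
  then show ?thesis by (simp add: sum.reindex)
qed

lemma rpoly_singletons:
  "finite I \<Longrightarrow> rpoly I (\<lambda>A. if card A = 1 then x (the_elem A) else 0) \<epsilon> = (\<Sum>j\<in>I. \<epsilon> j *\<^sub>R x j)"
  using sum_Pow_singletons[of I "\<lambda>A. walsh A \<epsilon> *\<^sub>R x (the_elem A)"]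
  by (simp add: rpoly_def walsh_def if_distrib cong: if_cong)

lemma riesz_expand: "finite I \<Longrightarrow> riesz I a \<eta> = (\<Sum>A\<in>Pow I. (\<Prod>i\<in>A. a i) * walsh A \<eta>)"
  using prod_add[of I "\<lambda>i. a i * \<eta> i" "\<lambda>_. 1"]
  by (simp add: riesz_def walsh_def prod.distrib add.commute)

lemma riesz_nonneg:
  assumes "\<eta> \<in> signs I" "\<And>i. i \<in> I \<Longrightarrow> \<bar>a i\<bar> \<le> 1"
  shows "riesz I a \<eta> \<ge> 0"
  unfolding riesz_def
proof (rule prod_nonneg)
  fix i assume "i \<in> I"
  then have "\<bar>a i * \<eta> i\<bar> \<le> 1" using assms signs_abs[OF assms(1)] by (simp add: abs_mult)
  then show "0 \<le> 1 + a i * \<eta> i" by linarith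
qed

lemma avg_riesz_walsh:
  assumes "finite I" "A \<subseteq> I"
  shows "avg (signs I) (\<lambda>\<eta>. riesz I a \<eta> * walsh A \<eta>) = (\<Prod>i\<in>A. a i)"
proof -
  have "avg (signs I) (\<lambda>\<eta>. riesz I a \<eta> * walsh A \<eta>)
      = (\<Sum>B\<in>Pow I. (\<Prod>i\<in>B. a i) * avg (signs I) (\<lambda>\<eta>. walsh B \<eta> * walsh A \<eta>))"
    by (simp add: riesz_expand[OF assms(1)] sum_distrib_right avg_sum avg_cmult mult.assoc)
  also have "\<dots> = (\<Sum>B\<in>Pow I. if B = A then (\<Prod>i\<in>B. a i) else 0)"
    using assms by (intro sum.cong) (auto simp: avg_walsh_mult)
  finally show ?thesis using assms by simp
qed

lemma avg_riesz: "finite I \<Longrightarrow> avg (signs I) (riesz I a) = 1"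
  using avg_riesz_walsh[of I "{}" a] by (simp add: walsh_def)

text \<open>The Riesz product represents the multiplier \<open>walsh A \<mapsto> \<Prod>i\<in>A. a i\<close> by a positive kernel.\<close>

lemma riesz_multiplier_norm_le:
  fixes y :: "nat set \<Rightarrow> 'a::real_normed_vector"
  assumes I: "finite I" and a: "\<And>i. i \<in> I \<Longrightarrow> \<bar>a i\<bar> \<le> 1"
  shows "norm (\<Sum>A\<in>Pow I. (\<Prod>i\<in>A. a i) *\<^sub>R y A) \<le> avg (signs I) (\<lambda>\<eta>. riesz I a \<eta> * norm (rpoly I y \<eta>))"
proof -
  let ?c = "1 / real (card (signs I))"
  have "(\<Sum>\<eta>\<in>signs I. riesz I a \<eta> *\<^sub>R rpoly I y \<eta>)
      = (\<Sum>A\<in>Pow I. (\<Sum>\<eta>\<in>signs I. riesz I a \<eta> * walsh A \<eta>) *\<^sub>R y A)"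
    unfolding rpoly_def by (simp add: scaleR_sum_right scaleR_sum_left sum.swap[of _ "Pow I"])
  then have "?c *\<^sub>R (\<Sum>\<eta>\<in>signs I. riesz I a \<eta> *\<^sub>R rpoly I y \<eta>)
      = (\<Sum>A\<in>Pow I. avg (signs I) (\<lambda>\<eta>. riesz I a \<eta> * walsh A \<eta>) *\<^sub>R y A)"
    by (simp add: scaleR_sum_right avg_def)
  also have "\<dots> = (\<Sum>A\<in>Pow I. (\<Prod>i\<in>A. a i) *\<^sub>R y A)"
    using I by (intro sum.cong) (auto simp: avg_riesz_walsh)
  finally have "norm (\<Sum>A\<in>Pow I. (\<Prod>i\<in>A. a i) *\<^sub>R y A)
     \<le> avg (signs I) (\<lambda>\<eta>. norm (riesz I a \<eta> *\<^sub>R rpoly I y \<eta>))"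
    using norm_sum_le_avg by metis
  also have "\<dots> = avg (signs I) (\<lambda>\<eta>. riesz I a \<eta> * norm (rpoly I y \<eta>))"
    using a by (intro avg_cong) (simp add: riesz_nonneg)
  finally show ?thesis .
qed

text \<open>A Riesz product is a probability density for the uniform measure, so Jensen's inequality
  holds with it as weight.\<close>

lemma avg_riesz_powr_le:
  assumes I: "finite I" and a: "\<And>i. i \<in> I \<Longrightarrow> \<bar>a i\<bar> \<le> 1" and F: "\<And>\<eta>. \<eta> \<in> signs I \<Longrightarrow> 0 \<le> F \<eta>" and t: "t \<ge> 1"
  shows "(avg (signs I) (\<lambda>\<eta>. riesz I a \<eta> * F \<eta>)) powr t \<le> avg (signs I) (\<lambda>\<eta>. riesz I a \<eta> * F \<eta> powr t)"
proof -
  define w where "w \<eta> = riesz I a \<eta> / real (card (signs I))" for \<eta>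
  have "sum w (signs I) = 1"
    using avg_riesz[OF I, of a] by (simp add: w_def avg_def sum_divide_distrib)
  moreover have "\<And>\<eta>. \<eta> \<in> signs I \<Longrightarrow> w \<eta> \<ge> 0" using a by (simp add: w_def riesz_nonneg)
  ultimately have "(\<Sum>\<eta>\<in>signs I. w \<eta> * F \<eta>) powr t \<le> (\<Sum>\<eta>\<in>signs I. w \<eta> * F \<eta> powr t)"
    using F t by (intro powr_sum_le) auto
  then show ?thesis by (simp add: w_def avg_def sum_divide_distrib)
qed

lemma avg_bessel:
  assumes "finite I"
  shows "(\<Sum>A\<in>Pow I. (avg (signs I) (\<lambda>\<eta>. F \<eta> * walsh A \<eta>))\<^sup>2) \<le> avg (signs I) (\<lambda>\<eta>. (F \<eta>)\<^sup>2)"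
proof -
  let ?E = "avg (signs I)"
  define c where "c A = ?E (\<lambda>\<eta>. F \<eta> * walsh A \<eta>)" for A
  have "0 \<le> ?E (\<lambda>\<eta>. (F \<eta> - (\<Sum>A\<in>Pow I. c A * walsh A \<eta>))\<^sup>2)" by (intro avg_nonneg) auto
  also have "\<dots> = ?E (\<lambda>\<eta>. (F \<eta>)\<^sup>2 + ((- 2) * (\<Sum>A\<in>Pow I. c A * (F \<eta> * walsh A \<eta>))
      + (\<Sum>A\<in>Pow I. \<Sum>B\<in>Pow I. (c A * c B) * (walsh A \<eta> * walsh B \<eta>))))"
    by (intro avg_cong) (simp add: power2_eq_square algebra_simps sum_distrib_left sum_distrib_right sum_negf)
  also have "\<dots> = ?E (\<lambda>\<eta>. (F \<eta>)\<^sup>2) + ((- 2) * (\<Sum>A\<in>Pow I. c A * c A)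
      + (\<Sum>A\<in>Pow I. \<Sum>B\<in>Pow I. (c A * c B) * ?E (\<lambda>\<eta>. walsh A \<eta> * walsh B \<eta>)))"
    by (simp only: avg_add avg_cmult avg_sum c_def)
  also have "(\<Sum>A\<in>Pow I. \<Sum>B\<in>Pow I. (c A * c B) * ?E (\<lambda>\<eta>. walsh A \<eta> * walsh B \<eta>))
      = (\<Sum>A\<in>Pow I. \<Sum>B\<in>Pow I. if A = B then c A * c B else 0)"
    using assms by (intro sum.cong refl) (simp add: avg_walsh_mult)
  also have "\<dots> = (\<Sum>A\<in>Pow I. c A * c A)" using assms by simp
  finally show ?thesis by (simp add: c_def power2_eq_square)
qed

section \<open>The Bonami inequality and exponents above 2\<close>

lemma avg_cauchy_schwarz:
  fixes F G :: "'b \<Rightarrow> real"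
  shows "(avg W (\<lambda>w. F w * G w))\<^sup>2 \<le> avg W (\<lambda>w. (F w)\<^sup>2) * avg W (\<lambda>w. (G w)\<^sup>2)"
  using Cauchy_Schwarz_ineq_sum[of F G W]
  by (simp add: avg_def power_divide divide_right_mono power2_eq_square[of "real (card W)"])

lemma walsh_fun_upd: "i \<notin> A \<Longrightarrow> walsh A (\<epsilon>(i := v)) = walsh A \<epsilon>"
  unfolding walsh_def by (intro prod.cong) auto

lemma walsh_insert: "i \<notin> A \<Longrightarrow> finite A \<Longrightarrow> walsh (insert i A) \<epsilon> = \<epsilon> i * walsh A \<epsilon>"
  by (simp add: walsh_def)

text \<open>The classical noise parameter for the step from exponent 2 to exponent 4: the mixed term
  of a fourth power has the factor 6, and \<open>6 * \<rho>\<^sup>2 = 2\<close> turns it into the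
  mixed term of a square.\<close>

definition \<rho> :: real where "\<rho> = 1 / sqrt 3"

lemma \<rho>: "0 < \<rho>" "\<rho> \<le> 1" "\<rho>\<^sup>2 = 1 / 3" "\<rho> ^ 4 = 1 / 9"
proof -
  show r: "0 < \<rho>" "\<rho>\<^sup>2 = 1 / 3" by (simp_all add: \<rho>_def power_divide)
  show "\<rho> \<le> 1" by (simp add: \<rho>_def)
  have "\<rho> ^ 4 = (\<rho>\<^sup>2)\<^sup>2" by simp
  then show "\<rho> ^ 4 = 1 / 9" unfolding r by (simp add: power_divide)
qed

text \<open>Induction on the number of variables: isolating one variable writes the sum as
  \<open>g \<epsilon> + \<rho> * \<epsilon> i * h \<epsilon>\<close> with \<open>g\<close> and
  \<open>h\<close> free of it. The outer set \<open>I\<close> stays fixed, so that all averages in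
  the induction run over the same points.\<close>

lemma bonami_coefficients:
  fixes c :: "nat set \<Rightarrow> real"
  assumes "finite I" "J \<subseteq> I"
  shows "avg (signs I) (\<lambda>\<epsilon>. (\<Sum>A\<in>Pow J. \<rho> ^ card A * c A * walsh A \<epsilon>) ^ 4) \<le> (\<Sum>A\<in>Pow J. (c A)\<^sup>2)\<^sup>2"
proof -
  have "finite J" using assms finite_subset by auto
  then show ?thesis using assms(2)
  proof (induction J arbitrary: c rule: finite_induct)
    case empty
    show ?case using assms(1) by (simp add: walsh_def avg_const signs_finite_nonempty)
  next
    case (insert i J)
    let ?E = "avg (signs I)"
    define g where "g \<epsilon> = (\<Sum>A\<in>Pow J. \<rho> ^ card A * c A * walsh A \<epsilon>)" for \<epsilon>
    define h where "h \<epsilon> = (\<Sum>A\<in>Pow J. \<rho> ^ card A * c (insert i A) * walsh A \<epsilon>)" for \<epsilon>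
    define G where "G = (\<Sum>A\<in>Pow J. (c A)\<^sup>2)"
    define H where "H = (\<Sum>A\<in>Pow J. (c (insert i A))\<^sup>2)"
    have split: "(\<Sum>A\<in>Pow (insert i J). k A) = (\<Sum>A\<in>Pow J. k A) + (\<Sum>A\<in>Pow J. k (insert i A))" for k :: "nat set \<Rightarrow> real"
    proof -
      have "inj_on (insert i) (Pow J)" using insert.hyps(2) by (auto simp: inj_on_def)
      then show ?thesis unfolding Pow_insert using insert.hyps
        by (subst sum.union_disjoint) (auto simp: sum.reindex)
    qed
    have notin: "i \<notin> A" "finite A" if "A \<in> Pow J" for A
      using that insert.hyps finite_subset by auto
    have sum_eq: "(\<Sum>A\<in>Pow (insert i J). \<rho> ^ card A * c A * walsh A \<epsilon>) = g \<epsilon> + \<rho> * \<epsilon> i * h \<epsilon>" for \<epsilon>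
      unfolding split g_def h_def using notin
      by (simp add: walsh_insert sum_distrib_left mult_ac)
    define fl where "fl \<epsilon> = \<epsilon>(i := - \<epsilon> i)" for \<epsilon> :: "nat \<Rightarrow> real"
    have iI: "i \<in> I" using insert.prems by auto
    have fl: "fl ` signs I \<subseteq> signs I"
      using iI by (auto simp: fl_def PiE_iff extensional_def) blast+
    have bij: "bij_betw fl (signs I) (signs I)"
      by (rule bij_betw_byWitness[where f'=fl]) (use fl in \<open>auto simp: fl_def\<close>)
    have inv: "g (fl \<epsilon>) = g \<epsilon>" "h (fl \<epsilon>) = h \<epsilon>" for \<epsilon>
      unfolding g_def h_def fl_def using notin by (auto intro!: sum.cong simp: walsh_fun_upd)
    have IH: "?E (\<lambda>\<epsilon>. g \<epsilon> ^ 4) \<le> G\<^sup>2" "?E (\<lambda>\<epsilon>. h \<epsilon> ^ 4) \<le> H\<^sup>2"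
      unfolding g_def h_def G_def H_def using insert.prems by (auto intro!: insert.IH)
    have GH: "G \<ge> 0" "H \<ge> 0" by (auto simp: G_def H_def intro: sum_nonneg)
    have "(?E (\<lambda>\<epsilon>. (g \<epsilon>)\<^sup>2 * (h \<epsilon>)\<^sup>2))\<^sup>2 \<le> ?E (\<lambda>\<epsilon>. ((g \<epsilon>)\<^sup>2)\<^sup>2) * ?E (\<lambda>\<epsilon>. ((h \<epsilon>)\<^sup>2)\<^sup>2)"
      by (rule avg_cauchy_schwarz)
    also have "\<dots> \<le> G\<^sup>2 * H\<^sup>2"
      using IH by (intro mult_mono avg_nonneg) auto
    finally have "(?E (\<lambda>\<epsilon>. (g \<epsilon>)\<^sup>2 * (h \<epsilon>)\<^sup>2))\<^sup>2 \<le> (G * H)\<^sup>2" by (simp add: power_mult_distrib)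
    then have gh: "?E (\<lambda>\<epsilon>. (g \<epsilon>)\<^sup>2 * (h \<epsilon>)\<^sup>2) \<le> G * H"
      by (rule power2_le_imp_le) (use GH in simp)
    let ?F = "\<lambda>\<epsilon>. (g \<epsilon> + \<rho> * \<epsilon> i * h \<epsilon>) ^ 4"
    \<comment> \<open>Averaging with the flip of the sign at \<open>i\<close> removes the odd powers
      of \<open>\<epsilon> i\<close>. The surviving mixed term is bounded by \<open>G * H\<close>
      through Cauchy-Schwarz.\<close>
    have "?E ?F = (1 / 2) * (?E ?F + ?E (\<lambda>\<epsilon>. ?F (fl \<epsilon>)))"
      using avg_bij[OF bij, of ?F] by simp
    also have "\<dots> = ?E (\<lambda>\<epsilon>. (1 / 2) * (?F \<epsilon> + ?F (fl \<epsilon>)))"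
      by (simp only: avg_add avg_cmult)
    also have "\<dots> = ?E (\<lambda>\<epsilon>. g \<epsilon> ^ 4 + (2 * ((g \<epsilon>)\<^sup>2 * (h \<epsilon>)\<^sup>2) + (1 / 9) * h \<epsilon> ^ 4))"
    proof (rule avg_cong)
      fix \<epsilon> assume e: "\<epsilon> \<in> signs I"
      have e2: "(\<epsilon> i)\<^sup>2 = 1" using signs_square[OF e iI] by (simp add: power2_eq_square)
      have "(1 / 2) * (?F \<epsilon> + ?F (fl \<epsilon>))
          = g \<epsilon> ^ 4 + (6 * (\<rho>\<^sup>2 * (\<epsilon> i)\<^sup>2) * ((g \<epsilon>)\<^sup>2 * (h \<epsilon>)\<^sup>2) + (\<rho>\<^sup>2 * (\<epsilon> i)\<^sup>2)\<^sup>2 * h \<epsilon> ^ 4)"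
        unfolding inv by (simp add: fl_def) algebra
      then show "(1 / 2) * (?F \<epsilon> + ?F (fl \<epsilon>)) = g \<epsilon> ^ 4 + (2 * ((g \<epsilon>)\<^sup>2 * (h \<epsilon>)\<^sup>2) + (1 / 9) * h \<epsilon> ^ 4)"
        unfolding e2 \<rho> by (simp add: power_divide)
    qed
    also have "\<dots> = ?E (\<lambda>\<epsilon>. g \<epsilon> ^ 4) + (2 * ?E (\<lambda>\<epsilon>. (g \<epsilon>)\<^sup>2 * (h \<epsilon>)\<^sup>2) + (1 / 9) * ?E (\<lambda>\<epsilon>. h \<epsilon> ^ 4))"
      by (simp only: avg_add avg_cmult)
    also have "\<dots> \<le> G\<^sup>2 + (2 * (G * H) + H\<^sup>2)"
    proof -
      have "0 \<le> ?E (\<lambda>\<epsilon>. h \<epsilon> ^ 4)" by (intro avg_nonneg) auto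
      then show ?thesis using IH gh by linarith
    qed
    also have "\<dots> = (G + H)\<^sup>2" by (simp add: power2_eq_square algebra_simps)
    also have "G + H = (\<Sum>A\<in>Pow (insert i J). (c A)\<^sup>2)" unfolding split G_def H_def ..
    finally show ?case unfolding sum_eq .
  qed
qed

text \<open>The noise operator, which multiplies the coefficient of \<open>A\<close> by
  \<open>\<rho> ^ card A\<close>. In kernel form its positivity is visible, and it can be applied to
  norms of vector-valued polynomials.\<close>

definition noise :: "nat set \<Rightarrow> ((nat \<Rightarrow> real) \<Rightarrow> real) \<Rightarrow> (nat \<Rightarrow> real) \<Rightarrow> real" where
  "noise I F \<epsilon> = avg (signs I) (\<lambda>\<eta>. riesz I (\<lambda>i. \<rho> * \<epsilon> i) \<eta> * F \<eta>)"

lemma riesz_noise_nonneg: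
  assumes "\<epsilon> \<in> signs I" "\<eta> \<in> signs I"
  shows "riesz I (\<lambda>i. \<rho> * \<epsilon> i) \<eta> \<ge> 0"
  using assms(2) by (rule riesz_nonneg) (use assms(1) \<rho> in \<open>simp add: abs_mult signs_abs\<close>)

lemma noise_mono:
  assumes "\<epsilon> \<in> signs I" "\<And>\<eta>. \<eta> \<in> signs I \<Longrightarrow> F \<eta> \<le> G \<eta>"
  shows "noise I F \<epsilon> \<le> noise I G \<epsilon>"
  unfolding noise_def using assms by (intro avg_mono mult_left_mono riesz_noise_nonneg)

lemma noise_nonneg:
  "\<epsilon> \<in> signs I \<Longrightarrow> (\<And>\<eta>. \<eta> \<in> signs I \<Longrightarrow> 0 \<le> F \<eta>) \<Longrightarrow> 0 \<le> noise I F \<epsilon>"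
  unfolding noise_def by (intro avg_nonneg mult_nonneg_nonneg riesz_noise_nonneg)

lemma noise_self_adjoint:
  "avg (signs I) (\<lambda>\<epsilon>. F \<epsilon> * noise I G \<epsilon>) = avg (signs I) (\<lambda>\<epsilon>. noise I F \<epsilon> * G \<epsilon>)"
proof -
  have sym: "riesz I (\<lambda>i. \<rho> * \<epsilon> i) \<eta> = riesz I (\<lambda>i. \<rho> * \<eta> i) \<epsilon>" for \<epsilon> \<eta>
    by (simp add: riesz_def mult_ac)
  have "avg (signs I) (\<lambda>\<epsilon>. F \<epsilon> * noise I G \<epsilon>)
      = avg (signs I) (\<lambda>\<epsilon>. avg (signs I) (\<lambda>\<eta>. F \<epsilon> * (riesz I (\<lambda>i. \<rho> * \<epsilon> i) \<eta> * G \<eta>)))"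
    by (simp add: noise_def avg_cmult)
  also have "\<dots> = avg (signs I) (\<lambda>\<eta>. avg (signs I) (\<lambda>\<epsilon>. G \<eta> * (riesz I (\<lambda>i. \<rho> * \<eta> i) \<epsilon> * F \<epsilon>)))"
    by (subst avg_swap, intro avg_cong, subst sym, simp only: mult_ac)
  also have "\<dots> = avg (signs I) (\<lambda>\<eta>. noise I F \<eta> * G \<eta>)"
    by (simp add: noise_def avg_cmult mult.commute)
  finally show ?thesis .
qed

lemma bonami:
  assumes "finite I"
  shows "avg (signs I) (\<lambda>\<epsilon>. noise I F \<epsilon> ^ 4) \<le> (avg (signs I) (\<lambda>\<epsilon>. (F \<epsilon>)\<^sup>2))\<^sup>2"
proof -
  define c where "c A = avg (signs I) (\<lambda>\<eta>. F \<eta> * walsh A \<eta>)" for A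
  have "noise I F \<epsilon> = (\<Sum>A\<in>Pow I. \<rho> ^ card A * c A * walsh A \<epsilon>)" for \<epsilon>
  proof -
    have "riesz I (\<lambda>i. \<rho> * \<epsilon> i) \<eta> * F \<eta>
        = (\<Sum>A\<in>Pow I. (\<rho> ^ card A * walsh A \<epsilon>) * (F \<eta> * walsh A \<eta>))" for \<eta>
      by (simp add: riesz_expand[OF assms] sum_distrib_left prod.distrib walsh_def mult_ac)
    then have "noise I F \<epsilon> = (\<Sum>A\<in>Pow I. (\<rho> ^ card A * walsh A \<epsilon>) * c A)"
      by (simp only: noise_def avg_sum avg_cmult c_def)
    then show ?thesis by (simp add: mult_ac)
  qed
  then have "avg (signs I) (\<lambda>\<epsilon>. noise I F \<epsilon> ^ 4) \<le> (\<Sum>A\<in>Pow I. (c A)\<^sup>2)\<^sup>2"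
    using bonami_coefficients[OF assms order.refl] by simp
  also have "\<dots> \<le> (avg (signs I) (\<lambda>\<epsilon>. (F \<epsilon>)\<^sup>2))\<^sup>2"
    unfolding c_def by (intro power_mono avg_bessel assms sum_nonneg) auto
  finally show ?thesis .
qed

text \<open>Bonami's inequality for \<open>F powr (t / 2)\<close>: since
  \<open>t / 2 \<ge> 1\<close>, Jensen moves this power through the positive kernel. The same \<rho>
  therefore works for every doubling of the exponent.\<close>

lemma noise_hypercontractive:
  assumes I: "finite I" and F: "\<And>\<eta>. \<eta> \<in> signs I \<Longrightarrow> 0 \<le> F \<eta>" and t: "t \<ge> 2"
  shows "(avg (signs I) (\<lambda>\<epsilon>. noise I F \<epsilon> powr (2 * t))) powr (1 / (2 * t))
    \<le> (avg (signs I) (\<lambda>\<epsilon>. F \<epsilon> powr t)) powr (1 / t)"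
proof -
  have "avg (signs I) (\<lambda>\<epsilon>. noise I F \<epsilon> powr (2 * t))
      \<le> avg (signs I) (\<lambda>\<epsilon>. noise I (\<lambda>\<eta>. F \<eta> powr (t / 2)) \<epsilon> ^ 4)"
  proof (rule avg_mono)
    fix \<epsilon> assume e: "\<epsilon> \<in> signs I"
    have "noise I F \<epsilon> powr (2 * t) = (noise I F \<epsilon> powr (t / 2)) powr 4"
      by (simp add: powr_powr)
    also have "\<dots> \<le> (noise I (\<lambda>\<eta>. F \<eta> powr (t / 2)) \<epsilon>) powr 4"
      unfolding noise_def using I F t e \<rho>
      by (intro powr_mono2 avg_riesz_powr_le) (auto simp: abs_mult signs_abs)
    also have "\<dots> = (noise I (\<lambda>\<eta>. F \<eta> powr (t / 2)) \<epsilon>) ^ 4"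
    proof -
      have "0 \<le> noise I (\<lambda>\<eta>. F \<eta> powr (t / 2)) \<epsilon>" using e by (rule noise_nonneg) simp
      then show ?thesis
        by (cases "noise I (\<lambda>\<eta>. F \<eta> powr (t / 2)) \<epsilon> = 0") (auto simp: powr_numeral)
    qed
    finally show "noise I F \<epsilon> powr (2 * t) \<le> (noise I (\<lambda>\<eta>. F \<eta> powr (t / 2)) \<epsilon>) ^ 4" .
  qed
  also have "\<dots> \<le> (avg (signs I) (\<lambda>\<epsilon>. (F \<epsilon> powr (t / 2))\<^sup>2))\<^sup>2" by (rule bonami[OF I])
  also have "\<dots> = (avg (signs I) (\<lambda>\<epsilon>. F \<epsilon> powr t))\<^sup>2"
    by (simp add: power2_eq_square powr_add[symmetric])
  finally have "(avg (signs I) (\<lambda>\<epsilon>. noise I F \<epsilon> powr (2 * t))) powr (1 / (2 * t))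
      \<le> ((avg (signs I) (\<lambda>\<epsilon>. F \<epsilon> powr t))\<^sup>2) powr (1 / (2 * t))"
    using t by (intro powr_mono2 avg_nonneg) auto
  also have "\<dots> = ((avg (signs I) (\<lambda>\<epsilon>. F \<epsilon> powr t)) powr 2) powr (1 / (2 * t))"
    by (simp add: powr_numeral avg_nonneg)
  also have "\<dots> = (avg (signs I) (\<lambda>\<epsilon>. F \<epsilon> powr t)) powr (1 / t)"
    using t by (simp add: powr_powr)
  finally show ?thesis .
qed


section \<open>Exponents below 2 by duality\<close>

lemma avg_hoelder:
  assumes F: "\<And>w. w \<in> W \<Longrightarrow> 0 \<le> F w" and G: "\<And>w. w \<in> W \<Longrightarrow> 0 \<le> G w"
    and W: "finite W" "W \<noteq> {}" and p: "1 < p" "1 / p + 1 / p' = 1"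
  shows "avg W (\<lambda>w. F w * G w) \<le> (avg W (\<lambda>w. F w powr p)) powr (1 / p) * (avg W (\<lambda>w. G w powr p')) powr (1 / p')"
proof -
  have p': "1 < p'"
  proof -
    have "1 / p < 1" "1 / p > 0" using p by auto
    then have "0 < 1 / p'" "1 / p' < 1" using p(2) by linarith+
    then show ?thesis by (simp add: field_simps split: if_splits)
  qed
  define a where "a = (avg W (\<lambda>w. F w powr p)) powr (1 / p)"
  define b where "b = (avg W (\<lambda>w. G w powr p')) powr (1 / p')"
  have ab: "a \<ge> 0" "b \<ge> 0" by (simp_all add: a_def b_def)
  have ap: "a powr p = avg W (\<lambda>w. F w powr p)" "b powr p' = avg W (\<lambda>w. G w powr p')"
    using p p' by (simp_all add: a_def b_def powr_powr avg_nonneg)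
  have zero: "avg W (\<lambda>w. F w * G w) = 0" if "(\<forall>w\<in>W. F w = 0) \<or> (\<forall>w\<in>W. G w = 0)"
    using that by (auto simp: avg_def)
  have az: "a = 0 \<Longrightarrow> \<forall>w\<in>W. F w = 0" and bz: "b = 0 \<Longrightarrow> \<forall>w\<in>W. G w = 0"
    using ap W by (simp_all add: avg_def sum_nonneg_eq_0_iff)
  show ?thesis
  proof (cases "a = 0 \<or> b = 0")
    case True
    then have "avg W (\<lambda>w. F w * G w) = 0" using zero az bz by blast
    then show ?thesis using ab by (simp add: a_def b_def)
  next
    case False
    then have pos: "a > 0" "b > 0" using ab by auto
    have "avg W (\<lambda>w. (1 / (a * b)) * (F w * G w))
        \<le> avg W (\<lambda>w. (1 / (p * a powr p)) * F w powr p + (1 / (p' * b powr p')) * G w powr p')"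
    proof (rule avg_mono)
      fix w assume w: "w \<in> W"
      have "(F w / a) * (G w / b) \<le> (F w / a) powr p / p + (G w / b) powr p' / p'"
        using F[OF w] G[OF w] pos p p' by (intro Youngs_inequality) auto
      then show "(1 / (a * b)) * (F w * G w)
          \<le> (1 / (p * a powr p)) * F w powr p + (1 / (p' * b powr p')) * G w powr p'"
        using F[OF w] G[OF w] pos by (simp add: powr_divide mult_ac)
    qed
    also have "\<dots> = 1 / p + 1 / p'"
      unfolding avg_add avg_cmult ap[symmetric] using pos by simp
    finally have "(1 / (a * b)) * avg W (\<lambda>w. F w * G w) \<le> 1" unfolding p(2) avg_cmult .
    then show ?thesis using pos by (simp add: a_def[symmetric] b_def[symmetric] field_simps)
  qed
qed

lemma noise_iterate_nonneg:
  "(\<And>\<eta>. \<eta> \<in> signs I \<Longrightarrow> 0 \<le> F \<eta>) \<Longrightarrow> \<epsilon> \<in> signs I \<Longrightarrow> 0 \<le> (noise I ^^ k) F \<epsilon>"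
  by (induction k arbitrary: \<epsilon>) (auto intro: noise_nonneg)

lemma noise_iterate_hypercontractive:
  assumes I: "finite I" and F: "\<And>\<eta>. \<eta> \<in> signs I \<Longrightarrow> 0 \<le> F \<eta>"
  shows "(avg (signs I) (\<lambda>\<epsilon>. (noise I ^^ k) F \<epsilon> powr (2 ^ Suc k))) powr (1 / 2 ^ Suc k)
    \<le> (avg (signs I) (\<lambda>\<epsilon>. F \<epsilon> powr 2)) powr (1 / 2)"
proof (induction k)
  case (Suc k)
  have "(2::real) ^ 1 \<le> 2 ^ Suc k" by (intro power_increasing) auto
  then have "(2::real) \<le> 2 ^ Suc k" by simp
  from noise_hypercontractive[OF I, of "(noise I ^^ k) F", OF noise_iterate_nonneg[OF F] this]
  show ?case using Suc.IH by simp
qed simp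

lemma noise_iterate_self_adjoint:
  "avg (signs I) (\<lambda>\<epsilon>. F \<epsilon> * (noise I ^^ k) G \<epsilon>) = avg (signs I) (\<lambda>\<epsilon>. (noise I ^^ k) F \<epsilon> * G \<epsilon>)"
  by (induction k arbitrary: F G) (simp_all add: noise_self_adjoint funpow_swap1)

text \<open>The iterate is self-adjoint and maps L2 into the space with exponent
  \<open>2 ^ Suc k\<close>, so it maps Lp into L2 once the conjugate exponent of \<open>p\<close> is
  at most \<open>2 ^ Suc k\<close>. Duality is made explicit by pairing \<open>G\<close>, the image
  of \<open>F\<close>, with itself and moving the iterate to the other side.\<close>

lemma noise_iterate_le:
  assumes I: "finite I" and F: "\<And>\<eta>. \<eta> \<in> signs I \<Longrightarrow> 0 \<le> F \<eta>"
    and p: "1 < p" "1 / p + 1 / 2 ^ Suc k \<le> 1"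
  shows "(avg (signs I) (\<lambda>\<epsilon>. (noise I ^^ k) F \<epsilon> powr 2)) powr (1 / 2)
    \<le> (avg (signs I) (\<lambda>\<epsilon>. F \<epsilon> powr p)) powr (1 / p)"
proof -
  define G where "G = (noise I ^^ k) F"
  have G: "\<And>\<eta>. \<eta> \<in> signs I \<Longrightarrow> 0 \<le> G \<eta>" unfolding G_def by (intro noise_iterate_nonneg F)
  note GG = noise_iterate_nonneg[OF G]
  define p' where "p' = p / (p - 1)"
  have conj: "1 / p + 1 / p' = 1" using p by (simp add: p'_def field_simps)
  have p'1: "p' > 0" using p by (simp add: p'_def)
  have p'le: "p' \<le> 2 ^ Suc k"
  proof -
    have "1 / 2 ^ Suc k \<le> 1 / p'" using p conj by linarith
    then show ?thesis using p'1 by (simp add: field_simps)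
  qed
  define n where "n = (avg (signs I) (\<lambda>\<epsilon>. G \<epsilon> powr 2)) powr (1 / 2)"
  have n0: "n \<ge> 0" by (simp add: n_def)
  have "n * n = avg (signs I) (\<lambda>\<epsilon>. G \<epsilon> powr 2)"
    by (simp add: n_def powr_add[symmetric] avg_nonneg)
  also have "\<dots> = avg (signs I) (\<lambda>\<epsilon>. G \<epsilon> * G \<epsilon>)"
    by (intro avg_cong) (use G in \<open>simp add: power2_eq_square\<close>)
  also have "\<dots> = avg (signs I) (\<lambda>\<epsilon>. F \<epsilon> * (noise I ^^ k) G \<epsilon>)"
    unfolding noise_iterate_self_adjoint by (simp add: G_def)
  also have "\<dots> \<le> (avg (signs I) (\<lambda>\<epsilon>. F \<epsilon> powr p)) powr (1 / p)
      * (avg (signs I) (\<lambda>\<epsilon>. (noise I ^^ k) G \<epsilon> powr p')) powr (1 / p')"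
    using F GG I p conj by (intro avg_hoelder) (auto simp: signs_finite_nonempty)
  also have "\<dots> \<le> (avg (signs I) (\<lambda>\<epsilon>. F \<epsilon> powr p)) powr (1 / p) * n"
  proof (rule mult_left_mono)
    have "(avg (signs I) (\<lambda>\<epsilon>. (noise I ^^ k) G \<epsilon> powr p')) powr (1 / p')
        \<le> (avg (signs I) (\<lambda>\<epsilon>. (noise I ^^ k) G \<epsilon> powr (2 ^ Suc k))) powr (1 / 2 ^ Suc k)"
      using I GG p'1 p'le by (intro avg_powr_mono_exponent) (auto simp: signs_finite_nonempty)
    also have "\<dots> \<le> n" unfolding n_def by (rule noise_iterate_hypercontractive[OF I G])
    finally show "(avg (signs I) (\<lambda>\<epsilon>. (noise I ^^ k) G \<epsilon> powr p')) powr (1 / p') \<le> n" .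
  qed simp
  finally have "n * n \<le> (avg (signs I) (\<lambda>\<epsilon>. F \<epsilon> powr p)) powr (1 / p) * n" .
  then have "n \<le> (avg (signs I) (\<lambda>\<epsilon>. F \<epsilon> powr p)) powr (1 / p)"
    using n0 by (cases "n = 0") auto
  then show ?thesis by (simp add: n_def G_def)
qed

lemma norm_rpoly_noise_le:
  fixes y :: "nat set \<Rightarrow> 'a::real_normed_vector"
  assumes I: "finite I" and e: "\<epsilon> \<in> signs I"
  shows "norm (rpoly I (\<lambda>A. \<rho> ^ card A *\<^sub>R y A) \<epsilon>) \<le> noise I (\<lambda>\<eta>. norm (rpoly I y \<eta>)) \<epsilon>"
proof -
  have "rpoly I (\<lambda>A. \<rho> ^ card A *\<^sub>R y A) \<epsilon> = (\<Sum>A\<in>Pow I. (\<Prod>i\<in>A. \<rho> * \<epsilon> i) *\<^sub>R y A)"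
    by (simp add: rpoly_def walsh_def prod.distrib mult.commute)
  moreover have "\<bar>\<rho> * \<epsilon> i\<bar> \<le> 1" if "i \<in> I" for i
    using \<rho> e that by (simp add: abs_mult signs_abs)
  ultimately show ?thesis
    unfolding noise_def using riesz_multiplier_norm_le[OF I, of "\<lambda>i. \<rho> * \<epsilon> i" y] by simp
qed

lemma norm_rpoly_noise_iterate_le:
  fixes y :: "nat set \<Rightarrow> 'a::real_normed_vector"
  assumes I: "finite I" and e: "\<epsilon> \<in> signs I"
  shows "norm (rpoly I (\<lambda>A. (\<rho> ^ k) ^ card A *\<^sub>R y A) \<epsilon>) \<le> (noise I ^^ k) (\<lambda>\<eta>. norm (rpoly I y \<eta>)) \<epsilon>"
  using e
proof (induction k arbitrary: \<epsilon>)
  case (Suc k)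
  have "(\<lambda>A. (\<rho> ^ Suc k) ^ card A *\<^sub>R y A) = (\<lambda>A. \<rho> ^ card A *\<^sub>R ((\<rho> ^ k) ^ card A *\<^sub>R y A))"
    by (simp add: power_mult_distrib)
  then have "norm (rpoly I (\<lambda>A. (\<rho> ^ Suc k) ^ card A *\<^sub>R y A) \<epsilon>)
      \<le> noise I (\<lambda>\<eta>. norm (rpoly I (\<lambda>A. (\<rho> ^ k) ^ card A *\<^sub>R y A) \<eta>)) \<epsilon>"
    using norm_rpoly_noise_le[OF I Suc.prems, of "\<lambda>A. (\<rho> ^ k) ^ card A *\<^sub>R y A"] by simp
  also have "\<dots> \<le> noise I ((noise I ^^ k) (\<lambda>\<eta>. norm (rpoly I y \<eta>))) \<epsilon>"
    using Suc.prems Suc.IH by (intro noise_mono)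
  finally show ?case by simp
qed (simp add: rpoly_def)

text \<open>The number \<open>k\<close> depends on \<open>p\<close> only, so the damping
  \<open>(\<rho> ^ k) ^ card A\<close> is geometric in the degree and can be absorbed by the weight
  in the coefficient inequality.\<close>

lemma rpoly_hypercontractive:
  fixes p :: real
  assumes "1 < p"
  shows "\<exists>k. \<forall>I (y :: nat set \<Rightarrow> 'a::real_normed_vector). finite I \<longrightarrow>
    (avg (signs I) (\<lambda>\<epsilon>. norm (rpoly I (\<lambda>A. (\<rho> ^ k) ^ card A *\<^sub>R y A) \<epsilon>) powr 2)) powr (1 / 2)
    \<le> (avg (signs I) (\<lambda>\<epsilon>. norm (rpoly I y \<epsilon>) powr p)) powr (1 / p)"
proof -
  have "1 - 1 / p > 0" using assms by simp
  obtain k where k: "1 / (1 - 1 / p) < 2 ^ k"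
    using real_arch_pow[of 2 "1 / (1 - 1 / p)"] by (meson one_less_numeral_iff semiring_norm(76))
  have "1 / (1 - 1 / p) \<le> 2 ^ Suc k"
    using k power_increasing[of k "Suc k" "2::real"] by linarith
  then have "1 / 2 ^ Suc k \<le> 1 - 1 / p"
    using \<open>1 - 1 / p > 0\<close> by (simp add: field_simps)
  then have "1 / p + 1 / 2 ^ Suc k \<le> 1" by simp
  note * = noise_iterate_le[OF _ _ assms(1) this]
  have "(avg (signs I) (\<lambda>\<epsilon>. norm (rpoly I (\<lambda>A. (\<rho> ^ k) ^ card A *\<^sub>R y A) \<epsilon>) powr 2)) powr (1 / 2)
    \<le> (avg (signs I) (\<lambda>\<epsilon>. norm (rpoly I y \<epsilon>) powr p)) powr (1 / p)"
    if I: "finite I" for I and y :: "nat set \<Rightarrow> 'a"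
  proof -
    have "(avg (signs I) (\<lambda>\<epsilon>. norm (rpoly I (\<lambda>A. (\<rho> ^ k) ^ card A *\<^sub>R y A) \<epsilon>) powr 2)) powr (1 / 2)
        \<le> (avg (signs I) (\<lambda>\<epsilon>. (noise I ^^ k) (\<lambda>\<eta>. norm (rpoly I y \<eta>)) \<epsilon> powr 2)) powr (1 / 2)"
      by (intro powr_mono2 avg_mono avg_nonneg norm_rpoly_noise_iterate_le I) auto
    also have "\<dots> \<le> (avg (signs I) (\<lambda>\<epsilon>. norm (rpoly I y \<epsilon>) powr p)) powr (1 / p)"
      by (intro * I) auto
    finally show ?thesis .
  qed
  then show ?thesis by blast
qed

section \<open>Rademacher sums and Kahane's inequality\<close>

lemma rsum_noise:
  fixes x :: "nat \<Rightarrow> 'a::real_normed_vector"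
  assumes I: "finite I" and e: "\<epsilon> \<in> signs I"
  shows "\<rho> * norm (\<Sum>j\<in>I. \<epsilon> j *\<^sub>R x j) \<le> noise I (\<lambda>\<eta>. norm (\<Sum>j\<in>I. \<eta> j *\<^sub>R x j)) \<epsilon>"
proof -
  \<comment> \<open>A Rademacher sum is homogeneous of degree one, hence an eigenvector of the noise
    multiplier with eigenvalue \<rho>. Damping thus amounts to a constant factor.\<close>
  let ?y = "\<lambda>A. if card A = 1 then x (the_elem A) else 0"
  have "(\<lambda>A. \<rho> ^ card A *\<^sub>R ?y A) = (\<lambda>A. if card A = 1 then (\<lambda>j. \<rho> *\<^sub>R x j) (the_elem A) else 0)"
    by auto
  then have "rpoly I (\<lambda>A. \<rho> ^ card A *\<^sub>R ?y A) \<epsilon> = \<rho> *\<^sub>R (\<Sum>j\<in>I. \<epsilon> j *\<^sub>R x j)"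
    using rpoly_singletons[OF I, of "\<lambda>j. \<rho> *\<^sub>R x j" \<epsilon>] by (simp add: scaleR_sum_right mult.commute)
  then show ?thesis
    using norm_rpoly_noise_le[OF I e, of ?y] \<rho> unfolding rpoly_singletons[OF I] by simp
qed

lemma rsum_doubling:
  fixes x :: "nat \<Rightarrow> 'a::real_normed_vector"
  assumes I: "finite I" and t: "t \<ge> 2"
  defines "a \<equiv> \<lambda>\<epsilon>. norm (\<Sum>j\<in>I. \<epsilon> j *\<^sub>R x j)"
  shows "\<rho> * (avg (signs I) (\<lambda>\<epsilon>. a \<epsilon> powr (2 * t))) powr (1 / (2 * t))
    \<le> (avg (signs I) (\<lambda>\<epsilon>. a \<epsilon> powr t)) powr (1 / t)"
proof -
  have "\<rho> * (avg (signs I) (\<lambda>\<epsilon>. a \<epsilon> powr (2 * t))) powr (1 / (2 * t))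
      = (\<rho> powr (2 * t) * avg (signs I) (\<lambda>\<epsilon>. a \<epsilon> powr (2 * t))) powr (1 / (2 * t))"
    using \<rho> t by (simp add: powr_mult powr_powr avg_nonneg)
  also have "\<dots> = (avg (signs I) (\<lambda>\<epsilon>. (\<rho> * a \<epsilon>) powr (2 * t))) powr (1 / (2 * t))"
    using \<rho> by (simp add: avg_cmult[symmetric] powr_mult a_def)
  also have "\<dots> \<le> (avg (signs I) (\<lambda>\<epsilon>. noise I a \<epsilon> powr (2 * t))) powr (1 / (2 * t))"
    using t rsum_noise[OF I, of _ x] \<rho>
    by (intro powr_mono2 avg_mono avg_nonneg) (auto simp: a_def)
  also have "\<dots> \<le> (avg (signs I) (\<lambda>\<epsilon>. a \<epsilon> powr t)) powr (1 / t)"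
    using t by (intro noise_hypercontractive I) (auto simp: a_def)
  finally show ?thesis .
qed


text \<open>Interpolation between the exponents 1, 2, 3, 4 by Cauchy-Schwarz.\<close>

lemma rsum_L2_le_L1:
  fixes x :: "nat \<Rightarrow> 'a::real_normed_vector"
  assumes I: "finite I"
  defines "a \<equiv> \<lambda>\<epsilon>. norm (\<Sum>j\<in>I. \<epsilon> j *\<^sub>R x j)"
  shows "(avg (signs I) (\<lambda>\<epsilon>. a \<epsilon> powr 2)) powr (1 / 2) \<le> 3 * avg (signs I) a"
proof -
  let ?E = "avg (signs I)"
  have a0: "a \<epsilon> \<ge> 0" for \<epsilon> by (simp add: a_def)
  define M1 where "M1 = ?E a"
  define M2 where "M2 = ?E (\<lambda>\<epsilon>. (a \<epsilon>)\<^sup>2)"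
  define M3 where "M3 = ?E (\<lambda>\<epsilon>. a \<epsilon> ^ 3)"
  define M4 where "M4 = ?E (\<lambda>\<epsilon>. a \<epsilon> ^ 4)"
  have M0: "M1 \<ge> 0" "M2 \<ge> 0" "M3 \<ge> 0" "M4 \<ge> 0"
    unfolding M1_def M2_def M3_def M4_def by (auto intro!: avg_nonneg simp: a0)
  have 1: "M2\<^sup>2 \<le> M1 * M3"
  proof -
    have "sqrt (a \<epsilon>) * (sqrt (a \<epsilon>) * a \<epsilon>) = (a \<epsilon>)\<^sup>2" for \<epsilon>
      using a0 by (simp add: mult.assoc[symmetric] power2_eq_square)
    moreover have "(sqrt (a \<epsilon>) * a \<epsilon>)\<^sup>2 = a \<epsilon> ^ 3" for \<epsilon>
      using a0 by (simp add: power_mult_distrib power2_eq_square power3_eq_cube)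
    ultimately show ?thesis
      using avg_cauchy_schwarz[of "signs I" "\<lambda>\<epsilon>. sqrt (a \<epsilon>)" "\<lambda>\<epsilon>. sqrt (a \<epsilon>) * a \<epsilon>"] a0
      by (simp add: M1_def M2_def M3_def)
  qed
  have 2: "M3\<^sup>2 \<le> M2 * M4"
  proof -
    have "(\<lambda>\<epsilon>. a \<epsilon> * (a \<epsilon>)\<^sup>2) = (\<lambda>\<epsilon>. a \<epsilon> ^ 3)" by (simp add: power2_eq_square power3_eq_cube mult.assoc)
    then show ?thesis
      using avg_cauchy_schwarz[of "signs I" a "\<lambda>\<epsilon>. (a \<epsilon>)\<^sup>2"]
      by (simp add: M2_def M3_def M4_def)
  qed
  \<comment> \<open>The factor 9 is the inverse of \<open>\<rho> ^ 4\<close>.\<close>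
  have 3: "M4 \<le> 9 * M2\<^sup>2"
  proof -
    have "\<rho> ^ 4 * M4 = ?E (\<lambda>\<epsilon>. (\<rho> * a \<epsilon>) ^ 4)"
      by (simp add: M4_def avg_cmult power_mult_distrib)
    also have "\<dots> \<le> ?E (\<lambda>\<epsilon>. noise I a \<epsilon> ^ 4)"
      using rsum_noise[OF I, of _ x] \<rho> a0 by (intro avg_mono power_mono) (auto simp: a_def)
    also have "\<dots> \<le> M2\<^sup>2" unfolding M2_def by (rule bonami[OF I])
    finally show ?thesis by (simp add: \<rho>)
  qed
  have "M2 \<le> 9 * M1\<^sup>2"
  proof (cases "M2 = 0")
    case False
    then have M2: "M2 > 0" using M0 by simp
    have "M2 ^ 4 = (M2\<^sup>2)\<^sup>2" by simp
    also have "\<dots> \<le> (M1 * M3)\<^sup>2" using 1 by (intro power_mono) auto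
    also have "\<dots> = M1\<^sup>2 * M3\<^sup>2" by (simp add: power_mult_distrib)
    also have "\<dots> \<le> M1\<^sup>2 * (M2 * (9 * M2\<^sup>2))"
      using 2 3 M0 by (intro mult_left_mono) (auto intro: order_trans mult_left_mono)
    also have "\<dots> = (9 * M1\<^sup>2) * M2 ^ 3" by (simp add: power2_eq_square power3_eq_cube)
    finally have "M2 * M2 ^ 3 \<le> (9 * M1\<^sup>2) * M2 ^ 3" by (simp add: power3_eq_cube power4_eq_xxxx)
    then show ?thesis using M2 by simp
  qed simp
  then have "M2 powr (1 / 2) \<le> ((3 * M1)\<^sup>2) powr (1 / 2)"
    using M0 by (intro powr_mono2) (auto simp: power_mult_distrib)
  also have "((3 * M1)\<^sup>2) powr (1 / 2) = 3 * M1" using M0 real_sqrt_abs[of "3 * M1"] by (simp only: powr_half_sqrt zero_le_power2 abs_of_nonneg mult_nonneg_nonneg zero_le_numeral)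
  finally show ?thesis using a0 by (simp add: M2_def M1_def)
qed

text \<open>From exponent 1 to 2 at the price of 3, then by doublings at the price of
  \<open>1 / \<rho>\<close> each, until the exponent exceeds \<open>p\<close>; monotonicity in the
  exponent does the rest. The constant depends on \<open>p\<close> alone.\<close>

lemma kahane:
  fixes p :: real
  assumes p: "p > 0"
  shows "\<exists>K\<ge>1. \<forall>I (x :: nat \<Rightarrow> 'a::real_normed_vector). finite I \<longrightarrow>
    (avg (signs I) (\<lambda>\<epsilon>. norm (\<Sum>j\<in>I. \<epsilon> j *\<^sub>R x j) powr p)) powr (1 / p)
      \<le> K * avg (signs I) (\<lambda>\<epsilon>. norm (\<Sum>j\<in>I. \<epsilon> j *\<^sub>R x j))"
proof -
  define a where "a I x \<epsilon> = norm (\<Sum>j\<in>I. \<epsilon> j *\<^sub>R x j)" for I :: "nat set" and x :: "nat \<Rightarrow> 'a" and \<epsilon> :: "nat \<Rightarrow> real"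
  have a0: "a I x \<epsilon> \<ge> 0" for I x \<epsilon> by (simp add: a_def)
  have it: "(avg (signs I) (\<lambda>\<epsilon>. a I x \<epsilon> powr (2 ^ Suc k))) powr (1 / 2 ^ Suc k) \<le> (3 / \<rho> ^ k) * avg (signs I) (a I x)"
    if I: "finite I" for I :: "nat set" and x k
  proof (induction k)
    case 0
    show ?case using rsum_L2_le_L1[OF I, of x] by (simp add: a_def)
  next
    case (Suc k)
    have "(2::real) ^ 1 \<le> 2 ^ Suc k" by (intro power_increasing) auto
    then have "\<rho> * (avg (signs I) (\<lambda>\<epsilon>. a I x \<epsilon> powr (2 * 2 ^ Suc k))) powr (1 / (2 * 2 ^ Suc k))
      \<le> (avg (signs I) (\<lambda>\<epsilon>. a I x \<epsilon> powr (2 ^ Suc k))) powr (1 / (2 ^ Suc k))"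
      unfolding a_def by (intro rsum_doubling I) simp
    also note Suc.IH
    finally show ?case using \<rho> by (simp add: field_simps)
  qed
  obtain k where k: "p < 2 ^ k"
    using real_arch_pow[of 2 p] by (meson one_less_numeral_iff semiring_norm(76))
  have k': "p \<le> 2 ^ Suc k" using k power_increasing[of k "Suc k" "2::real"] by linarith
  show ?thesis
  proof (intro exI[of _ "3 / \<rho> ^ k"] conjI allI impI)
    have "\<rho> ^ k \<le> 1" "\<rho> ^ k > 0" using \<rho> by (auto intro: power_le_one)
    then show "1 \<le> 3 / \<rho> ^ k" by (simp add: field_simps)
    fix I :: "nat set" and x :: "nat \<Rightarrow> 'a" assume I: "finite I"
    have "(avg (signs I) (\<lambda>\<epsilon>. a I x \<epsilon> powr p)) powr (1 / p)
        \<le> (avg (signs I) (\<lambda>\<epsilon>. a I x \<epsilon> powr (2 ^ Suc k))) powr (1 / 2 ^ Suc k)"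
      using p k' I a0 by (intro avg_powr_mono_exponent) (auto simp: signs_finite_nonempty)
    also note it[OF I]
    finally show "(avg (signs I) (\<lambda>\<epsilon>. norm (\<Sum>j\<in>I. \<epsilon> j *\<^sub>R x j) powr p)) powr (1 / p)
      \<le> 3 / \<rho> ^ k * avg (signs I) (\<lambda>\<epsilon>. norm (\<Sum>j\<in>I. \<epsilon> j *\<^sub>R x j))"
      by (simp add: a_def[abs_def])
  qed
qed

section \<open>The contraction principle\<close>

lemma bij_signs_mult:
  assumes "\<eta> \<in> signs I"
  shows "bij_betw (\<lambda>\<epsilon>. \<lambda>i\<in>I. \<epsilon> i * \<eta> i) (signs I) (signs I)"
proof -
  have inv: "(\<lambda>i\<in>I. (\<lambda>i\<in>I. \<epsilon> i * \<eta> i) i * \<eta> i) = \<epsilon>" if "\<epsilon> \<in> signs I" for \<epsilon>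
  proof
    fix i show "(\<lambda>i\<in>I. (\<lambda>i\<in>I. \<epsilon> i * \<eta> i) i * \<eta> i) i = \<epsilon> i"
      using signs_square[OF assms, of i] PiE_arb[OF that, of i] by (simp add: mult.assoc)
  qed
  have "\<epsilon> i * \<eta> i \<in> {-1, 1}" if "\<epsilon> \<in> signs I" "i \<in> I" for \<epsilon> i
    using PiE_mem[OF that] PiE_mem[OF assms that(2)] by auto
  then have sub: "(\<lambda>\<epsilon>. \<lambda>i\<in>I. \<epsilon> i * \<eta> i) ` signs I \<subseteq> signs I"
    by (simp only: image_subset_iff restrict_PiE_iff) blast
  show ?thesis
    by (rule bij_betw_byWitness[where f'="\<lambda>\<epsilon>. \<lambda>i\<in>I. \<epsilon> i * \<eta> i"]) (use inv sub in blast)+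
qed

text \<open>For fixed \<epsilon> the sum with factors \<open>a j\<close> is an average of the sums
  with signs \<open>\<epsilon> i * \<eta> i\<close>, weighted by the Riesz product in \<eta>. These
  products are distributed like \<epsilon>, and the weight has mean one.\<close>

lemma real_contraction:
  fixes x :: "nat \<Rightarrow> 'a::real_normed_vector"
  assumes I: "finite I" and a: "\<And>i. i \<in> I \<Longrightarrow> \<bar>a i\<bar> \<le> 1" and p: "p \<ge> 1"
  shows "avg (signs I) (\<lambda>\<epsilon>. norm (\<Sum>j\<in>I. \<epsilon> j *\<^sub>R a j *\<^sub>R x j) powr p)
    \<le> avg (signs I) (\<lambda>\<epsilon>. norm (\<Sum>j\<in>I. \<epsilon> j *\<^sub>R x j) powr p)"
proof -
  let ?E = "avg (signs I)"
  let ?n = "\<lambda>\<epsilon>. norm (\<Sum>j\<in>I. \<epsilon> j *\<^sub>R x j)"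
  have "?E (\<lambda>\<epsilon>. norm (\<Sum>j\<in>I. \<epsilon> j *\<^sub>R a j *\<^sub>R x j) powr p)
      \<le> ?E (\<lambda>\<epsilon>. ?E (\<lambda>\<eta>. riesz I a \<eta> * ?n (\<lambda>i\<in>I. \<epsilon> i * \<eta> i) powr p))"
  proof (rule avg_mono)
    fix \<epsilon> assume e: "\<epsilon> \<in> signs I"
    let ?y = "\<lambda>A. if card A = 1 then (\<lambda>j. \<epsilon> j *\<^sub>R x j) (the_elem A) else 0"
    have y: "norm (rpoly I ?y \<eta>) = ?n (\<lambda>i\<in>I. \<epsilon> i * \<eta> i)" for \<eta>
      unfolding rpoly_singletons[OF I, of "\<lambda>j. \<epsilon> j *\<^sub>R x j"] by (simp add: mult.commute)
    have "(\<Sum>A\<in>Pow I. (\<Prod>i\<in>A. a i) *\<^sub>R ?y A) = (\<Sum>A\<in>Pow I. if card A = 1 then (\<Prod>i\<in>A. a i) *\<^sub>R ?y A else 0)"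
      by (intro sum.cong) auto
    also have "\<dots> = (\<Sum>j\<in>I. \<epsilon> j *\<^sub>R a j *\<^sub>R x j)"
      unfolding sum_Pow_singletons[OF I] by (simp add: mult.commute)
    finally have eq: "(\<Sum>A\<in>Pow I. (\<Prod>i\<in>A. a i) *\<^sub>R ?y A) = (\<Sum>j\<in>I. \<epsilon> j *\<^sub>R a j *\<^sub>R x j)" .
    have "norm (\<Sum>j\<in>I. \<epsilon> j *\<^sub>R a j *\<^sub>R x j) \<le> ?E (\<lambda>\<eta>. riesz I a \<eta> * ?n (\<lambda>i\<in>I. \<epsilon> i * \<eta> i))"
      using riesz_multiplier_norm_le[OF I, of a ?y] a unfolding eq y by blast
    then have "norm (\<Sum>j\<in>I. \<epsilon> j *\<^sub>R a j *\<^sub>R x j) powr p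
        \<le> (?E (\<lambda>\<eta>. riesz I a \<eta> * ?n (\<lambda>i\<in>I. \<epsilon> i * \<eta> i))) powr p"
      using p by (intro powr_mono2) auto
    also have "\<dots> \<le> ?E (\<lambda>\<eta>. riesz I a \<eta> * ?n (\<lambda>i\<in>I. \<epsilon> i * \<eta> i) powr p)"
      using p by (intro avg_riesz_powr_le I a) auto
    finally show "norm (\<Sum>j\<in>I. \<epsilon> j *\<^sub>R a j *\<^sub>R x j) powr p
      \<le> ?E (\<lambda>\<eta>. riesz I a \<eta> * ?n (\<lambda>i\<in>I. \<epsilon> i * \<eta> i) powr p)" .
  qed
  also have "\<dots> = ?E (\<lambda>\<eta>. riesz I a \<eta> * ?E (\<lambda>\<epsilon>. ?n (\<lambda>i\<in>I. \<epsilon> i * \<eta> i) powr p))"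
    by (subst avg_swap) (simp only: avg_cmult)
  also have "\<dots> = ?E (\<lambda>\<eta>. riesz I a \<eta> * ?E (\<lambda>\<epsilon>. ?n \<epsilon> powr p))"
    by (intro avg_cong arg_cong[where f="(*) _"] avg_bij[OF bij_signs_mult, where F="\<lambda>\<epsilon>. ?n \<epsilon> powr p"])
  also have "\<dots> = ?E (\<lambda>\<eta>. ?E (\<lambda>\<epsilon>. ?n \<epsilon> powr p) * riesz I a \<eta>)"
    by (simp only: mult.commute)
  also have "\<dots> = ?E (\<lambda>\<epsilon>. ?n \<epsilon> powr p)"
    unfolding avg_cmult using avg_riesz[OF I, of a] by simp
  finally show ?thesis .
qed

text \<open>Real and imaginary parts are treated separately by the real principle. Convexity gives
  the factor \<open>2 powr (p - 1)\<close> for the sum of two terms, and the two equal bounds add up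
  to \<open>2 powr p\<close>.\<close>

lemma complex_contraction:
  fixes x :: "nat \<Rightarrow> 'a::complex_banach"
  assumes I: "finite I" and u: "\<And>i. i \<in> I \<Longrightarrow> cmod (u i) \<le> 1" and p: "p \<ge> 1"
  shows "avg (signs I) (\<lambda>\<epsilon>. norm (\<Sum>j\<in>I. \<epsilon> j *\<^sub>R u j *\<^sub>C x j) powr p)
    \<le> 2 powr p * avg (signs I) (\<lambda>\<epsilon>. norm (\<Sum>j\<in>I. \<epsilon> j *\<^sub>R x j) powr p)"
proof -
  let ?E = "avg (signs I)"
  define a where "a \<epsilon> = norm (\<Sum>j\<in>I. \<epsilon> j *\<^sub>R Re (u j) *\<^sub>R x j)" for \<epsilon> :: "nat \<Rightarrow> real"
  define b where "b \<epsilon> = norm (\<Sum>j\<in>I. \<epsilon> j *\<^sub>R Im (u j) *\<^sub>R x j)" for \<epsilon> :: "nat \<Rightarrow> real"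
  have ab0: "a \<epsilon> \<ge> 0" "b \<epsilon> \<ge> 0" for \<epsilon> by (simp_all add: a_def b_def)
  define M where "M = ?E (\<lambda>\<epsilon>. norm (\<Sum>j\<in>I. \<epsilon> j *\<^sub>R x j) powr p)"
  have "norm (\<Sum>j\<in>I. \<epsilon> j *\<^sub>R u j *\<^sub>C x j) powr p \<le> 2 powr (p - 1) * (a \<epsilon> powr p + b \<epsilon> powr p)" for \<epsilon>
  proof -
    have "\<epsilon> j *\<^sub>R u j *\<^sub>C x j = \<epsilon> j *\<^sub>R Re (u j) *\<^sub>R x j + \<i> *\<^sub>C (\<epsilon> j *\<^sub>R Im (u j) *\<^sub>R x j)" for j
    proof -
      have "u j *\<^sub>C x j = Re (u j) *\<^sub>R x j + \<i> *\<^sub>C (Im (u j) *\<^sub>R x j)"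
        by (subst complex_eq[of "u j"]) (simp add: scaleC_add_left scaleR_scaleC scaleC_scaleC)
      then show ?thesis by (simp add: scaleR_add_right scaleR_scaleC_right del: scaleR_scaleR)
    qed
    then have "(\<Sum>j\<in>I. \<epsilon> j *\<^sub>R u j *\<^sub>C x j) = (\<Sum>j\<in>I. \<epsilon> j *\<^sub>R Re (u j) *\<^sub>R x j)
        + \<i> *\<^sub>C (\<Sum>j\<in>I. \<epsilon> j *\<^sub>R Im (u j) *\<^sub>R x j)"
      by (simp only: sum.distrib scaleC_sum_right)
    then have "norm (\<Sum>j\<in>I. \<epsilon> j *\<^sub>R u j *\<^sub>C x j)
        \<le> a \<epsilon> + norm (\<i> *\<^sub>C (\<Sum>j\<in>I. \<epsilon> j *\<^sub>R Im (u j) *\<^sub>R x j))"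
      unfolding a_def by (simp only: norm_triangle_ineq)
    then have "norm (\<Sum>j\<in>I. \<epsilon> j *\<^sub>R u j *\<^sub>C x j) \<le> a \<epsilon> + b \<epsilon>"
      by (simp only: norm_scaleC norm_ii mult_1 b_def)
    then have "norm (\<Sum>j\<in>I. \<epsilon> j *\<^sub>R u j *\<^sub>C x j) powr p \<le> (a \<epsilon> + b \<epsilon>) powr p"
      using p by (intro powr_mono2) auto
    also have "\<dots> = 2 powr p * (\<Sum>i\<in>{True, False}. (1 / 2) * (if i then a \<epsilon> else b \<epsilon>)) powr p"
      using ab0[of \<epsilon>] by (simp add: powr_mult[symmetric] algebra_simps)
    also have "\<dots> \<le> 2 powr p * (\<Sum>i\<in>{True, False}. (1 / 2) * (if i then a \<epsilon> else b \<epsilon>) powr p)"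
      using p ab0 by (intro mult_left_mono powr_sum_le) auto
    also have "\<dots> = 2 powr (p - 1) * (a \<epsilon> powr p + b \<epsilon> powr p)"
      by (simp add: powr_diff algebra_simps)
    finally show ?thesis .
  qed
  then have "?E (\<lambda>\<epsilon>. norm (\<Sum>j\<in>I. \<epsilon> j *\<^sub>R u j *\<^sub>C x j) powr p)
      \<le> ?E (\<lambda>\<epsilon>. 2 powr (p - 1) * (a \<epsilon> powr p + b \<epsilon> powr p))"
    by (intro avg_mono)
  also have "\<dots> = 2 powr (p - 1) * (?E (\<lambda>\<epsilon>. a \<epsilon> powr p) + ?E (\<lambda>\<epsilon>. b \<epsilon> powr p))"
    by (simp only: avg_cmult avg_add)
  also have "\<dots> \<le> 2 powr (p - 1) * (M + M)"
  proof (intro mult_left_mono add_mono)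
    have "\<bar>Re (u i)\<bar> \<le> 1" "\<bar>Im (u i)\<bar> \<le> 1" if "i \<in> I" for i
      using u[OF that] abs_Re_le_cmod[of "u i"] abs_Im_le_cmod[of "u i"] by linarith+
    then show "?E (\<lambda>\<epsilon>. a \<epsilon> powr p) \<le> M" "?E (\<lambda>\<epsilon>. b \<epsilon> powr p) \<le> M"
      unfolding a_def b_def M_def by (intro real_contraction I p; simp)+
  qed simp
  also have "\<dots> = 2 powr p * M" by (simp add: powr_diff)
  finally show ?thesis unfolding M_def .
qed

section \<open>Product measures on tori and cubes\<close>

lemma sets_circle: "sets circle_measure = sets (restrict_space borel (sphere 0 1))"
  by (simp add: circle_measure_def)

lemma space_circle: "space circle_measure = sphere 0 1"
  by (simp add: circle_measure_def space_restrict_space)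

lemma cis_measurable_circle: "cis \<in> measurable (uniform_measure lborel {0..<2 * pi}) (restrict_space borel (sphere 0 1))"
proof (rule measurable_restrict_space2)
  have "continuous_on UNIV cis" by (intro continuous_intros)
  then have "cis \<in> borel_measurable borel" by (rule borel_measurable_continuous_onI)
  then show "cis \<in> borel_measurable (uniform_measure lborel {0..<2 * pi})"
    by (simp add: measurable_cong_sets[OF sets_uniform_measure refl])
qed auto

lemma prob_space_circle: "prob_space circle_measure"
  unfolding circle_measure_def
proof (rule prob_space.prob_space_distr[OF _ cis_measurable_circle])
  show "prob_space (uniform_measure lborel {0..<2 * pi})"
    by (rule prob_space_uniform_measure) auto
qed

text \<open>The part of the shifted interval that lies beyond \<open>2 * pi\<close> is moved back by
  one period.\<close>

lemma nn_integral_periodic_shift: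
  fixes g :: "real \<Rightarrow> ennreal"
  assumes g[measurable]: "g \<in> borel_measurable borel" and per: "\<And>t. g (t + 2 * pi) = g t" and s: "0 \<le> s" "s < 2 * pi"
  shows "(\<integral>\<^sup>+t. indicator {0..<2*pi} t * g (t + s) \<partial>lborel) = (\<integral>\<^sup>+t. indicator {0..<2*pi} t * g t \<partial>lborel)"
proof -
  have "(\<integral>\<^sup>+t. indicator {0..<2*pi} t * g (t + s) \<partial>lborel)
      = (\<integral>\<^sup>+t. indicator {s..<s+2*pi} t * g t \<partial>lborel)"
    by (subst nn_integral_real_affine[where c=1 and t=s and f="\<lambda>t. indicator {s..<s+2*pi} t * g t"])
      (auto simp: indicator_def add.commute intro!: nn_integral_cong)
  also have "\<dots> = (\<integral>\<^sup>+t. indicator {s..<2*pi} t * g t + indicator {2*pi..<s+2*pi} t * g t \<partial>lborel)"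
    using s by (intro nn_integral_cong) (auto simp: indicator_def)
  also have "\<dots> = (\<integral>\<^sup>+t. indicator {s..<2*pi} t * g t \<partial>lborel) + (\<integral>\<^sup>+t. indicator {2*pi..<s+2*pi} t * g t \<partial>lborel)"
    by (rule nn_integral_add) auto
  also have "(\<integral>\<^sup>+t. indicator {2*pi..<s+2*pi} t * g t \<partial>lborel) = (\<integral>\<^sup>+t. indicator {0..<s} t * g t \<partial>lborel)"
    by (subst nn_integral_real_affine[where c=1 and t="2*pi"])
      (auto simp: indicator_def per[of "_ :: real", unfolded add.commute[of _ "2 * pi"]] intro!: nn_integral_cong)
  also have "(\<integral>\<^sup>+t. indicator {s..<2*pi} t * g t \<partial>lborel) + (\<integral>\<^sup>+t. indicator {0..<s} t * g t \<partial>lborel)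
      = (\<integral>\<^sup>+t. indicator {s..<2*pi} t * g t + indicator {0..<s} t * g t \<partial>lborel)"
    by (rule nn_integral_add[symmetric]) auto
  also have "\<dots> = (\<integral>\<^sup>+t. indicator {0..<2*pi} t * g t \<partial>lborel)"
    using s by (intro nn_integral_cong) (auto simp: indicator_def)
  finally show ?thesis .
qed

lemma rotate_measurable_circle:
  assumes "cmod u = 1"
  shows "(\<lambda>z. u * z) \<in> measurable circle_measure circle_measure"
proof -
  have "(\<lambda>z. u * z) \<in> measurable (restrict_space borel (sphere 0 1)) (restrict_space borel (sphere 0 1))"
    using assms by (intro measurable_restrict_space3) (auto simp: norm_mult)
  then show ?thesis by (simp add: measurable_cong_sets[OF sets_circle sets_circle])
qed

text \<open>In the angle coordinate a rotation is a translation, and an indicator composed with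
  \<open>cis\<close> is a periodic function.\<close>

lemma circle_rotate:
  assumes u: "cmod u = 1"
  shows "distr circle_measure circle_measure (\<lambda>z. u * z) = circle_measure"
proof (rule measure_eqI)
  fix B assume "B \<in> sets (distr circle_measure circle_measure (\<lambda>z. u * z))"
  then have B: "B \<in> sets circle_measure" by simp
  then have Bb: "B \<in> sets borel"
    by (auto simp: sets_circle sets_restrict_space)
  define s where "s = Arg2pi u"
  have "u = of_real (norm u) * exp (\<i> * of_real s)" unfolding s_def using Arg2pi[of u] is_Arg_def by blast
  then have "u = cis s" using u by (simp add: cis_conv_exp)
  moreover have "0 \<le> s" "s < 2 * pi" unfolding s_def using Arg2pi[of u] by blast+
  ultimately have s: "0 \<le> s" "s < 2 * pi" "u = cis s" by auto
  define g where "g t = (indicator B (cis t) :: ennreal)" for t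
  have "continuous_on UNIV cis" by (intro continuous_intros)
  then have [measurable]: "cis \<in> borel_measurable borel" by (rule borel_measurable_continuous_onI)
  have gm[measurable]: "g \<in> borel_measurable borel" unfolding g_def using Bb by measurable
  have per: "g (t + 2 * pi) = g t" for t by (simp add: g_def cis_mult[symmetric])
  have em: "emeasure circle_measure C
      = (\<integral>\<^sup>+t. indicator {0..<2*pi} t * indicator C (cis t) \<partial>lborel) / emeasure lborel {0..<2*pi}"
    if C: "C \<in> sets circle_measure" for C
  proof -
    have Cb: "C \<in> sets borel" using C by (auto simp: sets_circle sets_restrict_space)
    have cisC: "cis -` C \<in> sets borel" by (rule measurable_sets_borel[OF _ Cb]) measurable
    have "emeasure circle_measure C = emeasure (uniform_measure lborel {0..<2*pi}) (cis -` C \<inter> UNIV)"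
      unfolding circle_measure_def using C
      by (subst emeasure_distr[OF cis_measurable_circle]) (simp_all add: sets_circle)
    also have "\<dots> = emeasure lborel ({0..<2*pi} \<inter> cis -` C) / emeasure lborel {0..<2*pi}"
      using cisC by (subst emeasure_uniform_measure) auto
    also have "emeasure lborel ({0..<2*pi} \<inter> cis -` C) = (\<integral>\<^sup>+t. indicator ({0..<2*pi} \<inter> cis -` C) t \<partial>lborel)"
      using cisC by (subst nn_integral_indicator) auto
    also have "\<dots> = (\<integral>\<^sup>+t. indicator {0..<2*pi} t * indicator C (cis t) \<partial>lborel)"
      by (intro nn_integral_cong) (auto simp: indicator_def)
    finally show ?thesis .
  qed
  have vB: "(\<lambda>z. u * z) -` B \<inter> space circle_measure \<in> sets circle_measure"
    using measurable_sets[OF rotate_measurable_circle[OF u] B] .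
  have "emeasure (distr circle_measure circle_measure (\<lambda>z. u * z)) B
      = emeasure circle_measure ((\<lambda>z. u * z) -` B \<inter> space circle_measure)"
    using B by (subst emeasure_distr[OF rotate_measurable_circle[OF u]]) auto
  also have "\<dots> = (\<integral>\<^sup>+t. indicator {0..<2*pi} t * g (t + s) \<partial>lborel) / emeasure lborel {0..<2*pi}"
    unfolding em[OF vB]
    by (intro arg_cong[where f="\<lambda>x. x / _"] nn_integral_cong)
      (auto simp: g_def s(3) cis_mult space_circle indicator_def add.commute)
  also have "\<dots> = emeasure circle_measure B"
    unfolding em[OF B] nn_integral_periodic_shift[OF gm per s(1,2)] by (simp add: g_def)
  finally show "emeasure (distr circle_measure circle_measure (\<lambda>z. u * z)) B = emeasure circle_measure B" .
qed simp

text \<open>Cylinder sets determine the product measure, and on them the claim factorises. The torus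
  uses it for rotations, the cube for changes of sign.\<close>

lemma PiM_coordinatewise_invariant:
  assumes M: "\<And>i. i \<in> I \<Longrightarrow> prob_space (M i)"
    and g: "\<And>i. i \<in> I \<Longrightarrow> g i \<in> measurable (M i) (M i)"
    and inv: "\<And>i. i \<in> I \<Longrightarrow> distr (M i) (M i) (g i) = M i"
  shows "distr (Pi\<^sub>M I M) (Pi\<^sub>M I M) (\<lambda>w. \<lambda>i\<in>I. g i (w i)) = Pi\<^sub>M I M"
proof (rule measure_eqI_PiM_infinite[symmetric, OF refl])
  let ?t = "\<lambda>w. \<lambda>i\<in>I. g i (w i)"
  have t: "?t \<in> measurable (Pi\<^sub>M I M) (Pi\<^sub>M I M)"
    by (rule measurable_restrict) (rule measurable_compose[OF measurable_component_singleton], auto intro: g)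
  interpret prob_space "Pi\<^sub>M I M" using M by (rule prob_space_PiM)
  show "finite_measure (Pi\<^sub>M I M)" by unfold_locales
  fix A J assume J: "finite J" "J \<subseteq> I" and A: "\<And>i. i \<in> J \<Longrightarrow> A i \<in> sets (M i)"
  have gA: "g i -` A i \<inter> space (M i) \<in> sets (M i)" if "i \<in> J" for i
    using measurable_sets[OF g A] that J by auto
  have eq: "emeasure (M i) (g i -` A i \<inter> space (M i)) = emeasure (M i) (A i)" if "i \<in> J" for i
  proof -
    have "i \<in> I" using that J by auto
    then show ?thesis
      using emeasure_distr[OF g A, of i] inv[of i] that by simp
  qed
  have "emeasure (distr (Pi\<^sub>M I M) (Pi\<^sub>M I M) ?t) (prod_emb I M J (Pi\<^sub>E J A))
      = emeasure (Pi\<^sub>M I M) (?t -` prod_emb I M J (Pi\<^sub>E J A) \<inter> space (Pi\<^sub>M I M))"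
    using J A by (intro emeasure_distr t sets_PiM_I) auto
  also have "?t -` prod_emb I M J (Pi\<^sub>E J A) \<inter> space (Pi\<^sub>M I M)
      = prod_emb I M J (Pi\<^sub>E J (\<lambda>i. g i -` A i \<inter> space (M i)))"
  proof -
    have "g i (w i) \<in> space (M i)" if "w \<in> space (Pi\<^sub>M I M)" "i \<in> I" for w i
      using measurable_space[OF g[OF that(2)]] that by (auto simp: space_PiM)
    then show ?thesis using J A
      by (auto simp: prod_emb_def space_PiM PiE_iff Int_absorb1 subset_eq)
  qed
  also have "emeasure (Pi\<^sub>M I M) \<dots> = (\<Prod>i\<in>J. emeasure (M i) (g i -` A i \<inter> space (M i)))"
    using J gA by (intro emeasure_PiM_emb M) auto
  also have "\<dots> = (\<Prod>i\<in>J. emeasure (M i) (A i))"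
    using eq by simp
  also have "\<dots> = emeasure (Pi\<^sub>M I M) (prod_emb I M J (Pi\<^sub>E J A))"
    using J A by (intro emeasure_PiM_emb[symmetric] M) auto
  finally show "emeasure (Pi\<^sub>M I M) (prod_emb I M J (Pi\<^sub>E J A))
     = emeasure (distr (Pi\<^sub>M I M) (Pi\<^sub>M I M) ?t) (prod_emb I M J (Pi\<^sub>E J A))" by (rule sym)
qed simp

lemma integral_PiM_coordinatewise:
  fixes f :: "('i \<Rightarrow> 'm) \<Rightarrow> 'b::{banach, second_countable_topology}"
  assumes M: "\<And>i. i \<in> I \<Longrightarrow> prob_space (M i)"
    and g: "\<And>i. i \<in> I \<Longrightarrow> g i \<in> measurable (M i) (M i)"
    and inv: "\<And>i. i \<in> I \<Longrightarrow> distr (M i) (M i) (g i) = M i"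
    and f: "f \<in> borel_measurable (Pi\<^sub>M I M)"
  shows "(\<integral>w. f (\<lambda>i\<in>I. g i (w i)) \<partial>Pi\<^sub>M I M) = (\<integral>w. f w \<partial>Pi\<^sub>M I M)"
proof -
  have t: "(\<lambda>w. \<lambda>i\<in>I. g i (w i)) \<in> measurable (Pi\<^sub>M I M) (Pi\<^sub>M I M)"
    by (rule measurable_restrict) (rule measurable_compose[OF measurable_component_singleton], auto intro: g)
  have "(\<integral>w. f w \<partial>Pi\<^sub>M I M) = (\<integral>w. f w \<partial>distr (Pi\<^sub>M I M) (Pi\<^sub>M I M) (\<lambda>w. \<lambda>i\<in>I. g i (w i)))"
    by (subst PiM_coordinatewise_invariant) (auto intro: M g inv)
  also have "\<dots> = (\<integral>w. f (\<lambda>i\<in>I. g i (w i)) \<partial>Pi\<^sub>M I M)"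
    by (rule integral_distr[OF t f])
  finally show ?thesis by simp
qed

lemma prob_space_PiM_circle: "prob_space (Pi\<^sub>M I (\<lambda>_. circle_measure))"
  by (intro prob_space_PiM prob_space_circle)

lemma prob_space_torus: "prob_space torus"
  unfolding torus_def by (rule prob_space_PiM_circle)

lemma circle_coordinate_measurable:
  assumes "i \<in> I"
  shows "(\<lambda>z. z i) \<in> borel_measurable (Pi\<^sub>M I (\<lambda>_. circle_measure))"
proof -
  have "(\<lambda>z. z) \<in> measurable circle_measure borel"
    unfolding measurable_cong_sets[OF sets_circle refl] by (rule measurable_restrict_space1) simp
  then show ?thesis
    by (rule measurable_compose[OF measurable_component_singleton[OF assms]])
qed

lemma circle_coordinate_norm:
  "z \<in> space (Pi\<^sub>M I (\<lambda>_. circle_measure)) \<Longrightarrow> i \<in> I \<Longrightarrow> cmod (z i) = 1"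
  by (auto simp: space_PiM PiE_iff space_circle)

lemma integral_circle_rotate:
  fixes f :: "('i \<Rightarrow> complex) \<Rightarrow> 'b::{banach, second_countable_topology}"
  assumes "\<And>i. i \<in> I \<Longrightarrow> cmod (u i) = 1" "f \<in> borel_measurable (Pi\<^sub>M I (\<lambda>_. circle_measure))"
  shows "(\<integral>w. f (\<lambda>i\<in>I. u i * w i) \<partial>Pi\<^sub>M I (\<lambda>_. circle_measure)) = (\<integral>w. f w \<partial>Pi\<^sub>M I (\<lambda>_. circle_measure))"
  using assms
  by (intro integral_PiM_coordinatewise prob_space_circle rotate_measurable_circle circle_rotate)

section \<open>Sign invariance of the infinite cube\<close>

definition coin :: "real measure" where "coin = uniform_count_measure {-1, 1}"

lemma prob_space_coin: "prob_space coin"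
  unfolding coin_def by (rule prob_space_uniform_count_measure) auto

lemma space_coin: "space coin = {-1, 1}" and sets_coin: "sets coin = Pow {-1, 1}"
  by (auto simp: coin_def space_uniform_count_measure sets_uniform_count_measure)

lemma cube_eq: "cube = Pi\<^sub>M UNIV (\<lambda>_. coin)"
  by (simp add: cube_def coin_def)

lemma prob_space_cube: "prob_space cube"
  unfolding cube_eq by (intro prob_space_PiM prob_space_coin)

lemma flip_measurable_coin: "a \<in> {-1, 1} \<Longrightarrow> (\<lambda>x. a * x) \<in> measurable coin coin"
  by (auto simp: measurable_def space_coin sets_coin)

lemma coin_flip:
  assumes a: "a \<in> {-1, 1}"
  shows "distr coin coin (\<lambda>x. a * x) = coin"
proof (rule measure_eqI)
  fix B assume "B \<in> sets (distr coin coin (\<lambda>x. a * x))"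
  then have B: "B \<in> sets coin" by simp
  have "bij_betw (\<lambda>x. a * x) ((\<lambda>x. a * x) -` B \<inter> {-1, 1}) B"
    by (rule bij_betw_byWitness[where f'="\<lambda>x. a * x"]) (use a B in \<open>auto simp: sets_coin\<close>)
  then have "card ((\<lambda>x. a * x) -` B \<inter> {-1, 1}) = card B" by (rule bij_betw_same_card)
  then show "emeasure (distr coin coin (\<lambda>x. a * x)) B = emeasure coin B"
    using B by (subst emeasure_distr[OF flip_measurable_coin[OF a]])
      (auto simp: coin_def emeasure_uniform_count_measure space_uniform_count_measure sets_uniform_count_measure)
qed simp

lemma cube_coordinate: "\<epsilon> \<in> space cube \<Longrightarrow> \<epsilon> i \<in> {-1, 1}"
  by (auto simp: cube_eq space_PiM PiE_iff space_coin)

text \<open>As a consequence Walsh polynomials and Riesz products are simple functions, whose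
  measurability and integrability are immediate.\<close>

lemma cube_coordinate_simple: "simple_function cube (\<lambda>\<epsilon>. \<epsilon> i)"
proof -
  have "(\<lambda>x. x) \<in> measurable coin (count_space UNIV)"
    by (auto simp: measurable_def space_coin sets_coin)
  then have "(\<lambda>\<epsilon>. \<epsilon> i) \<in> measurable cube (count_space UNIV)"
    unfolding cube_eq by (rule measurable_compose[OF measurable_component_singleton[OF UNIV_I]])
  moreover have "finite ((\<lambda>\<epsilon>. \<epsilon> i) ` space cube)"
    by (rule finite_subset[of _ "{-1, 1}"]) (use cube_coordinate in auto)
  ultimately show ?thesis by (simp add: simple_function_eq_measurable)
qed

lemma integral_cube_flip:
  fixes f :: "(nat \<Rightarrow> real) \<Rightarrow> 'b::{banach, second_countable_topology}"
  assumes "\<And>i. a i \<in> {-1, 1}" "f \<in> borel_measurable cube"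
  shows "(\<integral>w. f (\<lambda>i. a i * w i) \<partial>cube) = (\<integral>w. f w \<partial>cube)"
  using integral_PiM_coordinatewise[where I=UNIV and M="\<lambda>_. coin" and g="\<lambda>i x. a i * x" and f=f] assms
  unfolding cube_eq restrict_UNIV by (simp add: prob_space_coin flip_measurable_coin coin_flip)

section \<open>Lebesgue-Bochner spaces on probability spaces\<close>

lemma (in prob_space) integral_powr_le:
  fixes f :: "'a \<Rightarrow> real"
  assumes f: "f \<in> borel_measurable M" "\<And>w. f w \<ge> 0" and p: "p \<ge> 1" and int: "integrable M (\<lambda>w. f w powr p)"
  shows "integrable M f" "(\<integral>w. f w \<partial>M) powr p \<le> (\<integral>w. f w powr p \<partial>M)"
proof -
  have "f w \<le> 1 + f w powr p" for w
  proof (cases "f w \<le> 1")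
    case False
    then have "f w powr 1 \<le> f w powr p" using p by (intro powr_mono) auto
    then show ?thesis using False by simp
  qed (simp add: add_increasing2)
  then show intf: "integrable M f"
    using f int by (intro Bochner_Integration.integrable_bound[of M "\<lambda>w. 1 + f w powr p" f]) auto
  define b where "b = (\<integral>w. f w \<partial>M)"
  have b0: "b \<ge> 0" unfolding b_def by (rule Bochner_Integration.integral_nonneg) (rule f(2))
  have "b powr p = (\<integral>w. b powr p + p * b powr (p - 1) * (f w - b) \<partial>M)"
    using intf by (simp add: prob_space b_def)
  also have "\<dots> \<le> (\<integral>w. f w powr p \<partial>M)"
    using intf int f p b0 by (intro integral_mono powr_tangent) auto
  finally show "(\<integral>w. f w \<partial>M) powr p \<le> (\<integral>w. f w powr p \<partial>M)" by (simp add: b_def)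
qed

text \<open>Makes the coefficients meaningful for every \<open>p \<ge> 1\<close>. On the torus the
  norm comparison also reduces the coefficient inequality for all \<open>p\<close> to a bound by the
  L1 norm.\<close>

lemma (in prob_space) Lp_bochner:
  assumes "f \<in> Lp M p" "p \<ge> 1"
  shows "bochner M f" "(\<integral>w. norm (f w) \<partial>M) \<le> Lp_norm M p f"
proof -
  have f: "strongly_measurable M f" "integrable M (\<lambda>w. norm (f w) powr p)"
    using assms by (auto simp: Lp_def)
  note * = integral_powr_le[OF strongly_measurable_norm[OF f(1)] norm_ge_zero assms(2) f(2)]
  show "bochner M f" using f(1) *(1) by (simp add: bochner_def)
  have "((\<integral>w. norm (f w) \<partial>M) powr p) powr (1 / p) \<le> (\<integral>w. norm (f w) powr p \<partial>M) powr (1 / p)"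
    using *(2) assms by (intro powr_mono2) auto
  then show "(\<integral>w. norm (f w) \<partial>M) \<le> Lp_norm M p f"
    using assms by (simp add: Lp_norm_def powr_powr Bochner_Integration.integral_nonneg)
qed

lemma (in prob_space) Lp_bounded:
  assumes "strongly_measurable M f" "\<And>w. w \<in> space M \<Longrightarrow> norm (f w) \<le> B" "p > 0"
  shows "f \<in> Lp M p"
proof -
  have "norm (norm (f w) powr p) \<le> B powr p" if "w \<in> space M" for w
    using assms that by (auto intro!: powr_mono2)
  then have "integrable M (\<lambda>w. norm (f w) powr p)"
    using strongly_measurable_norm[OF assms(1)]
    by (intro integrable_const_bound[where B="B powr p"] AE_I2) auto
  then show ?thesis using assms by (simp add: Lp_def)
qed

section \<open>Monomials on the torus\<close>

definition tmono :: "(nat \<Rightarrow> int) \<Rightarrow> (nat \<Rightarrow> complex) \<Rightarrow> complex" where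
  "tmono \<beta> z = (\<Prod>i | \<beta> i \<noteq> 0. z i powi \<beta> i)"

lemma tmono_superset:
  assumes "finite J" "\<And>i. \<beta> i \<noteq> 0 \<Longrightarrow> i \<in> J"
  shows "tmono \<beta> z = (\<Prod>i\<in>J. z i powi \<beta> i)"
  unfolding tmono_def by (rule prod.mono_neutral_left) (use assms in auto)

lemma torus_coordinate: "z \<in> space torus \<Longrightarrow> cmod (z i) = 1"
  unfolding torus_def by (rule circle_coordinate_norm) auto

lemma torus_coordinate_measurable: "(\<lambda>z. z i) \<in> borel_measurable torus"
  unfolding torus_def by (rule circle_coordinate_measurable) simp

lemma tmono_add:
  assumes "z \<in> space torus" "\<alpha> \<in> int_multiindices" "\<beta> \<in> int_multiindices"
  shows "tmono (\<lambda>i. \<alpha> i + \<beta> i) z = tmono \<alpha> z * tmono \<beta> z"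
proof -
  let ?J = "{i. \<alpha> i \<noteq> 0} \<union> {i. \<beta> i \<noteq> 0}"
  have J: "finite ?J" using assms by (auto simp: int_multiindices_def)
  have "z i \<noteq> 0" for i using torus_coordinate[OF assms(1), of i] by auto
  then show ?thesis
    by (subst (1 2 3) tmono_superset[OF J]) (auto simp: power_int_add prod.distrib)
qed

lemma power_int_measurable:
  assumes "f \<in> borel_measurable M"
  shows "(\<lambda>x. (f x :: complex) powi k) \<in> borel_measurable M"
  using assms unfolding power_int_def by (cases "k \<ge> 0") (simp_all, measurable)

lemma tmono_measurable: "tmono \<beta> \<in> borel_measurable torus"
  unfolding tmono_def[abs_def]
  by (intro borel_measurable_prod power_int_measurable torus_coordinate_measurable)

lemma tmono_norm: "z \<in> space torus \<Longrightarrow> cmod (tmono \<beta> z) = 1"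
  by (simp add: tmono_def prod_norm[symmetric] norm_power_int torus_coordinate)

lemma bochner_tmono:
  fixes f :: "(nat \<Rightarrow> complex) \<Rightarrow> 'a::complex_banach"
  assumes "bochner torus f"
  shows "bochner torus (\<lambda>z. tmono \<beta> z *\<^sub>C f z)"
  by (rule bochner_scaleC_bounded[where B=1, OF assms tmono_measurable]) (simp add: tmono_norm)

lemma torus_coeff_tmono: "torus_coeff f \<alpha> = strong_integral torus (\<lambda>z. tmono (\<lambda>i. - \<alpha> i) z *\<^sub>C f z)"
  by (simp add: torus_coeff_def tmono_def)

lemma integral_tmono:
  assumes "\<beta> \<in> int_multiindices"
  shows "(\<integral>z. tmono \<beta> z \<partial>torus) = (if \<beta> = (\<lambda>_. 0) then 1 else 0)"
proof (cases "\<beta> = (\<lambda>_. 0)")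
  case True
  interpret prob_space torus by (rule prob_space_torus)
  show ?thesis using True by (simp add: tmono_def prob_space)
next
  case False
  then obtain k where k: "\<beta> k \<noteq> 0" by auto
  \<comment> \<open>Rotating the coordinate \<open>k\<close> by the angle
    \<open>pi / \<beta> k\<close> changes the sign of the monomial, so its integral equals its own
    negative.\<close>
  define u where "u i = (if i = k then cis (pi / \<beta> k) else 1)" for i
  have fin: "finite {i. \<beta> i \<noteq> 0}" using assms by (simp add: int_multiindices_def)
  have "tmono \<beta> (\<lambda>i. u i * z i) = - tmono \<beta> z" for z
  proof -
    have "tmono \<beta> (\<lambda>i. u i * z i) = (\<Prod>i | \<beta> i \<noteq> 0. u i powi \<beta> i) * tmono \<beta> z"
      by (simp add: tmono_def power_int_mult_distrib prod.distrib)
    also have "(\<Prod>i | \<beta> i \<noteq> 0. u i powi \<beta> i) = (\<Prod>i\<in>{k}. u i powi \<beta> i)"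
      using fin k by (intro prod.mono_neutral_right) (auto simp: u_def)
    also have "\<dots> = - 1" using k by (simp add: u_def cis_power_int)
    finally show ?thesis by simp
  qed
  moreover have "(\<integral>z. tmono \<beta> (\<lambda>i\<in>UNIV. u i * z i) \<partial>torus) = (\<integral>z. tmono \<beta> z \<partial>torus)"
    using tmono_measurable unfolding torus_def by (intro integral_circle_rotate) (auto simp: u_def)
  ultimately have "- (\<integral>z. tmono \<beta> z \<partial>torus) = (\<integral>z. tmono \<beta> z \<partial>torus)"
    unfolding restrict_UNIV by simp
  then have "(\<integral>z. tmono \<beta> z \<partial>torus) = 0" by simp
  then show ?thesis using False by simp
qed

section \<open>Comparison of random sums\<close>

lemma integral_avg_signs:
  assumes "finite I" "\<And>\<eta>. \<eta> \<in> signs I \<Longrightarrow> integrable M (F \<eta>)"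
  shows "(\<integral>z. avg (signs I) (\<lambda>\<eta>. F \<eta> z) \<partial>M) = avg (signs I) (\<lambda>\<eta>. \<integral>z. F \<eta> z \<partial>M)"
    "integrable M (\<lambda>z. avg (signs I) (\<lambda>\<eta>. F \<eta> z))"
  using assms unfolding avg_def by (simp_all add: Bochner_Integration.integral_sum)

lemma steinhaus_Lp:
  fixes x :: "nat \<Rightarrow> 'a::complex_banach"
  assumes "J \<subseteq> I" "p > 0"
  shows "(\<lambda>z. \<Sum>j\<in>J. z j *\<^sub>C x j) \<in> Lp (Pi\<^sub>M I (\<lambda>_. circle_measure)) p"
proof -
  interpret prob_space "Pi\<^sub>M I (\<lambda>_. circle_measure)" by (rule prob_space_PiM_circle)
  show ?thesis
  proof (rule Lp_bounded[where B="\<Sum>j\<in>J. norm (x j)"])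
    show "strongly_measurable (Pi\<^sub>M I (\<lambda>_. circle_measure)) (\<lambda>z. \<Sum>j\<in>J. z j *\<^sub>C x j)"
      using assms by (intro strongly_measurable_sum strongly_measurable_scaleC circle_coordinate_measurable
          strongly_measurable_simple simple_function_const) auto
    show "norm (\<Sum>j\<in>J. z j *\<^sub>C x j) \<le> (\<Sum>j\<in>J. norm (x j))"
      if "z \<in> space (Pi\<^sub>M I (\<lambda>_. circle_measure))" for z
      using assms circle_coordinate_norm[OF that] by (intro sum_norm_le) (auto simp: norm_scaleC subset_eq)
  qed (rule assms)
qed

text \<open>Random signs do not change the distribution of the Steinhaus sum, and for fixed \<open>z\<close> the
  contraction principle removes the factors \<open>z j\<close>.\<close>

lemma steinhaus_rademacher:
  fixes x :: "nat \<Rightarrow> 'a::complex_banach"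
  assumes J: "finite J" "J \<subseteq> I" and p: "p \<ge> 1"
  defines "R \<equiv> avg (signs J) (\<lambda>\<epsilon>. norm (\<Sum>j\<in>J. \<epsilon> j *\<^sub>R x j) powr p)"
    and "S \<equiv> \<integral>z. norm (\<Sum>j\<in>J. z j *\<^sub>C x j) powr p \<partial>(Pi\<^sub>M I (\<lambda>_. circle_measure))"
  shows "S \<le> 2 powr p * R" "R \<le> 2 powr p * S"
proof -
  let ?M = "Pi\<^sub>M I (\<lambda>_. circle_measure)"
  interpret prob_space ?M by (rule prob_space_PiM_circle)
  define N where "N y z = norm (\<Sum>j\<in>J. z j *\<^sub>C y j) powr p" for y :: "nat \<Rightarrow> 'a" and z :: "nat \<Rightarrow> complex"
  have intN: "integrable ?M (N y)" for y
    using steinhaus_Lp[OF J(2), of p y] p by (simp add: Lp_def N_def[abs_def])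
  have flip: "(\<integral>z. N (\<lambda>j. \<eta> j *\<^sub>R x j) z \<partial>?M) = S" if e: "\<eta> \<in> signs J" for \<eta>
  proof -
    define u where "u i = (if i \<in> J then complex_of_real (\<eta> i) else 1)" for i
    have u: "cmod (u i) = 1" for i using signs_abs[OF e] by (simp add: u_def)
    have "N x (\<lambda>i\<in>I. u i * z i) = N (\<lambda>j. \<eta> j *\<^sub>R x j) z" for z
    proof -
      have "(\<Sum>j\<in>J. (\<lambda>i\<in>I. u i * z i) j *\<^sub>C x j) = (\<Sum>j\<in>J. z j *\<^sub>C \<eta> j *\<^sub>R x j)"
        using J by (intro sum.cong) (auto simp: u_def scaleR_scaleC scaleC_scaleC mult.commute)
      then show ?thesis by (simp add: N_def)
    qed
    then have "(\<integral>z. N (\<lambda>j. \<eta> j *\<^sub>R x j) z \<partial>?M) = (\<integral>z. N x (\<lambda>i\<in>I. u i * z i) \<partial>?M)" by simp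
    also have "\<dots> = (\<integral>z. N x z \<partial>?M)"
      by (intro integral_circle_rotate u borel_measurable_integrable intN)
    finally show ?thesis by (simp add: S_def N_def)
  qed
  define A where "A z = avg (signs J) (\<lambda>\<eta>. N (\<lambda>j. \<eta> j *\<^sub>R x j) z)" for z
  have "(\<integral>z. A z \<partial>?M) = avg (signs J) (\<lambda>\<eta>. S)"
    unfolding A_def using J intN flip by (subst integral_avg_signs) (auto intro: avg_cong)
  then have SA: "S = (\<integral>z. A z \<partial>?M)"
    using J by (simp add: avg_const signs_finite_nonempty)
  have intA: "integrable ?M A" unfolding A_def using J intN by (intro integral_avg_signs) auto
  have A_eq: "A z = avg (signs J) (\<lambda>\<eta>. norm (\<Sum>j\<in>J. \<eta> j *\<^sub>R z j *\<^sub>C x j) powr p)" for z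
    unfolding A_def N_def by (simp add: scaleR_scaleC_right)
  have up: "A z \<le> 2 powr p * R" if z: "z \<in> space ?M" for z
    unfolding A_eq R_def using circle_coordinate_norm[OF z] J p by (intro complex_contraction) auto
  \<comment> \<open>The reverse estimate applies the contraction principle to the vectors
    \<open>z j *\<^sub>C x j\<close> with the factors \<open>cnj (z j)\<close>, which undo the
    \<open>z j\<close> on the circle.\<close>
  have lo: "R \<le> 2 powr p * A z" if z: "z \<in> space ?M" for z
  proof -
    have nz: "cmod (z j) = 1" if "j \<in> J" for j using circle_coordinate_norm[OF z, of j] that J by auto
    have "cnj (z j) *\<^sub>C z j *\<^sub>C x j = x j" if "j \<in> J" for j
    proof -
      have "cnj (z j) * z j = 1" using nz[OF that] complex_norm_square[of "z j"] by (simp add: mult.commute)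
      then show ?thesis by (simp add: scaleC_scaleC)
    qed
    then have "R = avg (signs J) (\<lambda>\<epsilon>. norm (\<Sum>j\<in>J. \<epsilon> j *\<^sub>R cnj (z j) *\<^sub>C (\<lambda>j. z j *\<^sub>C x j) j) powr p)"
      by (simp add: R_def)
    also have "\<dots> \<le> 2 powr p * A z"
      unfolding A_eq using nz J p by (intro complex_contraction) auto
    finally show ?thesis .
  qed
  have "(\<integral>z. A z \<partial>?M) \<le> (\<integral>z. 2 powr p * R \<partial>?M)"
    using intA up by (intro integral_mono) auto
  then show "S \<le> 2 powr p * R" by (simp add: SA prob_space)
  have "(\<integral>z. R \<partial>?M) \<le> (\<integral>z. 2 powr p * A z \<partial>?M)"
    using intA lo by (intro integral_mono) auto
  then show "R \<le> 2 powr p * S" by (simp add: SA prob_space)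
qed

section \<open>Functions on the infinite cube\<close>

text \<open>Sign flips in the coordinates of \<open>I\<close> preserve the integral. Averaged over
  all flips, the integrand is constant, since for a fixed point the flips run through all sign
  patterns on \<open>I\<close>.\<close>

lemma integral_cube_cylinder:
  fixes F :: "(nat \<Rightarrow> real) \<Rightarrow> real"
  assumes I: "finite I" and F: "\<And>\<epsilon> \<epsilon>'. (\<And>i. i \<in> I \<Longrightarrow> \<epsilon> i = \<epsilon>' i) \<Longrightarrow> F \<epsilon> = F \<epsilon>'"
    and int: "integrable cube F"
  shows "(\<integral>\<epsilon>. F \<epsilon> \<partial>cube) = avg (signs I) F"
proof -
  interpret prob_space cube by (rule prob_space_cube)
  define a where "a \<eta> i = (if i \<in> I then \<eta> i else 1)" for \<eta> :: "nat \<Rightarrow> real" and i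
  have a: "a \<eta> i \<in> {-1, 1}" if "\<eta> \<in> signs I" for \<eta> i
    using PiE_mem[OF that, of i] by (simp add: a_def)
  have Fm: "F \<in> borel_measurable cube" using int by auto
  have flip: "(\<integral>\<epsilon>. F (\<lambda>i. a \<eta> i * \<epsilon> i) \<partial>cube) = (\<integral>\<epsilon>. F \<epsilon> \<partial>cube)" if "\<eta> \<in> signs I" for \<eta>
    by (rule integral_cube_flip[OF a[OF that] Fm])
  have avgF: "avg (signs I) (\<lambda>\<eta>. F (\<lambda>i. a \<eta> i * \<epsilon> i)) = avg (signs I) F" if e: "\<epsilon> \<in> space cube" for \<epsilon>
  proof -
    have "restrict \<epsilon> I \<in> signs I" using cube_coordinate[OF e] by auto
    from avg_bij[OF bij_signs_mult[OF this], of F]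
    have "avg (signs I) (\<lambda>\<eta>. F (\<lambda>i\<in>I. \<eta> i * restrict \<epsilon> I i)) = avg (signs I) F" .
    moreover have "F (\<lambda>i\<in>I. \<eta> i * restrict \<epsilon> I i) = F (\<lambda>i. a \<eta> i * \<epsilon> i)" for \<eta>
      by (rule F) (simp add: a_def)
    ultimately show ?thesis by simp
  qed
  have intf: "integrable cube (\<lambda>\<epsilon>. F (\<lambda>i. a \<eta> i * \<epsilon> i))" if e: "\<eta> \<in> signs I" for \<eta>
  proof -
    have t: "(\<lambda>w. \<lambda>i\<in>UNIV. a \<eta> i * w i) \<in> measurable cube cube"
      unfolding cube_eq
      by (rule measurable_restrict)
        (rule measurable_compose[OF measurable_component_singleton], simp, rule flip_measurable_coin[OF a[OF e]])
    have "distr cube cube (\<lambda>w. \<lambda>i\<in>UNIV. a \<eta> i * w i) = cube"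
      unfolding cube_eq
      by (rule PiM_coordinatewise_invariant) (rule prob_space_coin flip_measurable_coin[OF a[OF e]] coin_flip[OF a[OF e]])+
    then have "integrable (distr cube cube (\<lambda>w. \<lambda>i\<in>UNIV. a \<eta> i * w i)) F" using int by simp
    then show ?thesis using integrable_distr[OF t] unfolding restrict_UNIV by blast
  qed
  have "avg (signs I) F = (\<integral>\<epsilon>. avg (signs I) F \<partial>cube)" by (simp add: prob_space)
  also have "\<dots> = (\<integral>\<epsilon>. avg (signs I) (\<lambda>\<eta>. F (\<lambda>i. a \<eta> i * \<epsilon> i)) \<partial>cube)"
    by (rule Bochner_Integration.integral_cong) (simp_all add: avgF)
  also have "\<dots> = avg (signs I) (\<lambda>\<eta>. \<integral>\<epsilon>. F (\<lambda>i. a \<eta> i * \<epsilon> i) \<partial>cube)"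
    by (intro integral_avg_signs I intf)
  also have "\<dots> = avg (signs I) (\<lambda>\<eta>. \<integral>\<epsilon>. F \<epsilon> \<partial>cube)" by (intro avg_cong flip)
  also have "\<dots> = (\<integral>\<epsilon>. F \<epsilon> \<partial>cube)" using I by (simp add: avg_const signs_finite_nonempty)
  finally show ?thesis by simp
qed

lemma walsh_simple: "finite A \<Longrightarrow> simple_function cube (walsh A)"
proof (induction A rule: finite_induct)
  case (insert i A)
  have "walsh (insert i A) = (\<lambda>\<epsilon>. \<epsilon> i * walsh A \<epsilon>)"
    using insert.hyps by (simp add: walsh_def fun_eq_iff)
  then show ?case using simple_function_compose2[OF cube_coordinate_simple insert.IH, of "(*)"] by simp
qed (simp add: walsh_def[abs_def])

lemma rpoly_simple:
  assumes "finite I"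
  shows "simple_function cube (rpoly I y)"
proof -
  have "simple_function cube (\<lambda>\<epsilon>. walsh A \<epsilon> *\<^sub>R y A)" if "A \<in> Pow I" for A
    using that assms finite_subset by (intro simple_function_compose1[OF walsh_simple, where g="\<lambda>c. c *\<^sub>R y A"]) auto
  then show ?thesis unfolding rpoly_def[abs_def] by (rule simple_function_sum)
qed

lemma rpoly_cong: "(\<And>i. i \<in> I \<Longrightarrow> \<epsilon> i = \<epsilon>' i) \<Longrightarrow> rpoly I y \<epsilon> = rpoly I y \<epsilon>'"
  unfolding rpoly_def walsh_def by (intro sum.cong arg_cong[where f="\<lambda>c. c *\<^sub>R _"] prod.cong) auto

lemma simple_function_cube_integrable:
  fixes f :: "(nat \<Rightarrow> real) \<Rightarrow> real"
  assumes "simple_function cube f"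
  shows "integrable cube f"
proof -
  interpret prob_space cube by (rule prob_space_cube)
  show ?thesis
    by (intro integrableI_simple_bochner_integrable simple_bochner_integrable_simple assms)
qed

lemma rpoly_Lp:
  fixes y :: "nat set \<Rightarrow> 'a::complex_banach"
  assumes I: "finite I"
  shows "rpoly I y \<in> Lp cube p"
    "Lp_norm cube p (rpoly I y) = (avg (signs I) (\<lambda>\<epsilon>. norm (rpoly I y \<epsilon>) powr p)) powr (1 / p)"
proof -
  have int: "integrable cube (\<lambda>\<epsilon>. norm (rpoly I y \<epsilon>) powr p)"
    by (intro simple_function_cube_integrable simple_function_compose1[OF rpoly_simple[OF I], where g="\<lambda>v. norm v powr p"])
  then show "rpoly I y \<in> Lp cube p"
    using strongly_measurable_simple[OF rpoly_simple[OF I]] by (simp add: Lp_def)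
  show "Lp_norm cube p (rpoly I y) = (avg (signs I) (\<lambda>\<epsilon>. norm (rpoly I y \<epsilon>) powr p)) powr (1 / p)"
    unfolding Lp_norm_def
    by (subst integral_cube_cylinder[OF I _ int]) (auto intro: arg_cong[where f="\<lambda>v. norm v powr p"] rpoly_cong)
qed

lemma walsh_coeff_scaleC: "walsh_coeff f A = strong_integral cube (\<lambda>\<epsilon>. complex_of_real (walsh A \<epsilon>) *\<^sub>C f \<epsilon>)"
  by (simp add: walsh_coeff_def scaleR_scaleC)

lemma walsh_coeff_rpoly:
  fixes y :: "nat set \<Rightarrow> 'a::complex_banach"
  assumes I: "finite I" and B: "finite B"
  shows "walsh_coeff (rpoly I y) B = (if B \<subseteq> I then y B else 0)"
proof -
  interpret prob_space cube by (rule prob_space_cube)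
  have int: "integrable cube (\<lambda>\<epsilon>. walsh B \<epsilon> * walsh A \<epsilon>)" if "A \<subseteq> I" for A
    using that I finite_subset B
    by (intro simple_function_cube_integrable simple_function_compose2[OF walsh_simple walsh_simple, where h="(*)"]) auto
  have eq: "(\<integral>\<epsilon>. walsh B \<epsilon> * walsh A \<epsilon> \<partial>cube) = (if A = B then 1 else 0)" if "A \<subseteq> I" for A
  proof -
    have cong: "walsh B \<epsilon> * walsh A \<epsilon> = walsh B \<epsilon>' * walsh A \<epsilon>'" if e: "\<And>i. i \<in> B \<union> I \<Longrightarrow> \<epsilon> i = \<epsilon>' i" for \<epsilon> \<epsilon>'
      unfolding walsh_def using e \<open>A \<subseteq> I\<close> by (intro arg_cong2[where f="(*)"] prod.cong) auto
    have fin: "finite (B \<union> I)" using I B by simp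
    have "(\<integral>\<epsilon>. walsh B \<epsilon> * walsh A \<epsilon> \<partial>cube) = avg (signs (B \<union> I)) (\<lambda>\<epsilon>. walsh B \<epsilon> * walsh A \<epsilon>)"
      by (rule integral_cube_cylinder[OF fin cong int[OF that]])
    moreover have "A \<subseteq> B \<union> I" using that by auto
    ultimately show ?thesis using avg_walsh_mult[of "B \<union> I" B A] fin by (simp add: eq_commute)
  qed
  have "walsh_coeff (rpoly I y) B
      = strong_integral cube (\<lambda>\<epsilon>. \<Sum>A\<in>Pow I. complex_of_real (walsh B \<epsilon> * walsh A \<epsilon>) *\<^sub>C y A)"
    by (simp add: walsh_coeff_def rpoly_def scaleC_sum_right scaleR_scaleC scaleC_scaleC)
  also have "\<dots> = (\<Sum>A\<in>Pow I. strong_integral cube (\<lambda>\<epsilon>. complex_of_real (walsh B \<epsilon> * walsh A \<epsilon>) *\<^sub>C y A))"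
    using int by (intro strong_integral_sum bochner_scaleC_const integrable_of_real) auto
  also have "\<dots> = (\<Sum>A\<in>Pow I. (\<integral>\<epsilon>. complex_of_real (walsh B \<epsilon> * walsh A \<epsilon>) \<partial>cube) *\<^sub>C y A)"
    using int by (intro sum.cong strong_integral_scaleC_const integrable_of_real refl) auto
  also have "\<dots> = (\<Sum>A\<in>Pow I. if A = B then y A else 0)"
    unfolding integral_complex_of_real using eq by (intro sum.cong) auto
  finally show ?thesis using I by simp
qed

section \<open>Truncation to finitely many signs\<close>

lemma (in prob_space) weighted_integral_powr_le:
  fixes f :: "'a \<Rightarrow> real"
  assumes f: "f \<in> borel_measurable M" "\<And>w. f w \<ge> 0" and p: "p \<ge> 1" and int: "integrable M (\<lambda>w. f w powr p)"
    and k: "k \<in> borel_measurable M" "\<And>w. w \<in> space M \<Longrightarrow> 0 \<le> k w" "\<And>w. w \<in> space M \<Longrightarrow> k w \<le> B"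
       "(\<integral>w. k w \<partial>M) = 1"
  shows "(\<integral>w. k w * f w \<partial>M) powr p \<le> (\<integral>w. k w * f w powr p \<partial>M)"
proof -
  note intf = integral_powr_le(1)[OF f p int]
  have kint: "integrable M (\<lambda>w. k w * g w)" if "integrable M g" for g :: "'a \<Rightarrow> real"
  proof (rule Bochner_Integration.integrable_bound[of M "\<lambda>w. B * g w"])
    have "\<bar>k w\<bar> \<le> \<bar>B\<bar>" if "w \<in> space M" for w using k(2,3)[OF that] by linarith
    then show "AE w in M. norm (k w * g w) \<le> norm (B * g w)"
      by (intro AE_I2) (simp add: abs_mult mult_right_mono)
  qed (use k(1) that in auto)
  have k1: "integrable M k" using kint[of "\<lambda>_. 1"] by simp
  define b where "b = (\<integral>w. k w * f w \<partial>M)"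
  have b0: "b \<ge> 0" unfolding b_def using f k by (intro integral_nonneg_AE AE_I2) auto
  have "b powr p = b powr p * (\<integral>w. k w \<partial>M) + p * b powr (p - 1) * ((\<integral>w. k w * f w \<partial>M) - b * (\<integral>w. k w \<partial>M))"
    using k by (simp add: b_def)
  also have "\<dots> = (\<integral>w. b powr p * k w + p * b powr (p - 1) * (k w * f w - b * k w) \<partial>M)"
    using kint[OF intf] k1 by simp
  also have "\<dots> \<le> (\<integral>w. k w * f w powr p \<partial>M)"
  proof (rule integral_mono)
    show "integrable M (\<lambda>w. b powr p * k w + p * b powr (p - 1) * (k w * f w - b * k w))"
      using kint[OF intf] k1 by simp
    fix w assume w: "w \<in> space M"
    have "k w * (b powr p + p * b powr (p - 1) * (f w - b)) \<le> k w * f w powr p"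
      using f k(2)[OF w] p b0 by (intro mult_left_mono powr_tangent) auto
    then show "b powr p * k w + p * b powr (p - 1) * (k w * f w - b * k w) \<le> k w * f w powr p"
      by (simp add: algebra_simps)
  qed (rule kint[OF int])
  finally show ?thesis by (simp add: b_def)
qed

lemma riesz_simple:
  assumes "finite I"
  shows "simple_function cube (riesz I a)"
  using assms
proof (induction I rule: finite_induct)
  case (insert i I)
  have "riesz (insert i I) a = (\<lambda>w. (1 + a i * w i) * riesz I a w)"
    using insert.hyps by (simp add: riesz_def fun_eq_iff)
  then show ?case
    using simple_function_compose2[OF cube_coordinate_simple insert.IH, of "\<lambda>x y. (1 + a i * x) * y" i] by simp
qed (simp add: riesz_def[abs_def])

text \<open>The Riesz product projects onto the coordinates in \<open>I\<close>, with norm one.\<close>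

lemma cube_truncation:
  fixes f :: "(nat \<Rightarrow> real) \<Rightarrow> 'a::complex_banach"
  assumes f: "f \<in> Lp cube p" and p: "p \<ge> 1" and I: "finite I"
  shows "(avg (signs I) (\<lambda>\<epsilon>. norm (rpoly I (walsh_coeff f) \<epsilon>) powr p)) powr (1 / p) \<le> Lp_norm cube p f"
proof -
  interpret prob_space cube by (rule prob_space_cube)
  note bf = Lp_bochner[OF f p]
  have fm: "(\<lambda>w. norm (f w)) \<in> borel_measurable cube" "integrable cube (\<lambda>w. norm (f w) powr p)"
    using f by (auto simp: Lp_def strongly_measurable_norm)
  define B where "B = (2::real) ^ card I"
  have res: "restrict w I \<in> signs I" if "w \<in> space cube" for w using cube_coordinate[OF that] by auto
  \<comment> \<open>By symmetry the kernel has mean one in either argument: in \<open>w\<close> for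
    Jensen's inequality, in \<epsilon> for the final exchange of averages.\<close>
  have sym: "riesz I a w = riesz I w a" for a w by (simp add: riesz_def mult.commute)
  have rres: "riesz I a w = riesz I a (restrict w I)" for a w by (simp add: riesz_def)
  have k: "0 \<le> riesz I \<epsilon> w" "riesz I \<epsilon> w \<le> B" if e: "\<epsilon> \<in> signs I" and w: "w \<in> space cube" for \<epsilon> w
  proof -
    show "0 \<le> riesz I \<epsilon> w"
      unfolding rres[of \<epsilon> w] using res[OF w] by (rule riesz_nonneg) (simp add: signs_abs[OF e])
    have "\<epsilon> i * w i \<in> {-1, 1}" if "i \<in> I" for i
      using PiE_mem[OF e that] cube_coordinate[OF w, of i] by auto
    then have "0 \<le> 1 + \<epsilon> i * w i" "1 + \<epsilon> i * w i \<le> 2" if "i \<in> I" for i using that by fastforce+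
    then show "riesz I \<epsilon> w \<le> B" unfolding riesz_def B_def prod_constant[symmetric] by (intro prod_mono) auto
  qed
  have km: "riesz I \<epsilon> \<in> borel_measurable cube" for \<epsilon>
    by (rule borel_measurable_simple_function[OF riesz_simple[OF I]])
  have k1: "(\<integral>w. riesz I \<epsilon> w \<partial>cube) = 1" for \<epsilon>
  proof -
    have "riesz I \<epsilon> w = riesz I \<epsilon> w'" if "\<And>i. i \<in> I \<Longrightarrow> w i = w' i" for w w'
      using that by (simp add: riesz_def)
    from integral_cube_cylinder[OF I this simple_function_cube_integrable[OF riesz_simple[OF I]]]
    show ?thesis by (simp add: avg_riesz[OF I])
  qed
  \<comment> \<open>Expanding the kernel into Walsh functions of both arguments turns the truncated
    expansion of \<open>f\<close> into one integral against a positive bounded kernel.\<close>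
  have coef: "rpoly I (walsh_coeff f) \<epsilon> = strong_integral cube (\<lambda>w. complex_of_real (riesz I \<epsilon> w) *\<^sub>C f w)" for \<epsilon>
  proof -
    have wb: "bochner cube (\<lambda>w. complex_of_real (walsh A w) *\<^sub>C f w)" if "A \<in> Pow I" for A
    proof (rule bochner_scaleC_bounded[where B=1, OF bf(1)])
      show "(\<lambda>w. complex_of_real (walsh A w)) \<in> borel_measurable cube"
        using that finite_subset[OF _ I]
        by (intro borel_measurable_simple_function simple_function_compose1[where g=complex_of_real] walsh_simple) auto
      show "cmod (complex_of_real (walsh A w)) \<le> 1" if w: "w \<in> space cube" for w
      proof -
        have "\<bar>w i\<bar> = 1" for i using cube_coordinate[OF w, of i] by auto
        then show ?thesis by (simp add: walsh_def prod_norm[symmetric])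
      qed
    qed
    have "strong_integral cube (\<lambda>w. complex_of_real (riesz I \<epsilon> w) *\<^sub>C f w)
        = strong_integral cube (\<lambda>w. \<Sum>A\<in>Pow I. complex_of_real (walsh A \<epsilon>) *\<^sub>C (complex_of_real (walsh A w) *\<^sub>C f w))"
      by (simp add: riesz_expand[OF I] scaleC_sum_left scaleC_scaleC walsh_def)
    also have "\<dots> = (\<Sum>A\<in>Pow I. strong_integral cube (\<lambda>w. complex_of_real (walsh A \<epsilon>) *\<^sub>C (complex_of_real (walsh A w) *\<^sub>C f w)))"
      by (intro strong_integral_sum bochner_bounded_linear[OF bounded_linear_scaleC_right] wb)
    also have "\<dots> = (\<Sum>A\<in>Pow I. complex_of_real (walsh A \<epsilon>) *\<^sub>C walsh_coeff f A)"
      using wb by (intro sum.cong refl) (simp add: strong_integral_scaleC walsh_coeff_scaleC)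
    finally show ?thesis by (simp add: rpoly_def scaleR_scaleC)
  qed
  have "norm (rpoly I (walsh_coeff f) \<epsilon>) powr p \<le> (\<integral>w. riesz I \<epsilon> w * norm (f w) powr p \<partial>cube)"
    if e: "\<epsilon> \<in> signs I" for \<epsilon>
  proof -
    have "bochner cube (\<lambda>w. complex_of_real (riesz I \<epsilon> w) *\<^sub>C f w)"
      using k[OF e] by (intro bochner_scaleC_bounded[where B=B, OF bf(1)] borel_measurable_simple_function
          simple_function_compose1[where g=complex_of_real] riesz_simple I) auto
    then have "norm (rpoly I (walsh_coeff f) \<epsilon>) \<le> (\<integral>w. norm (complex_of_real (riesz I \<epsilon> w) *\<^sub>C f w) \<partial>cube)"
      unfolding coef by (rule strong_integral_norm_le)
    also have "\<dots> = (\<integral>w. riesz I \<epsilon> w * norm (f w) \<partial>cube)"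
      using k[OF e] by (intro Bochner_Integration.integral_cong) (auto simp: norm_scaleC)
    finally have "norm (rpoly I (walsh_coeff f) \<epsilon>) powr p \<le> (\<integral>w. riesz I \<epsilon> w * norm (f w) \<partial>cube) powr p"
      using p by (intro powr_mono2) auto
    also have "\<dots> \<le> (\<integral>w. riesz I \<epsilon> w * norm (f w) powr p \<partial>cube)"
      using fm k[OF e] km k1 p by (intro weighted_integral_powr_le) auto
    finally show ?thesis .
  qed
  then have "avg (signs I) (\<lambda>\<epsilon>. norm (rpoly I (walsh_coeff f) \<epsilon>) powr p)
      \<le> avg (signs I) (\<lambda>\<epsilon>. \<integral>w. riesz I \<epsilon> w * norm (f w) powr p \<partial>cube)"
    by (rule avg_mono)
  also have "\<dots> = (\<integral>w. avg (signs I) (\<lambda>\<epsilon>. riesz I \<epsilon> w * norm (f w) powr p) \<partial>cube)"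
  proof (rule integral_avg_signs(1)[OF I, symmetric])
    fix \<epsilon> assume e: "\<epsilon> \<in> signs I"
    show "integrable cube (\<lambda>w. riesz I \<epsilon> w * norm (f w) powr p)"
    proof (rule Bochner_Integration.integrable_bound[of _ "\<lambda>w. B * norm (f w) powr p"])
      show "integrable cube (\<lambda>w. B * norm (f w) powr p)" using fm by simp
      show "AE w in cube. norm (riesz I \<epsilon> w * norm (f w) powr p) \<le> norm (B * norm (f w) powr p)"
        using k[OF e] by (intro AE_I2) (auto simp: abs_mult B_def intro!: mult_right_mono)
    qed (use fm km in auto)
  qed
  also have "\<dots> = (\<integral>w. norm (f w) powr p \<partial>cube)"
  proof (rule Bochner_Integration.integral_cong[OF refl])
    fix w assume "w \<in> space cube"
    have "avg (signs I) (\<lambda>\<epsilon>. riesz I \<epsilon> w * norm (f w) powr p) = norm (f w) powr p * avg (signs I) (riesz I w)"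
      by (simp add: sym[of _ w] avg_cmult[symmetric] mult.commute)
    then show "avg (signs I) (\<lambda>\<epsilon>. riesz I \<epsilon> w * norm (f w) powr p) = norm (f w) powr p"
      by (simp add: avg_riesz[OF I])
  qed
  finally show ?thesis
    unfolding Lp_norm_def using p by (intro powr_mono2 avg_nonneg) auto
qed

section \<open>Functions on the infinite torus\<close>

text \<open>Only the vanishing mean of \<open>V\<close> enters, so the kernel integrates to one over
  roots of unity just as over the circle. This is what permits finite averages in
  \<open>z\<close>.\<close>

lemma avg_one_plus_Re:
  assumes V: "finite V" "V \<noteq> {}" "(\<Sum>v\<in>V. v) = 0" and I: "finite I"
  shows "avg (PiE I (\<lambda>_. V)) (\<lambda>z. \<Prod>j\<in>I. 1 + Re (z j * c j)) = 1"
proof -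
  have "(\<Sum>z\<in>PiE I (\<lambda>_. V). \<Prod>j\<in>I. 1 + Re (z j * c j)) = (\<Prod>j\<in>I. \<Sum>v\<in>V. 1 + Re (v * c j))"
    using V I by (subst prod_sum_PiE) auto
  also have "\<dots> = (\<Prod>j\<in>I. real (card V))"
  proof (rule prod.cong[OF refl])
    fix j
    have "(\<Sum>v\<in>V. Re (v * c j)) = Re ((\<Sum>v\<in>V. v) * c j)"
      by (simp add: sum_distrib_right)
    then show "(\<Sum>v\<in>V. 1 + Re (v * c j)) = real (card V)" using V by (simp add: sum.distrib)
  qed
  also have "\<dots> = real (card (PiE I (\<lambda>_. V)))" using I by (simp add: card_PiE)
  finally show ?thesis
    using V I by (simp add: avg_def card_PiE)
qed

text \<open>Only the coefficients with all entries \<open>0\<close> or \<open>d i\<close> survive the product of the kernels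
  \<open>1 + Re (z i * w i powi (- d i))\<close>, since \<open>f\<close> has no coefficients with a negative entry.\<close>

lemma torus_truncation:
  fixes f :: "(nat \<Rightarrow> complex) \<Rightarrow> 'a::complex_banach"
  assumes f: "f \<in> torus_Hp p" and p: "p \<ge> 1" and I: "finite I" and d: "\<And>i. i \<in> I \<Longrightarrow> d i \<ge> 1"
    and V: "finite V" "V \<noteq> {}" "(\<Sum>v\<in>V. v) = 0" "\<And>v. v \<in> V \<Longrightarrow> cmod v = 1"
  defines "y \<equiv> \<lambda>A. (1 / 2) ^ card A *\<^sub>R torus_coeff f (\<lambda>i. if i \<in> A then d i else 0)"
  shows "avg (PiE I (\<lambda>_. V)) (\<lambda>z. norm (tpoly id I y z)) \<le> (\<integral>w. norm (f w) \<partial>torus)"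
proof -
  interpret prob_space torus by (rule prob_space_torus)
  have fLp: "f \<in> Lp torus p" and neg: "\<And>\<alpha>. \<alpha> \<in> int_multiindices - nonneg_multiindices \<Longrightarrow> torus_coeff f \<alpha> = 0"
    using f by (auto simp: torus_Hp_def)
  note bf = Lp_bochner(1)[OF fLp p]
  define K where "K z w = (\<Prod>j\<in>I. 1 + Re (z j * w j powi (- d j)))" for z w :: "nat \<Rightarrow> complex"
  \<comment> \<open>Each factor of the kernel contributes 1, half of
    \<open>z j * w j powi (- d j)\<close>, or half of its conjugate. \<open>A\<close> collects the
    coordinates of the second kind and \<open>B\<close> those of the third; the halves are the
    origin of \<open>(1 / 2) ^ card A\<close> in \<open>y\<close>.\<close>
  define \<beta> where "\<beta> A B i = (if i \<in> A then - d i else if i \<in> B then d i else 0)" for A B and i :: nat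
  define c where "c z A B = (1 / 2) ^ card A * (1 / 2) ^ card B * (\<Prod>i\<in>A. z i) * (\<Prod>i\<in>B. cnj (z i))"
    for z :: "nat \<Rightarrow> complex" and A B
  have Vz: "cmod (z j) = 1" if "z \<in> PiE I (\<lambda>_. V)" "j \<in> I" for z j
    using V(4) PiE_mem[OF that] by auto
  have expand: "complex_of_real (K z w) = (\<Sum>B\<in>Pow I. \<Sum>A\<in>Pow (I - B). c z A B * tmono (\<beta> A B) w)"
    if w: "w \<in> space torus" for z w
  proof -
    define a where "a j = z j * w j powi (- d j)" for j
    have "complex_of_real (K z w) = (\<Prod>j\<in>I. (1 / 2) * cnj (a j) + ((1 / 2) * a j + 1))"
      unfolding K_def of_real_prod
    proof (rule prod.cong[OF refl])
      fix j
      have "complex_of_real (Re (a j)) = (1 / 2) * (a j + cnj (a j))"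
        by (simp add: complex_add_cnj)
      then show "complex_of_real (1 + Re (z j * w j powi (- d j))) = (1 / 2) * cnj (a j) + ((1 / 2) * a j + 1)"
        by (simp add: a_def algebra_simps)
    qed
    also have "\<dots> = (\<Sum>B\<in>Pow I. (\<Prod>j\<in>B. (1 / 2) * cnj (a j)) * (\<Prod>j\<in>I - B. (1 / 2) * a j + 1))"
      by (rule prod_add[OF I])
    also have "\<dots> = (\<Sum>B\<in>Pow I. \<Sum>A\<in>Pow (I - B). (\<Prod>j\<in>B. (1 / 2) * cnj (a j)) * (\<Prod>j\<in>A. (1 / 2) * a j))"
    proof (rule sum.cong[OF refl])
      fix B
      have fin: "finite (I - B)" using I by simp
      show "(\<Prod>j\<in>B. (1 / 2) * cnj (a j)) * (\<Prod>j\<in>I - B. (1 / 2) * a j + 1)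
          = (\<Sum>A\<in>Pow (I - B). (\<Prod>j\<in>B. (1 / 2) * cnj (a j)) * (\<Prod>j\<in>A. (1 / 2) * a j))"
        unfolding prod_add[OF fin] by (simp add: sum_distrib_left)
    qed
    also have "\<dots> = (\<Sum>B\<in>Pow I. \<Sum>A\<in>Pow (I - B). c z A B * tmono (\<beta> A B) w)"
    proof (intro sum.cong refl)
      fix A B assume AB: "B \<in> Pow I" "A \<in> Pow (I - B)"
      then have fin: "finite A" "finite B" "A \<inter> B = {}" 
        using finite_subset[OF _ I, of A] finite_subset[OF _ I, of B] by auto
      have "cnj (a j) = cnj (z j) * w j powi d j" for j
      proof -
        have "cmod (w j powi (- d j)) = 1" using torus_coordinate[OF w] by (simp add: norm_power_int)
        then have "cnj (w j powi (- d j)) = 1 / (w j powi (- d j))" by (simp add: divide_conv_cnj)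
        then show ?thesis by (simp add: a_def power_int_minus divide_inverse)
      qed
      then have 1: "(\<Prod>j\<in>B. (1 / 2) * cnj (a j)) = (1 / 2) ^ card B * (\<Prod>i\<in>B. cnj (z i)) * (\<Prod>i\<in>B. w i powi d i)"
        by (simp only: prod.distrib prod_constant mult_ac)
      have 2: "(\<Prod>j\<in>A. (1 / 2) * a j) = (1 / 2) ^ card A * (\<Prod>i\<in>A. z i) * (\<Prod>i\<in>A. w i powi (- d i))"
        by (simp only: a_def prod.distrib prod_constant mult_ac)
      have "tmono (\<beta> A B) w = (\<Prod>i\<in>A \<union> B. w i powi \<beta> A B i)"
        using fin by (intro tmono_superset) (auto simp: \<beta>_def split: if_splits)
      also have "\<dots> = (\<Prod>i\<in>A. w i powi \<beta> A B i) * (\<Prod>i\<in>B. w i powi \<beta> A B i)"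
        by (rule prod.union_disjoint[OF fin])
      also have "(\<Prod>i\<in>A. w i powi \<beta> A B i) = (\<Prod>i\<in>A. w i powi (- d i))"
        by (intro prod.cong) (auto simp: \<beta>_def)
      also have "(\<Prod>i\<in>B. w i powi \<beta> A B i) = (\<Prod>i\<in>B. w i powi d i)"
        using fin by (intro prod.cong) (auto simp: \<beta>_def)
      finally show "(\<Prod>j\<in>B. (1 / 2) * cnj (a j)) * (\<Prod>j\<in>A. (1 / 2) * a j) = c z A B * tmono (\<beta> A B) w"
        unfolding 1 2 c_def by (simp only: mult_ac)
    qed
    finally show ?thesis .
  qed
  have \<beta>_coeff: "strong_integral torus (\<lambda>w. tmono (\<beta> A B) w *\<^sub>C f w) = torus_coeff f (\<lambda>i. - \<beta> A B i)" for A B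
    by (simp add: torus_coeff_tmono)
  \<comment> \<open>A conjugated factor produces the entry \<open>- d i\<close>, negative because
    \<open>d i \<ge> 1\<close>; analyticity of \<open>f\<close> removes all terms with nonempty
    \<open>B\<close>.\<close>
  have zero: "torus_coeff f (\<lambda>i. - \<beta> A B i) = 0" if BA: "B \<in> Pow I" "B \<noteq> {}" "A \<in> Pow (I - B)" for A B
  proof (rule neg)
    have "{i. - \<beta> A B i \<noteq> 0} \<subseteq> I" using that by (auto simp: \<beta>_def split: if_splits)
    then have "finite {i. - \<beta> A B i \<noteq> 0}" using I finite_subset by blast
    moreover obtain i where "i \<in> B" "i \<notin> A" "i \<in> I" using BA by auto
    then have "\<not> 0 \<le> - \<beta> A B i" using d[of i] by (simp add: \<beta>_def)
    ultimately show "(\<lambda>i. - \<beta> A B i) \<in> int_multiindices - nonneg_multiindices"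
      by (auto simp: int_multiindices_def nonneg_multiindices_def)
  qed
  have coef: "tpoly id I y z = strong_integral torus (\<lambda>w. complex_of_real (K z w) *\<^sub>C f w)" for z
  proof -
    have "strong_integral torus (\<lambda>w. complex_of_real (K z w) *\<^sub>C f w)
        = strong_integral torus (\<lambda>w. \<Sum>B\<in>Pow I. \<Sum>A\<in>Pow (I - B). c z A B *\<^sub>C (tmono (\<beta> A B) w *\<^sub>C f w))"
      by (rule strong_integral_cong) (simp add: expand scaleC_sum_left scaleC_scaleC)
    also have "\<dots> = (\<Sum>B\<in>Pow I. \<Sum>A\<in>Pow (I - B). c z A B *\<^sub>C torus_coeff f (\<lambda>i. - \<beta> A B i))"
      by (simp add: strong_integral_sum strong_integral_scaleC bochner_sum bochner_tmono bf \<beta>_coeff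
          bochner_bounded_linear[OF bounded_linear_scaleC_right])
    also have "\<dots> = (\<Sum>B\<in>{{}}. \<Sum>A\<in>Pow (I - B). c z A B *\<^sub>C torus_coeff f (\<lambda>i. - \<beta> A B i))"
      using I by (intro sum.mono_neutral_right) (auto intro!: sum.neutral simp: zero)
    also have "\<dots> = (\<Sum>A\<in>Pow I. chi id A z *\<^sub>C y A)"
    proof -
      have "(\<lambda>i. - \<beta> A {} i) = (\<lambda>i. if i \<in> A then d i else 0)" for A by (auto simp: \<beta>_def)
      then show ?thesis by (simp add: y_def c_def chi_def scaleR_scaleC scaleC_scaleC mult.commute)
    qed
    finally show ?thesis by (simp add: tpoly_def)
  qed
  have K0: "0 \<le> K z w" "K z w \<le> 2 ^ card I" if z: "z \<in> PiE I (\<lambda>_. V)" and w: "w \<in> space torus" for z w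
  proof -
    have Re_le: "\<bar>Re (z j * w j powi (- d j))\<bar> \<le> 1" if "j \<in> I" for j
      using abs_Re_le_cmod[of "z j * w j powi (- d j)"] Vz[OF z that] torus_coordinate[OF w]
      by (simp add: norm_mult norm_power_int)
    have *: "0 \<le> 1 + Re (z j * w j powi (- d j))" "1 + Re (z j * w j powi (- d j)) \<le> 2" if "j \<in> I" for j
      using Re_le[OF that] by linarith+
    show "0 \<le> K z w" unfolding K_def using * by (intro prod_nonneg) auto
    show "K z w \<le> 2 ^ card I" unfolding K_def prod_constant[symmetric] using * by (intro prod_mono) auto
  qed
  have Km: "K z \<in> borel_measurable torus" for z
    unfolding K_def[abs_def]
    by (intro borel_measurable_prod borel_measurable_add borel_measurable_const measurable_compose[OF _ borel_measurable_Re]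
        borel_measurable_times power_int_measurable torus_coordinate_measurable)
  have Kint: "integrable torus (\<lambda>w. K z w * norm (f w))" if z: "z \<in> PiE I (\<lambda>_. V)" for z
  proof (rule Bochner_Integration.integrable_bound[of _ "\<lambda>w. 2 ^ card I * norm (f w)"])
    show "AE w in torus. norm (K z w * norm (f w)) \<le> norm (2 ^ card I * norm (f w))"
      using K0[OF z] by (intro AE_I2) (simp add: abs_mult mult_right_mono)
  qed (use bf Km strongly_measurable_norm in \<open>auto simp: bochner_def\<close>)
  have "norm (tpoly id I y z) \<le> (\<integral>w. K z w * norm (f w) \<partial>torus)" if z: "z \<in> PiE I (\<lambda>_. V)" for z
  proof -
    have "(\<lambda>w. complex_of_real (K z w)) \<in> borel_measurable torus" using Km[of z] by simp
    then have "bochner torus (\<lambda>w. complex_of_real (K z w) *\<^sub>C f w)"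
      using K0[OF z] by (intro bochner_scaleC_bounded[where B="2 ^ card I", OF bf]) auto
    then have "norm (tpoly id I y z) \<le> (\<integral>w. norm (complex_of_real (K z w) *\<^sub>C f w) \<partial>torus)"
      unfolding coef by (rule strong_integral_norm_le)
    also have "\<dots> = (\<integral>w. K z w * norm (f w) \<partial>torus)"
      using K0[OF z] by (intro Bochner_Integration.integral_cong) (auto simp: norm_scaleC)
    finally show ?thesis .
  qed
  then have "avg (PiE I (\<lambda>_. V)) (\<lambda>z. norm (tpoly id I y z)) \<le> avg (PiE I (\<lambda>_. V)) (\<lambda>z. \<integral>w. K z w * norm (f w) \<partial>torus)"
    by (rule avg_mono)
  also have "\<dots> = (\<integral>w. avg (PiE I (\<lambda>_. V)) (\<lambda>z. K z w * norm (f w)) \<partial>torus)"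
    unfolding avg_def using Kint by (simp add: Bochner_Integration.integral_sum)
  also have "\<dots> = (\<integral>w. norm (f w) \<partial>torus)"
  proof (rule Bochner_Integration.integral_cong[OF refl])
    fix w
    have "avg (PiE I (\<lambda>_. V)) (\<lambda>z. K z w * norm (f w)) = norm (f w) * avg (PiE I (\<lambda>_. V)) (\<lambda>z. K z w)"
      by (simp add: avg_cmult[symmetric] mult.commute)
    then show "avg (PiE I (\<lambda>_. V)) (\<lambda>z. K z w * norm (f w)) = norm (f w)"
      unfolding K_def using avg_one_plus_Re[OF V(1-3) I] by simp
  qed
  finally show ?thesis .
qed

section \<open>Uniqueness of Fourier coefficients\<close>

text \<open>Let \<open>N\<close> consist of the bounded functions \<open>\<phi>\<close> for which all Fourier coefficients of \<open>\<phi> F\<close>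
  vanish.  The bounded functions \<open>m\<close> with \<open>m N \<subseteq> N\<close> form an algebra that is closed under bounded
  pointwise limits and contains the monomials; hence it contains the indicators of all measurable
  sets.\<close>

lemma torus_coeff_unique:
  fixes F :: "(nat \<Rightarrow> complex) \<Rightarrow> 'a::complex_banach"
  assumes F: "bochner torus F" and 0: "\<And>\<beta>. \<beta> \<in> int_multiindices \<Longrightarrow> torus_coeff F \<beta> = 0"
  shows "(\<integral>w. norm (F w) \<partial>torus) = 0"
proof -
  interpret prob_space torus by (rule prob_space_torus)
  define bm where "bm \<phi> \<longleftrightarrow> \<phi> \<in> borel_measurable torus \<and> (\<exists>B. \<forall>w\<in>space torus. cmod (\<phi> w) \<le> B)"
    for \<phi> :: "(nat \<Rightarrow> complex) \<Rightarrow> complex"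
  define L where "L \<phi> = strong_integral torus (\<lambda>w. \<phi> w *\<^sub>C F w)" for \<phi> :: "(nat \<Rightarrow> complex) \<Rightarrow> complex"
  define N where "N \<phi> \<longleftrightarrow> bm \<phi> \<and> (\<forall>\<beta>\<in>int_multiindices. L (\<lambda>w. \<phi> w * tmono \<beta> w) = 0)"
    for \<phi> :: "(nat \<Rightarrow> complex) \<Rightarrow> complex"
  define Mult where "Mult m \<longleftrightarrow> bm m \<and> (\<forall>\<phi>. N \<phi> \<longrightarrow> N (\<lambda>w. m w * \<phi> w))"
    for m :: "(nat \<Rightarrow> complex) \<Rightarrow> complex"
  have bmF: "bochner torus (\<lambda>w. \<phi> w *\<^sub>C F w)" if "bm \<phi>" for \<phi>
    using that bochner_scaleC_bounded[OF F] unfolding bm_def by blast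
  have bm_mult: "bm (\<lambda>w. \<phi> w * \<psi> w)" if "bm \<phi>" "bm \<psi>" for \<phi> \<psi>
  proof -
    obtain B C where B: "\<forall>w\<in>space torus. cmod (\<phi> w) \<le> B" and C: "\<forall>w\<in>space torus. cmod (\<psi> w) \<le> C"
      using \<open>bm \<phi>\<close> \<open>bm \<psi>\<close> by (auto simp: bm_def)
    have "cmod (\<phi> w * \<psi> w) \<le> B * C" if "w \<in> space torus" for w
      unfolding norm_mult using B C that by (intro mult_mono) (auto intro: order_trans[OF norm_ge_zero])
    then show ?thesis using \<open>bm \<phi>\<close> \<open>bm \<psi>\<close> by (auto simp: bm_def)
  qed
  have bm_add: "bm (\<lambda>w. \<phi> w + \<psi> w)" if "bm \<phi>" "bm \<psi>" for \<phi> \<psi>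
  proof -
    obtain B C where B: "\<forall>w\<in>space torus. cmod (\<phi> w) \<le> B" and C: "\<forall>w\<in>space torus. cmod (\<psi> w) \<le> C"
      using \<open>bm \<phi>\<close> \<open>bm \<psi>\<close> by (auto simp: bm_def)
    have "cmod (\<phi> w + \<psi> w) \<le> B + C" if "w \<in> space torus" for w
      using B C that by (intro norm_triangle_le add_mono) auto
    then show ?thesis using \<open>bm \<phi>\<close> \<open>bm \<psi>\<close> by (auto simp: bm_def)
  qed
  have bm_const: "bm (\<lambda>_. c)" for c by (auto simp: bm_def)
  have bm_tmono: "bm (tmono \<beta>)" for \<beta>
    unfolding bm_def using tmono_measurable tmono_norm by (auto intro: exI[of _ 1])
  have L_add: "L (\<lambda>w. \<phi> w + \<psi> w) = L \<phi> + L \<psi>" if "bm \<phi>" "bm \<psi>" for \<phi> \<psi>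
    unfolding L_def using strong_integral_add[OF bmF[OF that(1)] bmF[OF that(2)]]
    by (simp add: scaleC_add_left)
  have L_cmult: "L (\<lambda>w. c * \<phi> w) = c *\<^sub>C L \<phi>" if "bm \<phi>" for c \<phi>
    unfolding L_def using strong_integral_scaleC[OF bmF[OF that], of c] by (simp add: scaleC_scaleC)
  have L_cong: "L \<phi> = L \<psi>" if "\<And>w. w \<in> space torus \<Longrightarrow> \<phi> w = \<psi> w" for \<phi> \<psi>
    unfolding L_def using that by (intro strong_integral_cong) simp
  have bm_cong: "bm \<phi> = bm \<psi>" if "\<And>w. w \<in> space torus \<Longrightarrow> \<phi> w = \<psi> w" for \<phi> \<psi>
    unfolding bm_def using measurable_cong[of torus \<phi> \<psi> borel, OF that] that by simp
  have N_cong: "N \<phi> = N \<psi>" if "\<And>w. w \<in> space torus \<Longrightarrow> \<phi> w = \<psi> w" for \<phi> \<psi>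
    unfolding N_def using bm_cong[of \<phi> \<psi>] L_cong[of "\<lambda>w. \<phi> w * tmono _ w" "\<lambda>w. \<psi> w * tmono _ w"] that
    by (metis (no_types, lifting) L_cong)
  have Mult_cong: "Mult m \<Longrightarrow> Mult m'" if "\<And>w. w \<in> space torus \<Longrightarrow> m w = m' w" for m m'
  proof -
    assume m: "Mult m"
    have "N (\<lambda>w. m' w * \<phi> w)" if "N \<phi>" for \<phi>
      using m that N_cong[of "\<lambda>w. m' w * \<phi> w" "\<lambda>w. m w * \<phi> w"] \<open>\<And>w. w \<in> space torus \<Longrightarrow> m w = m' w\<close>
      by (auto simp: Mult_def)
    then show "Mult m'" using m bm_cong[of m m'] that by (auto simp: Mult_def)
  qed
  have Mult_tmono: "Mult (tmono \<gamma>)" if \<gamma>: "\<gamma> \<in> int_multiindices" for \<gamma>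
    unfolding Mult_def
  proof (intro conjI allI impI bm_tmono)
    fix \<phi> assume \<phi>: "N \<phi>"
    have "L (\<lambda>w. tmono \<gamma> w * \<phi> w * tmono \<beta> w) = 0" if \<beta>: "\<beta> \<in> int_multiindices" for \<beta>
    proof -
      have "{i. \<gamma> i + \<beta> i \<noteq> 0} \<subseteq> {i. \<gamma> i \<noteq> 0} \<union> {i. \<beta> i \<noteq> 0}" by auto
      then have "(\<lambda>i. \<gamma> i + \<beta> i) \<in> int_multiindices"
        using \<gamma> \<beta> unfolding int_multiindices_def by (auto intro: finite_subset)
      then have "L (\<lambda>w. \<phi> w * tmono (\<lambda>i. \<gamma> i + \<beta> i) w) = 0" using \<phi> by (auto simp: N_def)
      moreover have "L (\<lambda>w. tmono \<gamma> w * \<phi> w * tmono \<beta> w) = L (\<lambda>w. \<phi> w * tmono (\<lambda>i. \<gamma> i + \<beta> i) w)"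
        by (rule L_cong) (simp add: tmono_add \<gamma> \<beta>)
      ultimately show ?thesis by simp
    qed
    then show "N (\<lambda>w. tmono \<gamma> w * \<phi> w)"
      using \<phi> bm_tmono bm_mult by (auto simp: N_def)
  qed
  have Mult_const: "Mult (\<lambda>_. c)" for c
  proof -
    have "N (\<lambda>w. c * \<phi> w)" if "N \<phi>" for \<phi>
      using that bm_mult[OF bm_const] L_cmult[OF bm_mult[OF _ bm_tmono]]
      by (auto simp: N_def mult.assoc)
    then show ?thesis using bm_const by (simp add: Mult_def)
  qed
  have Mult_add: "Mult (\<lambda>w. m w + m' w)" if "Mult m" "Mult m'" for m m'
  proof -
    have "N (\<lambda>w. (m w + m' w) * \<phi> w)" if "N \<phi>" for \<phi>
    proof -
      have n: "N (\<lambda>w. m w * \<phi> w)" "N (\<lambda>w. m' w * \<phi> w)"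
        using \<open>Mult m\<close> \<open>Mult m'\<close> that by (auto simp: Mult_def)
      then have b: "bm (\<lambda>w. m w * \<phi> w)" "bm (\<lambda>w. m' w * \<phi> w)" by (auto simp: N_def)
      show ?thesis unfolding N_def distrib_right
        using bm_add[OF b] L_add[OF bm_mult[OF b(1) bm_tmono] bm_mult[OF b(2) bm_tmono]] n
        by (simp add: N_def)
    qed
    then show ?thesis using that bm_add by (auto simp: Mult_def)
  qed
  have Mult_mult: "Mult (\<lambda>w. m w * m' w)" if "Mult m" "Mult m'" for m m'
    using that bm_mult unfolding Mult_def by (auto simp: mult.assoc)
  have Mult_lim: "Mult m"
    if m: "\<And>n::nat. Mult (mn n)" and B: "\<And>n w. w \<in> space torus \<Longrightarrow> cmod (mn n w) \<le> B"
      and lim: "\<And>w. w \<in> space torus \<Longrightarrow> (\<lambda>n. mn n w) \<longlonglongrightarrow> m w" for mn m B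
  proof -
    have mB: "cmod (m w) \<le> B" if "w \<in> space torus" for w
      using LIMSEQ_le_const2[OF tendsto_norm[OF lim[OF that]]] B[OF that] by blast
    have mm: "m \<in> borel_measurable torus"
      by (rule borel_measurable_LIMSEQ_metric[of mn torus m]) (use m lim in \<open>auto simp: Mult_def bm_def\<close>)
    have bmm: "bm m" using mB mm by (auto simp: bm_def)
    have "N (\<lambda>w. m w * \<phi> w)" if \<phi>: "N \<phi>" for \<phi>
    proof -
      have b\<phi>: "bm \<phi>" using \<phi> by (simp add: N_def)
      then obtain C where C: "\<And>w. w \<in> space torus \<Longrightarrow> cmod (\<phi> w) \<le> C" by (auto simp: bm_def)
      have "L (\<lambda>w. m w * \<phi> w * tmono \<beta> w) = 0" if \<beta>: "\<beta> \<in> int_multiindices" for \<beta>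
      proof -
        define G where "G w = (\<phi> w * tmono \<beta> w) *\<^sub>C F w" for w
        have bG: "bochner torus G" unfolding G_def by (intro bmF bm_mult b\<phi> bm_tmono)
        have bmn: "bm (mn n)" for n using m by (simp add: Mult_def)
        have bd: "bm (\<lambda>w. m w + (- 1) * mn n w)" for n by (intro bm_add bm_mult bm_const bmm bmn)
        have bb: "bochner torus (\<lambda>w. (m w + (- 1) * mn n w) *\<^sub>C G w)" for n
          using bmF[OF bm_mult[OF bd bm_mult[OF b\<phi> bm_tmono]]] by (simp add: G_def scaleC_scaleC)
        \<comment> \<open>The corresponding expression with \<open>mn n\<close> in place of
          \<open>m\<close> vanishes and may be subtracted for free. What is left tends to zero by
          dominated convergence while its value does not depend on \<open>n\<close>.\<close>
        have "L (\<lambda>w. m w * \<phi> w * tmono \<beta> w) = strong_integral torus (\<lambda>w. (m w + (- 1) * mn n w) *\<^sub>C G w)" for n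
        proof -
          have "L (\<lambda>w. mn n w * \<phi> w * tmono \<beta> w) = 0"
            using m[of n] \<phi> \<beta> by (auto simp: Mult_def N_def)
          moreover have b1: "bm (\<lambda>w. m w * \<phi> w * tmono \<beta> w)" "bm (\<lambda>w. mn n w * \<phi> w * tmono \<beta> w)"
            by (intro bm_mult bmm bmn b\<phi> bm_tmono)+
          ultimately have "L (\<lambda>w. m w * \<phi> w * tmono \<beta> w)
              = L (\<lambda>w. m w * \<phi> w * tmono \<beta> w + (- 1) * (mn n w * \<phi> w * tmono \<beta> w))"
            by (simp only: L_add bm_mult bm_const L_cmult scaleC_zero_right add_0_right)
          also have "\<dots> = strong_integral torus (\<lambda>w. (m w + (- 1) * mn n w) *\<^sub>C G w)"
            by (simp add: L_def G_def scaleC_scaleC algebra_simps)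
          finally show ?thesis .
        qed
        then have le: "norm (L (\<lambda>w. m w * \<phi> w * tmono \<beta> w)) \<le> (\<integral>w. norm ((m w + (- 1) * mn n w) *\<^sub>C G w) \<partial>torus)" for n
          using strong_integral_norm_le[OF bb] by metis
        have "(\<lambda>n. \<integral>w. norm ((m w + (- 1) * mn n w) *\<^sub>C G w) \<partial>torus) \<longlonglongrightarrow> (\<integral>w. 0 \<partial>torus)"
        proof (rule integral_dominated_convergence[where w="\<lambda>w. 2 * B * norm (G w)"])
          show "integrable torus (\<lambda>w. 2 * B * norm (G w))" using bG by (simp add: bochner_def)
          show "(\<lambda>w. norm ((m w + (- 1) * mn n w) *\<^sub>C G w)) \<in> borel_measurable torus" for n
            using bb[of n] strongly_measurable_norm unfolding bochner_def by blast
          show "AE w in torus. (\<lambda>n. norm ((m w + (- 1) * mn n w) *\<^sub>C G w)) \<longlonglongrightarrow> 0"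
          proof (rule AE_I2)
            fix w assume "w \<in> space torus"
            have "(\<lambda>n. m w + (- 1) * mn n w) \<longlonglongrightarrow> m w + (- 1) * m w"
              by (intro tendsto_intros lim \<open>w \<in> space torus\<close>)
            then have "(\<lambda>n. cmod (m w + (- 1) * mn n w) * norm (G w)) \<longlonglongrightarrow> cmod 0 * norm (G w)"
              by (intro tendsto_intros) simp
            then show "(\<lambda>n. norm ((m w + (- 1) * mn n w) *\<^sub>C G w)) \<longlonglongrightarrow> 0" by (simp add: norm_scaleC)
          qed
          show "AE w in torus. norm (norm ((m w + (- 1) * mn n w) *\<^sub>C G w)) \<le> 2 * B * norm (G w)" for n
          proof (rule AE_I2)
            fix w assume w: "w \<in> space torus"
            have "cmod (m w + (- 1) * mn n w) \<le> 2 * B"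
              using norm_triangle_ineq4[of "m w" "mn n w"] mB[OF w] B[OF w, of n] by simp
            then show "norm (norm ((m w + (- 1) * mn n w) *\<^sub>C G w)) \<le> 2 * B * norm (G w)"
              by (simp add: norm_scaleC mult_right_mono)
          qed
        qed simp
        then have "norm (L (\<lambda>w. m w * \<phi> w * tmono \<beta> w)) \<le> (\<integral>w. 0 \<partial>torus)"
          by (rule LIMSEQ_le_const) (use le in auto)
        then show ?thesis by simp
      qed
      then show ?thesis using bm_mult[OF bmm b\<phi>] by (simp add: N_def)
    qed
    then show ?thesis using bmm by (simp add: Mult_def)
  qed
  have Mult_poly: "Mult (\<lambda>w. complex_of_real (p (w i)))" if "real_polynomial_function p" for p :: "complex \<Rightarrow> real" and i
    using that
  proof (induction p rule: real_polynomial_function.induct)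
    case (linear f)
    interpret f: bounded_linear f by fact
    define e where "e k = (\<lambda>j. if j = i then k else 0 :: int)" for k
    have eI: "e k \<in> int_multiindices" for k
    proof -
      have "{j. e k j \<noteq> 0} \<subseteq> {i}" by (auto simp: e_def)
      then show ?thesis unfolding int_multiindices_def using finite_subset by blast
    qed
    have te: "tmono (e k) w = w i powi k" for k w
      by (subst tmono_superset[of "{i}"]) (auto simp: e_def split: if_splits)
    \<comment> \<open>On the circle the conjugate of \<open>w i\<close> is its inverse, so every
      real linear function of \<open>w i\<close> is a combination of the monomials with exponents 1
      and -1.\<close>
    have feq: "complex_of_real (f (w i)) = (complex_of_real (f 1) - \<i> * f \<i>) / 2 * tmono (e 1) w
        + (complex_of_real (f 1) + \<i> * f \<i>) / 2 * tmono (e (- 1)) w" if "w \<in> space torus" for w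
    proof -
      have "1 / w i = cnj (w i)"
        using torus_coordinate[OF that, of i] by (simp add: divide_conv_cnj)
      then have t: "tmono (e 1) w = w i" "tmono (e (- 1)) w = cnj (w i)"
        unfolding te by (simp_all add: power_int_minus inverse_eq_divide)
      have "w i = Re (w i) *\<^sub>R 1 + Im (w i) *\<^sub>R \<i>" by (simp add: complex_eq_iff)
      then have "f (w i) = Re (w i) * f 1 + Im (w i) * f \<i>"
        by (metis f.add f.scaleR real_scaleR_def)
      then show ?thesis unfolding t by (simp add: complex_eq_iff field_simps)
    qed
    have "Mult (\<lambda>w. (complex_of_real (f 1) - \<i> * f \<i>) / 2 * tmono (e 1) w
        + (complex_of_real (f 1) + \<i> * f \<i>) / 2 * tmono (e (- 1)) w)"
      by (intro Mult_add Mult_mult Mult_const Mult_tmono eI)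
    then show ?case by (rule Mult_cong[rotated]) (rule feq[symmetric])
  next
    case (const c)
    show ?case by (rule Mult_const)
  next
    case (add f g)
    then show ?case using Mult_add by simp
  next
    case (mult f g)
    then show ?case using Mult_mult by simp
  qed
  have Mult_cont: "Mult (\<lambda>w. complex_of_real (g (w i)))" if g: "continuous_on UNIV g" for g :: "complex \<Rightarrow> real" and i
  proof -
    let ?S = "sphere 0 1 :: complex set"
    have gS: "continuous_on ?S g" using g continuous_on_subset by blast
    have "\<exists>p. real_polynomial_function p \<and> (\<forall>x\<in>?S. \<bar>g x - p x\<bar> < 1 / real (Suc n))" for n
    proof (rule Stone_Weierstrass_real_polynomial_function[OF compact_sphere gS, of "1 / real (Suc n)"])
      fix p assume "real_polynomial_function p" "\<And>x. x \<in> ?S \<Longrightarrow> \<bar>g x - p x\<bar> < 1 / real (Suc n)"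
      then show ?thesis by (intro exI[of _ p] conjI ballI)
    qed simp
    then obtain p where p: "\<And>n. real_polynomial_function (p n)"
        "\<And>n x. x \<in> ?S \<Longrightarrow> \<bar>g x - p n x\<bar> < 1 / real (Suc n)"
      by metis
    have "compact (g ` ?S)" by (intro compact_continuous_image gS compact_sphere)
    then obtain B where B: "\<And>x. x \<in> ?S \<Longrightarrow> \<bar>g x\<bar> \<le> B"
      using compact_imp_bounded bounded_iff by (metis imageI real_norm_def)
    show ?thesis
    \<comment> \<open>The approximation errors are at most 1 on the circle, whence the common bound
      \<open>B + 1\<close>.\<close>
    proof (rule Mult_lim[of "\<lambda>n w. complex_of_real (p n (w i))" "B + 1"])
      show "Mult (\<lambda>w. complex_of_real (p n (w i)))" for n by (intro Mult_poly p)
      fix w assume "w \<in> space torus"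
      then have w: "w i \<in> ?S" using torus_coordinate[of w i] by simp
      show "cmod (complex_of_real (p n (w i))) \<le> B + 1" for n
      proof -
        have "1 / real (Suc n) \<le> 1" by simp
        then have "\<bar>p n (w i)\<bar> \<le> B + 1" using p(2)[OF w, of n] B[OF w] by linarith
        then show ?thesis by simp
      qed
      have "(\<lambda>n. g (w i) - p n (w i)) \<longlonglongrightarrow> 0"
        by (rule Lim_null_comparison[OF _ LIMSEQ_inverse_real_of_nat])
          (use p(2)[OF w] in \<open>auto intro!: always_eventually less_imp_le simp: inverse_eq_divide\<close>)
      from tendsto_diff[OF tendsto_const[of "g (w i)"] this]
      show "(\<lambda>n. complex_of_real (p n (w i))) \<longlonglongrightarrow> complex_of_real (g (w i))"
        by (intro tendsto_of_real) simp
    qed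
  qed
  define \<Sigma> where "\<Sigma> = {E \<in> sets torus. Mult (indicator E)}"
  have sig: "sigma_algebra (space torus) \<Sigma>"
  proof (rule sigma_algebra_iff2[THEN iffD2], intro conjI ballI allI impI)
    show "\<Sigma> \<subseteq> Pow (space torus)" using sets.sets_into_space by (auto simp: \<Sigma>_def)
    show "{} \<in> \<Sigma>" using Mult_const[of 0] by (simp add: \<Sigma>_def indicator_def[abs_def])
    show compl: "space torus - E \<in> \<Sigma>" if "E \<in> \<Sigma>" for E
    proof -
      have "Mult (\<lambda>w. 1 + (- 1) * indicator E w)"
        using that by (intro Mult_add Mult_mult Mult_const) (simp add: \<Sigma>_def)
      then have "Mult (indicator (space torus - E))"
        by (rule Mult_cong[rotated]) (auto simp: indicator_def)
      then show ?thesis using that by (auto simp: \<Sigma>_def)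
    qed
    fix A :: "nat \<Rightarrow> (nat \<Rightarrow> complex) set" assume A: "range A \<subseteq> \<Sigma>"
    \<comment> \<open>The indicator of the complement of a finite partial union. As a product of
      multipliers it is a multiplier, and the countable union is reached as a bounded limit.\<close>
    define P where "P n w = (\<Prod>k<n. 1 + (- 1) * indicator (A k) w :: complex)" for n w
    have MP: "Mult (P n)" for n
    proof (induction n)
      case (Suc n)
      have "Mult (indicator (A n))" using A by (auto simp: \<Sigma>_def)
      then have "Mult (\<lambda>w. P n w * (1 + (- 1) * indicator (A n) w))"
        by (intro Mult_mult[OF Suc.IH] Mult_add Mult_const Mult_mult)
      then show ?case by (simp add: P_def[abs_def])
    qed (use Mult_const[of 1] in \<open>simp add: P_def[abs_def]\<close>)
    have P01: "P n w = (if \<exists>k<n. w \<in> A k then 0 else 1)" for n w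
      by (auto simp: P_def prod_zero_iff indicator_def intro!: prod.neutral)
    have "Mult (indicator (\<Union>i. A i))"
    proof (rule Mult_lim[of "\<lambda>n w. 1 + (- 1) * P n w" 1])
      show "Mult (\<lambda>w. 1 + (- 1) * P n w)" for n by (intro Mult_add Mult_const Mult_mult MP)
      show "cmod (1 + (- 1) * P n w) \<le> 1" for n w by (simp add: P01)
      fix w
      show "(\<lambda>n. 1 + (- 1) * P n w) \<longlonglongrightarrow> indicator (\<Union>i. A i) w"
      proof (cases "\<exists>k. w \<in> A k")
        case True
        then obtain k where "w \<in> A k" by auto
        then have "eventually (\<lambda>n. 1 + (- 1) * P n w = indicator (\<Union>i. A i) w) sequentially"
          by (intro eventually_sequentiallyI[of "Suc k"]) (auto simp: P01 indicator_def)
        then show ?thesis by (rule tendsto_eventually)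
      qed (auto simp: P01 indicator_def)
    qed
    moreover have "(\<Union>i. A i) \<in> sets torus" using A by (auto simp: \<Sigma>_def)
    ultimately show "(\<Union>i. A i) \<in> \<Sigma>" by (simp add: \<Sigma>_def)
  qed
  have open_cyl: "{w \<in> space torus. w i \<in> U} \<in> \<Sigma>" if U: "open U" for U i
  proof -
    \<comment> \<open>Continuous functions tending pointwise to the indicator of \<open>U\<close>.
      The whole plane is treated apart because \<open>infdist\<close> to the empty set is 0 by
      convention.\<close>
    define g where "g n z = (if U = UNIV then 1 else min 1 (real n * infdist z (- U)))" for n z
    have gc: "continuous_on UNIV (g n)" for n
      unfolding g_def by (cases "U = UNIV") (auto intro!: continuous_intros)
    have g01: "0 \<le> g n z" "g n z \<le> 1" for n z by (auto simp: g_def infdist_nonneg)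
    have "(\<lambda>n. g n z) \<longlonglongrightarrow> indicator U z" for z
    proof (cases "z \<in> U")
      case True
      show ?thesis
      proof (cases "U = UNIV")
        case False
        then have ne: "- U \<noteq> {}" by auto
        have "closed (- U)" using U by (simp add: closed_Compl)
        then have pos: "infdist z (- U) > 0"
          using ne True in_closed_iff_infdist_zero[of "- U" z] infdist_nonneg[of z "- U"] by (auto simp: less_le)
        then obtain n0 where n0: "1 < real n0 * infdist z (- U)"
          using ex_less_of_nat_mult by blast
        have "g n z = indicator U z" if "n \<ge> n0" for n
        proof -
          have "real n0 * infdist z (- U) \<le> real n * infdist z (- U)"
            using that pos by (intro mult_right_mono) auto
          then show ?thesis using n0 True False by (simp add: g_def)
        qed
        then show ?thesis by (intro tendsto_eventually eventually_sequentiallyI)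
      qed (simp add: g_def)
    next
      case False
      then have "infdist z (- U) = 0" by simp
      then have "g n z = 0" for n using False by (auto simp: g_def)
      then show ?thesis using False by simp
    qed
    note glim = this
    have "Mult (\<lambda>w. complex_of_real (indicator U (w i)))"
    proof (rule Mult_lim[of "\<lambda>n w. complex_of_real (g n (w i))" 1])
      show "Mult (\<lambda>w. complex_of_real (g n (w i)))" for n by (intro Mult_cont gc)
      show "cmod (complex_of_real (g n (w i))) \<le> 1" for n w using g01[of n "w i"] by simp
      show "(\<lambda>n. complex_of_real (g n (w i))) \<longlonglongrightarrow> complex_of_real (indicator U (w i))" for w
        by (intro tendsto_of_real glim)
    qed
    then have "Mult (indicator {w \<in> space torus. w i \<in> U})"
      by (rule Mult_cong[rotated]) (auto simp: indicator_def)
    moreover have "{w \<in> space torus. w i \<in> U} \<in> sets torus"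
      using measurable_sets[OF torus_coordinate_measurable, of U i] U by (simp add: vimage_def Int_def conj_commute)
    ultimately show ?thesis by (simp add: \<Sigma>_def)
  qed
  interpret S: sigma_algebra "space torus" \<Sigma> by (rule sig)
  have setsS: "sets (measure_of (space torus) \<Sigma> (\<lambda>_. 0)) = \<Sigma>" "space (measure_of (space torus) \<Sigma> (\<lambda>_. 0)) = space torus"
    by (simp_all add: S.sets_measure_of_eq S.space_closed space_measure_of_conv)
  have "sets torus \<subseteq> \<Sigma>"
  proof -
    have cyl: "{w \<in> space torus. w i \<in> A} \<in> \<Sigma>" if "A \<in> sets circle_measure" for A i
    proof -
      have m: "(\<lambda>w. w i) \<in> borel_measurable (measure_of (space torus) \<Sigma> (\<lambda>_. 0))"
        by (rule borel_measurableI) (use open_cyl[of _ i] in \<open>simp add: setsS vimage_def Int_def conj_commute\<close>)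
      have "A \<in> sets borel" using that by (auto simp: sets_circle sets_restrict_space)
      from measurable_sets[OF m this] have "(\<lambda>w. w i) -` A \<inter> space torus \<in> \<Sigma>"
        unfolding setsS .
      then show ?thesis by (simp add: vimage_def Int_def conj_commute)
    qed
    have "sets torus = sigma_sets (space torus) {{f \<in> space torus. f i \<in> A} | i A. i \<in> UNIV \<and> A \<in> sets circle_measure}"
      unfolding torus_def by (simp add: sets_PiM_single space_PiM)
    also have "\<dots> \<subseteq> \<Sigma>" using cyl by (intro S.sigma_sets_subset) auto
    finally show ?thesis .
  qed
  \<comment> \<open>The hypothesis enters here, with the index negated since a Fourier coefficient
    integrates against the inverse monomial.\<close>
  moreover have "N (\<lambda>_. 1)"
  proof -
    have "L (\<lambda>w. 1 * tmono \<beta> w) = 0" if "\<beta> \<in> int_multiindices" for \<beta>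
    proof -
      have "(\<lambda>i. - \<beta> i) \<in> int_multiindices" using that by (simp add: int_multiindices_def)
      from 0[OF this] show ?thesis by (simp add: torus_coeff_tmono L_def)
    qed
    then show ?thesis using bm_const by (simp add: N_def)
  qed
  ultimately have "N (\<lambda>w. indicator E w * 1)" if "E \<in> sets torus" for E
    using that unfolding \<Sigma>_def Mult_def by blast
  then have "L (\<lambda>w. indicator E w * 1 * tmono (\<lambda>_. 0) w) = 0" if "E \<in> sets torus" for E
    using that unfolding N_def by (auto simp: int_multiindices_def)
  then have "strong_integral torus (\<lambda>w. indicator E w *\<^sub>C F w) = 0" if "E \<in> sets torus" for E
    using that by (simp add: L_def tmono_def)
  then show ?thesis by (rule integral_norm_eq_0[OF F])
qed

section \<open>Dirichlet series and the torus\<close>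

text \<open>Ensures that the norm of a Dirichlet series does not depend on the preimage under the
  Bohr transform.\<close>

lemma Lp_norm_cong_coeff:
  fixes f g :: "(nat \<Rightarrow> complex) \<Rightarrow> 'a::complex_banach"
  assumes f: "f \<in> Lp torus p" and g: "g \<in> Lp torus p" and p: "p \<ge> 1"
    and eq: "\<And>\<alpha>. \<alpha> \<in> int_multiindices \<Longrightarrow> torus_coeff f \<alpha> = torus_coeff g \<alpha>"
  shows "Lp_norm torus p f = Lp_norm torus p g"
proof -
  interpret prob_space torus by (rule prob_space_torus)
  have b: "bochner torus f" "bochner torus g" using Lp_bochner(1) f g p by blast+
  have bd: "bochner torus (\<lambda>w. f w - g w)" by (rule bochner_diff[OF b])
  have "torus_coeff (\<lambda>w. f w - g w) \<alpha> = 0" if "\<alpha> \<in> int_multiindices" for \<alpha>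
  proof -
    have "torus_coeff (\<lambda>w. f w - g w) \<alpha> = torus_coeff f \<alpha> - torus_coeff g \<alpha>"
      unfolding torus_coeff_tmono scaleC_diff_right
      by (intro strong_integral_diff bochner_tmono b)
    then show ?thesis using eq[OF that] by simp
  qed
  then have "(\<integral>w. norm (f w - g w) \<partial>torus) = 0" by (rule torus_coeff_unique[OF bd])
  then have "AE w in torus. norm (f w - g w) = 0"
    using bd by (subst (asm) integral_nonneg_eq_0_iff_AE) (auto simp: bochner_def)
  then have "AE w in torus. norm (f w) powr p = norm (g w) powr p"
    by eventually_elim simp
  moreover have "(\<lambda>w. norm (f w) powr p) \<in> borel_measurable torus" "(\<lambda>w. norm (g w) powr p) \<in> borel_measurable torus"
    using f g by (auto simp: Lp_def)
  ultimately have "(\<integral>w. norm (f w) powr p \<partial>torus) = (\<integral>w. norm (g w) powr p \<partial>torus)"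
    by (intro integral_cong_AE)
  then show ?thesis by (simp add: Lp_norm_def)
qed

definition prime_exponents :: "nat \<Rightarrow> nat \<Rightarrow> int" where
  "prime_exponents n i = int (multiplicity (enumerate {p::nat. prime p} i) n)"

lemma nth_prime:
  "prime (enumerate {p::nat. prime p} i)" "inj (enumerate {p::nat. prime p})"
  "prime q \<Longrightarrow> \<exists>i. enumerate {p::nat. prime p} i = q"
  using enumerate_in_set[OF primes_infinite, of i] inj_enumerate[OF primes_infinite]
    enumerate_Ex[of "{p::nat. prime p}" q] primes_infinite by auto

lemma prime_exponents_support:
  assumes "n > 0"
  shows "enumerate {p::nat. prime p} ` {i. prime_exponents n i \<noteq> 0} = prime_factors n"
proof -
  have "prime_exponents n i \<noteq> 0 \<longleftrightarrow> enumerate {p::nat. prime p} i \<in> prime_factors n" for i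
    using nth_prime(1)[of i] assms by (auto simp: prime_exponents_def prime_factors_multiplicity)
  moreover have "q \<in> range (enumerate {p::nat. prime p})" if "q \<in> prime_factors n" for q
  proof -
    have "prime q" using that by auto
    then show ?thesis using nth_prime(3) by blast
  qed
  ultimately show ?thesis by blast
qed

text \<open>Unique factorisation, in the form that transports infinite sums between the two index
  sets.\<close>

lemma prime_exponents_bij: "bij_betw prime_exponents {1..} nonneg_multiindices"
  unfolding bij_betw_def
proof (intro conjI inj_onI equalityI subsetI)
  fix m n :: nat assume mn: "m \<in> {1..}" "n \<in> {1..}" "prime_exponents m = prime_exponents n"
  show "m = n"
  proof (rule multiplicity_eq_nat)
    fix q :: nat assume "prime q"
    then obtain i where "enumerate {p::nat. prime p} i = q" using nth_prime(3) by blast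
    then show "multiplicity q m = multiplicity q n"
      using fun_cong[OF mn(3), of i] by (simp add: prime_exponents_def)
  qed (use mn in auto)
next
  fix \<alpha> assume "\<alpha> \<in> prime_exponents ` {1..}"
  then obtain n where n: "n > 0" "\<alpha> = prime_exponents n" by (auto simp: Suc_le_eq)
  have "finite (enumerate {p::nat. prime p} ` {i. prime_exponents n i \<noteq> 0})"
    unfolding prime_exponents_support[OF n(1)] by simp
  then have "finite {i. prime_exponents n i \<noteq> 0}"
    by (rule finite_imageD) (rule inj_on_subset[OF nth_prime(2)], simp)
  then show "\<alpha> \<in> nonneg_multiindices"
    unfolding n(2) by (simp add: nonneg_multiindices_def int_multiindices_def) (simp add: prime_exponents_def)
next
  fix \<alpha> assume \<alpha>: "\<alpha> \<in> nonneg_multiindices"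
  let ?e = "enumerate {p::nat. prime p}"
  define S where "S = ?e ` {i. \<alpha> i \<noteq> 0}"
  define f where "f q = nat (\<alpha> (inv ?e q))" for q
  define n where "n = (\<Prod>q\<in>S. q ^ f q)"
  have S: "finite S" "\<And>q. q \<in> S \<Longrightarrow> prime q"
    using \<alpha> nth_prime(1) by (auto simp: S_def nonneg_multiindices_def int_multiindices_def)
  have "n \<noteq> 0" unfolding n_def using S(1) S(2)[of 0] by (auto simp: prod_zero_iff)
  moreover have "prime_exponents n i = \<alpha> i" for i
  proof -
    have "multiplicity (?e i) n = (if ?e i \<in> S then f (?e i) else 0)"
      unfolding n_def by (rule multiplicity_prod_prime_powers[OF S nth_prime(1)])
    moreover have "?e i \<in> S \<longleftrightarrow> \<alpha> i \<noteq> 0" using nth_prime(2) by (auto simp: S_def inj_def)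
    moreover have "f (?e i) = nat (\<alpha> i)" using nth_prime(2) by (simp add: f_def)
    moreover have "\<alpha> i \<ge> 0" using \<alpha> by (simp add: nonneg_multiindices_def)
    ultimately show ?thesis by (simp add: prime_exponents_def)
  qed
  ultimately show "\<alpha> \<in> prime_exponents ` {1..}"
    by (intro image_eqI[of _ _ n]) auto
qed

lemma multiindex_size_prime_exponents:
  assumes "n > 0"
  shows "multiindex_size (prime_exponents n) = int (big_omega n)"
proof -
  have "big_omega n = (\<Sum>q\<in>prime_factors n. multiplicity q n)"
    unfolding big_omega_def size_multiset_overloaded_eq
    by (intro sum.cong) (auto simp: count_prime_factorization)
  also have "\<dots> = (\<Sum>i | prime_exponents n i \<noteq> 0. multiplicity (enumerate {p::nat. prime p} i) n)"
    unfolding prime_exponents_support[OF assms, symmetric]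
    by (rule sum.reindex[unfolded o_def]) (rule inj_on_subset[OF nth_prime(2)], simp)
  finally show ?thesis by (simp add: multiindex_size_def prime_exponents_def)
qed

lemma bohr_transform_prime_exponents: "n > 0 \<Longrightarrow> bohr_transform f n = torus_coeff f (prime_exponents n)"
  by (simp add: bohr_transform_def prime_exponents_def[abs_def])

text \<open>The chosen preimage and \<open>f\<close> agree at nonnegative multiindices because every
  one of them is the exponent sequence of some \<open>n\<close>, and at the other multiindices both
  coefficients vanish.\<close>

lemma dirichlet_norm_bohr_transform:
  fixes f :: "(nat \<Rightarrow> complex) \<Rightarrow> 'a::complex_banach"
  assumes f: "f \<in> torus_Hp p" and p: "p \<ge> 1"
  shows "dirichlet_norm p (bohr_transform f) = Lp_norm torus p f"
proof -
  define g where "g = inv_into (torus_Hp p) bohr_transform (bohr_transform f)"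
  have g: "g \<in> torus_Hp p" unfolding g_def by (rule inv_into_into[OF imageI[OF f]])
  have gf: "bohr_transform g = bohr_transform f" unfolding g_def by (rule f_inv_into_f[OF imageI[OF f]])
  have "torus_coeff g \<alpha> = torus_coeff f \<alpha>" if "\<alpha> \<in> int_multiindices" for \<alpha>
  proof (cases "\<alpha> \<in> nonneg_multiindices")
    case True
    then obtain n where "n \<ge> 1" "\<alpha> = prime_exponents n"
      using prime_exponents_bij by (auto simp: bij_betw_def)
    then show ?thesis
      using fun_cong[OF gf, of n] by (simp add: bohr_transform_prime_exponents)
  next
    case False
    then show ?thesis using f g that by (auto simp: torus_Hp_def)
  qed
  then show ?thesis
    unfolding dirichlet_norm_def g_def[symmetric]
    by (intro Lp_norm_cong_coeff p) (use f g in \<open>auto simp: torus_Hp_def\<close>)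
qed

lemma dirichlet_inequality_iff_torus_inequality:
  assumes p: "p \<ge> 1"
  shows "dirichlet_inequality TYPE('a::complex_banach) q p \<longleftrightarrow> torus_inequality TYPE('a) q p"
proof -
  have eq: "r ^ big_omega n * norm (bohr_transform f n) powr q
      = r powi multiindex_size (prime_exponents n) * norm (torus_coeff f (prime_exponents n)) powr q"
    if "n \<in> {1..}" for r and f :: "(nat \<Rightarrow> complex) \<Rightarrow> 'a" and n
    using that by (simp add: bohr_transform_prime_exponents multiindex_size_prime_exponents)
  have "((\<lambda>n. r ^ big_omega n * norm (bohr_transform f n) powr q) summable_on {1..}
      \<and> (\<Sum>\<^sub>\<infinity>n\<in>{1..}. r ^ big_omega n * norm (bohr_transform f n) powr q) powr (1 / q)
          \<le> C * dirichlet_norm p (bohr_transform f)) \<longleftrightarrow>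
    ((\<lambda>\<alpha>. r powi multiindex_size \<alpha> * norm (torus_coeff f \<alpha>) powr q) summable_on nonneg_multiindices
      \<and> (\<Sum>\<^sub>\<infinity>\<alpha>\<in>nonneg_multiindices. r powi multiindex_size \<alpha> * norm (torus_coeff f \<alpha>) powr q) powr (1 / q)
          \<le> C * Lp_norm torus p f)"
    if f: "f \<in> torus_Hp p" for r C and f :: "(nat \<Rightarrow> complex) \<Rightarrow> 'a"
  proof -
    let ?G = "\<lambda>\<alpha>. r powi multiindex_size \<alpha> * norm (torus_coeff f \<alpha>) powr q"
    have "(\<lambda>n. r ^ big_omega n * norm (bohr_transform f n) powr q) summable_on {1..}
        \<longleftrightarrow> ?G summable_on nonneg_multiindices"
      unfolding summable_on_reindex_bij_betw[OF prime_exponents_bij, of ?G, symmetric]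
      by (rule summable_on_cong) (rule eq)
    moreover have "(\<Sum>\<^sub>\<infinity>n\<in>{1..}. r ^ big_omega n * norm (bohr_transform f n) powr q)
        = infsum ?G nonneg_multiindices"
      unfolding infsum_reindex_bij_betw[OF prime_exponents_bij, of ?G, symmetric]
      by (rule infsum_cong) (rule eq)
    ultimately show ?thesis
      unfolding dirichlet_norm_bohr_transform[OF f p] by (simp only:)
  qed
  then show ?thesis
    unfolding dirichlet_inequality_def torus_inequality_def dirichlet_Hp_def ball_simps by (simp cong: ball_cong)
qed

section \<open>Cotype and Rademacher averages\<close>

text \<open>The weakest average, with exponent 1, is on the right; Kahane's inequality makes this no
  restriction. Arbitrary finite index sets are allowed because the inequality is applied to random
  sets of variables.\<close>

definition rademacher_cotype :: "'a::complex_banach itself \<Rightarrow> real \<Rightarrow> bool" where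
  "rademacher_cotype X q \<longleftrightarrow> (\<exists>C\<ge>1. \<forall>I (x :: nat \<Rightarrow> 'a). finite I \<longrightarrow>
     (\<Sum>j\<in>I. norm (x j) powr q) powr (1 / q)
       \<le> C * avg (signs I) (\<lambda>\<epsilon>. norm (\<Sum>j\<in>I. \<epsilon> j *\<^sub>R x j)))"

text \<open>Cotype is formulated for initial segments of the natural numbers; this transfers it to
  any finite index set.\<close>

lemma avg_signs_reindex:
  assumes h: "bij_betw h J I"
  shows "avg (signs J) (\<lambda>\<epsilon>. norm (\<Sum>j\<in>J. \<epsilon> j *\<^sub>R x (h j)) powr p)
    = avg (signs I) (\<lambda>\<epsilon>. norm (\<Sum>i\<in>I. \<epsilon> i *\<^sub>R x i) powr p)"
proof -
  define k where "k = the_inv_into J h"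
  have kh: "k (h j) = j" if "j \<in> J" for j
    using h that by (simp add: k_def the_inv_into_f_f bij_betw_def)
  have hk: "h (k i) = i" "k i \<in> J" if "i \<in> I" for i
    using h that by (auto simp: k_def f_the_inv_into_f_bij_betw bij_betw_def intro: the_inv_into_into)
  have hI: "h j \<in> I" if "j \<in> J" for j using h that by (auto simp: bij_betw_def)
  have "bij_betw (\<lambda>\<epsilon>. \<lambda>j\<in>J. \<epsilon> (h j)) (signs I) (signs J)"
  proof (rule bij_betw_byWitness[where f'="\<lambda>\<epsilon>. \<lambda>i\<in>I. \<epsilon> (k i)"])
    show "\<forall>\<epsilon>\<in>signs I. (\<lambda>i\<in>I. (\<lambda>j\<in>J. \<epsilon> (h j)) (k i)) = \<epsilon>"
    proof (intro ballI ext)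
      fix \<epsilon> i assume "\<epsilon> \<in> signs I"
      then show "(\<lambda>i\<in>I. (\<lambda>j\<in>J. \<epsilon> (h j)) (k i)) i = \<epsilon> i" using hk PiE_arb[of \<epsilon> I _ i] by simp
    qed
    show "\<forall>\<epsilon>\<in>signs J. (\<lambda>j\<in>J. (\<lambda>i\<in>I. \<epsilon> (k i)) (h j)) = \<epsilon>"
    proof (intro ballI ext)
      fix \<epsilon> i assume "\<epsilon> \<in> signs J"
      then show "(\<lambda>j\<in>J. (\<lambda>i\<in>I. \<epsilon> (k i)) (h j)) i = \<epsilon> i" using kh hI PiE_arb[of \<epsilon> J _ i] by simp
    qed
    have "\<epsilon> (h j) \<in> {-1, 1}" if "\<epsilon> \<in> signs I" "j \<in> J" for \<epsilon> j using PiE_mem[OF that(1) hI[OF that(2)]] .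
    then show "(\<lambda>\<epsilon>. \<lambda>j\<in>J. \<epsilon> (h j)) ` signs I \<subseteq> signs J"
      by (simp only: image_subset_iff restrict_PiE_iff) blast
    have "\<epsilon> (k j) \<in> {-1, 1}" if "\<epsilon> \<in> signs J" "j \<in> I" for \<epsilon> j using PiE_mem[OF that(1) hk(2)[OF that(2)]] .
    then show "(\<lambda>\<epsilon>. \<lambda>i\<in>I. \<epsilon> (k i)) ` signs J \<subseteq> signs I"
      by (simp only: image_subset_iff restrict_PiE_iff) blast
  qed
  then have "avg (signs J) (\<lambda>\<epsilon>. norm (\<Sum>j\<in>J. \<epsilon> j *\<^sub>R x (h j)) powr p)
      = avg (signs I) (\<lambda>\<epsilon>. norm (\<Sum>j\<in>J. (\<lambda>j\<in>J. \<epsilon> (h j)) j *\<^sub>R x (h j)) powr p)"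
    by (rule avg_reindex[symmetric])
  also have "(\<lambda>\<epsilon>::nat \<Rightarrow> real. \<Sum>j\<in>J. (\<lambda>j\<in>J. \<epsilon> (h j)) j *\<^sub>R x (h j)) = (\<lambda>\<epsilon>. \<Sum>i\<in>I. \<epsilon> i *\<^sub>R x i)"
  proof
    fix \<epsilon> :: "nat \<Rightarrow> real"
    have "(\<Sum>j\<in>J. (\<lambda>j\<in>J. \<epsilon> (h j)) j *\<^sub>R x (h j)) = (\<Sum>j\<in>J. \<epsilon> (h j) *\<^sub>R x (h j))" by simp
    also have "\<dots> = (\<Sum>i\<in>I. \<epsilon> i *\<^sub>R x i)" by (rule sum.reindex_bij_betw[OF h])
    finally show "(\<Sum>j\<in>J. (\<lambda>j\<in>J. \<epsilon> (h j)) j *\<^sub>R x (h j)) = (\<Sum>i\<in>I. \<epsilon> i *\<^sub>R x i)" .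
  qed
  finally show ?thesis by (simp add: fun_eq_iff)
qed

lemma cotype_imp_rademacher_cotype:
  assumes q: "q \<ge> 1" and ct: "cotype TYPE('a::complex_banach) q"
  shows "rademacher_cotype TYPE('a) q"
proof -
  obtain C where C: "C \<ge> 1" and ineq: "\<And>(N::nat) (x::nat \<Rightarrow> 'a).
     (\<Sum>n=1..N. norm (x n) powr q) powr (1 / q)
       \<le> C * (\<integral>z. norm (\<Sum>n=1..N. z n *\<^sub>C x n) powr q \<partial>(Pi\<^sub>M {1..N} (\<lambda>_. circle_measure))) powr (1 / q)"
    using ct unfolding cotype_def by blast
  have "q > 0" using q by simp
  from kahane[OF this, where 'a='a] obtain K where K: "K \<ge> 1" and kah: "\<And>I (x :: nat \<Rightarrow> 'a). finite I \<Longrightarrow>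
    (avg (signs I) (\<lambda>\<epsilon>. norm (\<Sum>j\<in>I. \<epsilon> j *\<^sub>R x j) powr q)) powr (1 / q)
      \<le> K * avg (signs I) (\<lambda>\<epsilon>. norm (\<Sum>j\<in>I. \<epsilon> j *\<^sub>R x j))" by blast
  have "(\<Sum>j\<in>I. norm (x j) powr q) powr (1 / q)
       \<le> (2 * C * K) * avg (signs I) (\<lambda>\<epsilon>. norm (\<Sum>j\<in>I. \<epsilon> j *\<^sub>R x j))" if I: "finite I" for I and x :: "nat \<Rightarrow> 'a"
  proof -
    obtain h where h: "bij_betw h {1..card I} I" using ex_bij_betw_nat_finite_1[OF I] by blast
    let ?N = "card I"
    let ?S = "\<integral>z. norm (\<Sum>n=1..?N. z n *\<^sub>C x (h n)) powr q \<partial>(Pi\<^sub>M {1..?N} (\<lambda>_. circle_measure))"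
    let ?R = "avg (signs I) (\<lambda>\<epsilon>. norm (\<Sum>j\<in>I. \<epsilon> j *\<^sub>R x j) powr q)"
    have "?S \<le> 2 powr q * avg (signs {1..?N}) (\<lambda>\<epsilon>. norm (\<Sum>n=1..?N. \<epsilon> n *\<^sub>R x (h n)) powr q)"
      by (rule steinhaus_rademacher(1)) (use q in auto)
    also have "\<dots> = 2 powr q * ?R" by (simp only: avg_signs_reindex[OF h])
    finally have "?S powr (1 / q) \<le> (2 powr q * ?R) powr (1 / q)"
      using q by (intro powr_mono2) (auto intro: Bochner_Integration.integral_nonneg)
    also have "\<dots> = 2 * ?R powr (1 / q)" using q by (simp add: powr_mult powr_powr avg_nonneg)
    also have "\<dots> \<le> 2 * (K * avg (signs I) (\<lambda>\<epsilon>. norm (\<Sum>j\<in>I. \<epsilon> j *\<^sub>R x j)))"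
      using kah[OF I] by (intro mult_left_mono) auto
    finally have S: "?S powr (1 / q) \<le> 2 * (K * avg (signs I) (\<lambda>\<epsilon>. norm (\<Sum>j\<in>I. \<epsilon> j *\<^sub>R x j)))" .
    have "(\<Sum>j\<in>I. norm (x j) powr q) powr (1 / q) = (\<Sum>n=1..?N. norm (x (h n)) powr q) powr (1 / q)"
      by (simp only: sum.reindex_bij_betw[OF h, of "\<lambda>j. norm (x j) powr q"])
    also have "\<dots> \<le> C * ?S powr (1 / q)" by (rule ineq)
    also have "\<dots> \<le> C * (2 * (K * avg (signs I) (\<lambda>\<epsilon>. norm (\<Sum>j\<in>I. \<epsilon> j *\<^sub>R x j))))"
      using S C by (intro mult_left_mono) auto
    finally show ?thesis by (simp add: mult_ac)
  qed
  moreover have "1 * (1 * 1) \<le> 2 * (C * K)" using C K by (intro mult_mono) auto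
  then have "2 * C * K \<ge> 1" by (simp add: mult.assoc)
  ultimately show ?thesis unfolding rademacher_cotype_def by blast
qed

text \<open>The exponent \<open>p\<close> on the right is unrelated to \<open>q\<close>, since
  testing a coefficient inequality produces an Lp average. Kahane's inequality brings it down to
  exponent 1, and monotonicity takes that to \<open>q\<close>.\<close>

lemma cotype_if_rademacher_Lp:
  assumes q: "q \<ge> 1" and p: "p \<ge> 1" and C: "C \<ge> 0"
    and ineq: "\<And>I (x :: nat \<Rightarrow> 'a::complex_banach). finite I \<Longrightarrow> (\<Sum>j\<in>I. norm (x j) powr q) powr (1 / q)
       \<le> C * (avg (signs I) (\<lambda>\<epsilon>. norm (\<Sum>j\<in>I. \<epsilon> j *\<^sub>R x j) powr p)) powr (1 / p)"
  shows "cotype TYPE('a) q"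
proof -
  have "p > 0" using p by simp
  from kahane[OF this, where 'a='a] obtain K where K: "K \<ge> 1" and kah: "\<And>I (x :: nat \<Rightarrow> 'a). finite I \<Longrightarrow>
    (avg (signs I) (\<lambda>\<epsilon>. norm (\<Sum>j\<in>I. \<epsilon> j *\<^sub>R x j) powr p)) powr (1 / p)
      \<le> K * avg (signs I) (\<lambda>\<epsilon>. norm (\<Sum>j\<in>I. \<epsilon> j *\<^sub>R x j))" by blast
  \<comment> \<open>\<open>K\<close> is the price of Kahane's inequality and 2 that of replacing
    signs by variables on the circle; the maximum provides \<open>D \<ge> 1\<close>.\<close>
  define D where "D = max 1 (C * K * 2)"
  have "(\<Sum>n=1..N. norm (x n) powr q) powr (1 / q)
       \<le> D * (\<integral>z. norm (\<Sum>n=1..N. z n *\<^sub>C x n) powr q \<partial>(Pi\<^sub>M {1..N} (\<lambda>_. circle_measure))) powr (1 / q)"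
    for N and x :: "nat \<Rightarrow> 'a"
  proof -
    let ?I = "{1..N}"
    let ?S = "\<integral>z. norm (\<Sum>n\<in>?I. z n *\<^sub>C x n) powr q \<partial>(Pi\<^sub>M {1..N} (\<lambda>_. circle_measure))"
    let ?R = "avg (signs ?I) (\<lambda>\<epsilon>. norm (\<Sum>j\<in>?I. \<epsilon> j *\<^sub>R x j) powr q)"
    have S0: "?S \<ge> 0" by (intro Bochner_Integration.integral_nonneg) auto
    have "avg (signs ?I) (\<lambda>\<epsilon>. norm (\<Sum>j\<in>?I. \<epsilon> j *\<^sub>R x j) powr 1) powr (1 / 1) \<le> ?R powr (1 / q)"
      using q by (intro avg_powr_mono_exponent) (auto simp: signs_finite_nonempty)
    then have 1: "avg (signs ?I) (\<lambda>\<epsilon>. norm (\<Sum>j\<in>?I. \<epsilon> j *\<^sub>R x j)) \<le> ?R powr (1 / q)"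
      by (simp add: avg_nonneg)
    have "?R \<le> 2 powr q * ?S" by (rule steinhaus_rademacher(2)) (use q in auto)
    then have "?R powr (1 / q) \<le> (2 powr q * ?S) powr (1 / q)"
      using q by (intro powr_mono2 avg_nonneg) auto
    also have "\<dots> = 2 * ?S powr (1 / q)" using q S0 by (simp add: powr_mult powr_powr)
    finally have 2: "?R powr (1 / q) \<le> 2 * ?S powr (1 / q)" .
    have "(\<Sum>n\<in>?I. norm (x n) powr q) powr (1 / q) \<le> C * (K * (2 * ?S powr (1 / q)))"
    proof (rule order_trans[OF ineq mult_left_mono[OF _ C]])
      show "(avg (signs ?I) (\<lambda>\<epsilon>. norm (\<Sum>j\<in>?I. \<epsilon> j *\<^sub>R x j) powr p)) powr (1 / p) \<le> K * (2 * ?S powr (1 / q))"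
        by (rule order_trans[OF kah mult_left_mono]) (use 1 2 K in auto)
    qed simp
    also have "\<dots> = (C * K * 2) * ?S powr (1 / q)" by simp
    also have "\<dots> \<le> D * ?S powr (1 / q)" unfolding D_def by (intro mult_right_mono) auto
    finally show ?thesis .
  qed
  then show ?thesis unfolding cotype_def by (intro exI[of _ D]) (auto simp: D_def)
qed

section \<open>Necessity of cotype\<close>

lemma torus_coeff_linear:
  fixes x :: "nat \<Rightarrow> 'a::complex_banach"
  assumes J: "finite J" and \<alpha>: "\<alpha> \<in> int_multiindices"
  shows "torus_coeff (\<lambda>z. \<Sum>j\<in>J. z j *\<^sub>C x j) \<alpha> = (\<Sum>j\<in>J. if \<alpha> = (\<lambda>i. if i = j then 1 else 0) then x j else 0)"
proof -
  interpret prob_space torus by (rule prob_space_torus)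
  define e where "e j = (\<lambda>i. if i = j then 1 else 0 :: int)" for j :: nat
  have eI: "e j \<in> int_multiindices" for j
  proof -
    have "{i. e j i \<noteq> 0} \<subseteq> {j}" by (auto simp: e_def split: if_splits)
    then show ?thesis unfolding int_multiindices_def using finite_subset by blast
  qed
  have te: "tmono (e j) z = z j" for j z
    by (subst tmono_superset[of "{j}"]) (auto simp: e_def split: if_splits)
  have m\<alpha>: "(\<lambda>i. - \<alpha> i) \<in> int_multiindices" using \<alpha> by (simp add: int_multiindices_def)
  have int: "integrable torus (tmono \<beta>)" for \<beta>
    by (rule integrable_const_bound[where B=1]) (auto simp: tmono_norm tmono_measurable)
  have "torus_coeff (\<lambda>z. \<Sum>j\<in>J. z j *\<^sub>C x j) \<alpha>
      = strong_integral torus (\<lambda>z. \<Sum>j\<in>J. tmono (\<lambda>i. - \<alpha> i + e j i) z *\<^sub>C x j)"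
    unfolding torus_coeff_tmono
  proof (rule strong_integral_cong)
    fix z assume z: "z \<in> space torus"
    show "tmono (\<lambda>i. - \<alpha> i) z *\<^sub>C (\<Sum>j\<in>J. z j *\<^sub>C x j) = (\<Sum>j\<in>J. tmono (\<lambda>i. - \<alpha> i + e j i) z *\<^sub>C x j)"
      by (simp only: tmono_add[OF z m\<alpha> eI] te scaleC_sum_right scaleC_scaleC)
  qed
  also have "\<dots> = (\<Sum>j\<in>J. strong_integral torus (\<lambda>z. tmono (\<lambda>i. - \<alpha> i + e j i) z *\<^sub>C x j))"
    by (intro strong_integral_sum bochner_scaleC_const int)
  also have "\<dots> = (\<Sum>j\<in>J. (\<integral>z. tmono (\<lambda>i. - \<alpha> i + e j i) z \<partial>torus) *\<^sub>C x j)"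
    by (intro sum.cong refl strong_integral_scaleC_const int)
  also have "\<dots> = (\<Sum>j\<in>J. if \<alpha> = e j then x j else 0)"
  proof (rule sum.cong[OF refl])
    fix j
    have "{i. - \<alpha> i + e j i \<noteq> 0} \<subseteq> {i. \<alpha> i \<noteq> 0} \<union> {i. e j i \<noteq> 0}" by auto
    then have "(\<lambda>i. - \<alpha> i + e j i) \<in> int_multiindices"
      using \<alpha> eI[of j] unfolding int_multiindices_def by (auto intro: finite_subset)
    moreover have "(\<lambda>i. - \<alpha> i + e j i) = (\<lambda>_. 0) \<longleftrightarrow> \<alpha> = e j"
      by (auto simp: fun_eq_iff)
    ultimately show "(\<integral>z. tmono (\<lambda>i. - \<alpha> i + e j i) z \<partial>torus) *\<^sub>C x j = (if \<alpha> = e j then x j else 0)"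
      by (simp add: integral_tmono)
  qed
  finally show ?thesis by (simp add: e_def)
qed

lemma torus_inequality_imp_cotype:
  assumes q: "q \<ge> 1" and p: "p \<ge> 1" and ti: "torus_inequality TYPE('a::complex_banach) q p"
  shows "cotype TYPE('a) q"
proof -
  obtain C r where C: "C \<ge> 1" and r: "0 < r" "r < 1" and
    sm: "\<And>f :: (nat \<Rightarrow> complex) \<Rightarrow> 'a. f \<in> torus_Hp p \<Longrightarrow>
      (\<lambda>\<alpha>. r powi multiindex_size \<alpha> * norm (torus_coeff f \<alpha>) powr q) summable_on nonneg_multiindices" and
    ineq: "\<And>f :: (nat \<Rightarrow> complex) \<Rightarrow> 'a. f \<in> torus_Hp p \<Longrightarrow>
      (\<Sum>\<^sub>\<infinity>\<alpha>\<in>nonneg_multiindices. r powi multiindex_size \<alpha> * norm (torus_coeff f \<alpha>) powr q) powr (1 / q)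
          \<le> C * Lp_norm torus p f"
    using ti unfolding torus_inequality_def by blast
  \<comment> \<open>A linear function has coefficients of degree one only, so the weight is a single
    factor \<open>r\<close>; the 2 comes from passing from the torus to signs.\<close>
  define D where "D = (1 / r) powr (1 / q) * C * 2"
  show ?thesis
  proof (rule cotype_if_rademacher_Lp[OF q p, of D])
    show "D \<ge> 0" using C r by (simp add: D_def)
    fix J :: "nat set" and x :: "nat \<Rightarrow> 'a" assume J: "finite J"
    define f where "f = (\<lambda>z. \<Sum>j\<in>J. z j *\<^sub>C x j)"
    define e where "e j = (\<lambda>i. if i = j then 1 else 0 :: int)" for j :: nat
    have einj: "inj e" by (auto simp: inj_def e_def fun_eq_iff split: if_splits)
    have supp: "{i. e j i \<noteq> 0} = {j}" for j by (auto simp: e_def split: if_splits)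
    have eN: "e j \<in> nonneg_multiindices" for j
      by (simp add: nonneg_multiindices_def int_multiindices_def supp) (simp add: e_def)
    have esize: "multiindex_size (e j) = 1" for j by (simp add: multiindex_size_def supp) (simp add: e_def)
    have coef: "torus_coeff f \<alpha> = (\<Sum>j\<in>J. if \<alpha> = e j then x j else 0)" if "\<alpha> \<in> int_multiindices" for \<alpha>
      unfolding f_def e_def by (rule torus_coeff_linear[OF J that])
    have coefe: "torus_coeff f (e j) = x j" if "j \<in> J" for j
    proof -
      have "torus_coeff f (e j) = (\<Sum>k\<in>J. if e j = e k then x k else 0)"
        using eN[of j] by (intro coef) (simp add: nonneg_multiindices_def)
      also have "\<dots> = (\<Sum>k\<in>J. if k = j then x k else 0)"
        using einj by (intro sum.cong) (auto simp: inj_def)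
      finally show ?thesis using that J by simp
    qed
    have fLp: "f \<in> Lp torus p"
      unfolding f_def torus_def using p by (intro steinhaus_Lp) auto
    have f: "f \<in> torus_Hp p"
      unfolding torus_Hp_def using fLp eN by (auto simp: coef intro!: sum.neutral)
    have "(\<Sum>j\<in>J. r * norm (x j) powr q) = (\<Sum>j\<in>J. r powi multiindex_size (e j) * norm (torus_coeff f (e j)) powr q)"
      by (simp add: esize coefe)
    also have "\<dots> = (\<Sum>\<alpha>\<in>e ` J. r powi multiindex_size \<alpha> * norm (torus_coeff f \<alpha>) powr q)"
      by (subst sum.reindex) (use einj in \<open>auto simp: inj_on_def inj_def\<close>)
    also have "\<dots> \<le> (\<Sum>\<^sub>\<infinity>\<alpha>\<in>nonneg_multiindices. r powi multiindex_size \<alpha> * norm (torus_coeff f \<alpha>) powr q)"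
      using J eN r by (intro finite_sum_le_infsum sm f) auto
    finally have "(\<Sum>j\<in>J. r * norm (x j) powr q) powr (1 / q)
        \<le> (\<Sum>\<^sub>\<infinity>\<alpha>\<in>nonneg_multiindices. r powi multiindex_size \<alpha> * norm (torus_coeff f \<alpha>) powr q) powr (1 / q)"
      using q r by (intro powr_mono2) (auto intro: sum_nonneg)
    also have "\<dots> \<le> C * Lp_norm torus p f" by (rule ineq[OF f])
    finally have 1: "(\<Sum>j\<in>J. r * norm (x j) powr q) powr (1 / q) \<le> C * Lp_norm torus p f" .
    let ?R = "avg (signs J) (\<lambda>\<epsilon>. norm (\<Sum>j\<in>J. \<epsilon> j *\<^sub>R x j) powr p)"
    have "(\<integral>z. norm (f z) powr p \<partial>torus) \<le> 2 powr p * ?R"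
      unfolding f_def torus_def using J p by (intro steinhaus_rademacher(1)) auto
    then have "Lp_norm torus p f \<le> (2 powr p * ?R) powr (1 / p)"
      unfolding Lp_norm_def using p by (intro powr_mono2) (auto intro: Bochner_Integration.integral_nonneg)
    also have "\<dots> = 2 * ?R powr (1 / p)" using p by (simp add: powr_mult powr_powr avg_nonneg)
    finally have 2: "Lp_norm torus p f \<le> 2 * ?R powr (1 / p)" .
    have "(\<Sum>j\<in>J. norm (x j) powr q) powr (1 / q) = ((1 / r) * (\<Sum>j\<in>J. r * norm (x j) powr q)) powr (1 / q)"
      using r by (simp add: sum_distrib_left[symmetric])
    also have "\<dots> = (1 / r) powr (1 / q) * (\<Sum>j\<in>J. r * norm (x j) powr q) powr (1 / q)"
      by (rule powr_mult)
    also have "\<dots> \<le> (1 / r) powr (1 / q) * (C * (2 * ?R powr (1 / p)))"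
      using order_trans[OF 1 mult_left_mono[OF 2, of C]] C by (intro mult_left_mono) auto
    finally show "(\<Sum>j\<in>J. norm (x j) powr q) powr (1 / q) \<le> D * ?R powr (1 / p)" by (simp add: D_def)
  qed
qed

lemma cube_inequality_imp_cotype:
  assumes q: "q \<ge> 1" and p: "p \<ge> 1" and ci: "cube_inequality TYPE('a::complex_banach) q p"
  shows "cotype TYPE('a) q"
proof -
  obtain C r where C: "C \<ge> 1" and r: "0 < r" "r < 1" and
    sm: "\<And>f :: (nat \<Rightarrow> real) \<Rightarrow> 'a. f \<in> Lp cube p \<Longrightarrow>
      (\<lambda>A. r ^ card A * norm (walsh_coeff f A) powr q) summable_on {A. finite A}" and
    ineq: "\<And>f :: (nat \<Rightarrow> real) \<Rightarrow> 'a. f \<in> Lp cube p \<Longrightarrow>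
      (\<Sum>\<^sub>\<infinity>A\<in>{A. finite A}. r ^ card A * norm (walsh_coeff f A) powr q) powr (1 / q)
          \<le> C * Lp_norm cube p f"
    using ci unfolding cube_inequality_def by blast
  \<comment> \<open>Again a single factor \<open>r\<close>. Here the test function is already a
    Rademacher sum, so no comparison constant appears.\<close>
  define D where "D = (1 / r) powr (1 / q) * C"
  show ?thesis
  proof (rule cotype_if_rademacher_Lp[OF q p, of D])
    show "D \<ge> 0" using C r by (simp add: D_def)
    fix J :: "nat set" and x :: "nat \<Rightarrow> 'a" assume J: "finite J"
    let ?y = "\<lambda>A. if card A = 1 then x (the_elem A) else 0"
    define f where "f = rpoly J ?y"
    have f: "f \<in> Lp cube p" unfolding f_def by (rule rpoly_Lp(1)[OF J])
    have coef: "walsh_coeff f {j} = x j" if "j \<in> J" for j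
      unfolding f_def using that by (subst walsh_coeff_rpoly[OF J]) auto
    have "(\<Sum>j\<in>J. r * norm (x j) powr q) = (\<Sum>j\<in>J. r ^ card {j} * norm (walsh_coeff f {j}) powr q)"
      by (simp add: coef)
    also have "\<dots> = (\<Sum>A\<in>(\<lambda>j. {j}) ` J. r ^ card A * norm (walsh_coeff f A) powr q)"
      by (subst sum.reindex) auto
    also have "\<dots> \<le> (\<Sum>\<^sub>\<infinity>A\<in>{A. finite A}. r ^ card A * norm (walsh_coeff f A) powr q)"
      using J r by (intro finite_sum_le_infsum sm f) auto
    finally have "(\<Sum>j\<in>J. r * norm (x j) powr q) powr (1 / q)
        \<le> (\<Sum>\<^sub>\<infinity>A\<in>{A. finite A}. r ^ card A * norm (walsh_coeff f A) powr q) powr (1 / q)"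
      using q r by (intro powr_mono2) (auto intro: sum_nonneg)
    also have "\<dots> \<le> C * Lp_norm cube p f" by (rule ineq[OF f])
    finally have 1: "(\<Sum>j\<in>J. r * norm (x j) powr q) powr (1 / q) \<le> C * Lp_norm cube p f" .
    have 2: "Lp_norm cube p f = (avg (signs J) (\<lambda>\<epsilon>. norm (\<Sum>j\<in>J. \<epsilon> j *\<^sub>R x j) powr p)) powr (1 / p)"
      unfolding f_def rpoly_Lp(2)[OF J] rpoly_singletons[OF J] ..
    have "(\<Sum>j\<in>J. norm (x j) powr q) powr (1 / q) = ((1 / r) * (\<Sum>j\<in>J. r * norm (x j) powr q)) powr (1 / q)"
      using r by (simp add: sum_distrib_left[symmetric])
    also have "\<dots> = (1 / r) powr (1 / q) * (\<Sum>j\<in>J. r * norm (x j) powr q) powr (1 / q)"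
      by (rule powr_mult)
    also have "\<dots> \<le> (1 / r) powr (1 / q) * (C * Lp_norm cube p f)"
      using 1 by (intro mult_left_mono) auto
    finally show "(\<Sum>j\<in>J. norm (x j) powr q) powr (1 / q)
        \<le> D * (avg (signs J) (\<lambda>\<epsilon>. norm (\<Sum>j\<in>J. \<epsilon> j *\<^sub>R x j) powr p)) powr (1 / p)"
      by (simp add: D_def 2)
  qed
qed

section \<open>From cotype to the torus inequality\<close>

text \<open>Multiplication by the primitive root \<open>w\<close> permutes the roots and multiplies
  the sum by \<open>w ^ m\<close>, which differs from 1.\<close>

lemma sum_roots_unity_power:
  assumes "0 < m" "m < n"
  shows "(\<Sum>u | u ^ n = (1::complex). u ^ m) = 0"
proof -
  let ?V = "{u::complex. u ^ n = 1}"
  have n: "n > 0" using assms by simp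
  define w where "w = cis (2 * pi * real 1 / real n)"
  have wj: "w ^ j = cis (2 * pi * real j / real n)" for j
    unfolding w_def Complex.DeMoivre by (simp add: mult_ac)
  have wn: "w ^ n = 1" using n by (simp add: wj)
  have "w ^ m = cis (2 * pi * real m / real n)" by (rule wj)
  moreover have "cis (2 * pi * real m / real n) \<noteq> cis (2 * pi * real 0 / real n)"
    using inj_onD[OF bij_betw_imp_inj_on[OF Complex.bij_betw_roots_unity[OF n]], of m 0] assms
    by (metis lessThan_iff n not_less_iff_gr_or_eq)
  ultimately have wm: "w ^ m \<noteq> 1" by simp
  have w0: "w \<noteq> 0" by (simp add: w_def)
  have bij: "bij_betw (\<lambda>u. w * u) ?V ?V"
    by (rule bij_betw_byWitness[where f'="\<lambda>u. u / w"])
      (use w0 wn in \<open>auto simp: power_mult_distrib power_divide\<close>)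
  have "(\<Sum>u\<in>?V. u ^ m) = (\<Sum>u\<in>?V. (w * u) ^ m)"
    by (rule sum.reindex_bij_betw[OF bij, symmetric])
  also have "\<dots> = w ^ m * (\<Sum>u\<in>?V. u ^ m)" by (simp add: power_mult_distrib sum_distrib_left)
  finally show ?thesis using wm by simp
qed

lemma bij_PiE_roots_unity_mult:
  fixes V :: "complex set"
  assumes V: "V = {u. u ^ n = 1}" and n: "n > 0" and c: "\<And>i. i \<in> I \<Longrightarrow> c i \<in> V"
  shows "bij_betw (\<lambda>z. \<lambda>i\<in>I. c i * z i) (PiE I (\<lambda>_. V)) (PiE I (\<lambda>_. V))"
proof -
  have c0: "c i \<noteq> 0" if "i \<in> I" for i using c[OF that] n by (auto simp: V power_0_left)
  have sub: "(\<lambda>z. \<lambda>i\<in>I. c i * z i) ` PiE I (\<lambda>_. V) \<subseteq> PiE I (\<lambda>_. V)"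
    using c by (auto simp: V image_subset_iff restrict_PiE_iff power_mult_distrib PiE_mem dest!: PiE_mem)
  have sub': "(\<lambda>z. \<lambda>i\<in>I. z i / c i) ` PiE I (\<lambda>_. V) \<subseteq> PiE I (\<lambda>_. V)"
    using c by (auto simp: V image_subset_iff restrict_PiE_iff power_divide dest!: PiE_mem)
  have "(\<lambda>i\<in>I. (\<lambda>i\<in>I. c i * z i) i / c i) = z" "(\<lambda>i\<in>I. c i * (\<lambda>i\<in>I. z i / c i) i) = z"
    if "z \<in> PiE I (\<lambda>_. V)" for z
    using c0 PiE_arb[OF that] by (auto simp: fun_eq_iff)
  then show ?thesis
    by (intro bij_betw_byWitness[where f'="\<lambda>z. \<lambda>i\<in>I. z i / c i"] ballI sub sub')
qed

text \<open>Averaging over a common rotation \<open>u\<close> of all variables extracts the part of degree one; random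
  signs are absorbed by the rotation invariance, since \<open>n\<close> is even.\<close>

lemma one_step_torus:
  fixes I :: "nat set"
  assumes q: "q \<ge> 1" and C: "C \<ge> 0" and I: "finite I" and n: "card I + 2 \<le> n" "even n"
    and rc: "\<And>J (x :: nat \<Rightarrow> 'a::complex_banach). finite J \<Longrightarrow>
      (\<Sum>j\<in>J. norm (x j) powr q) powr (1 / q) \<le> C * avg (signs J) (\<lambda>\<epsilon>. norm (\<Sum>j\<in>J. \<epsilon> j *\<^sub>R x j))"
  shows "one_step TYPE('a) id {u::complex. u ^ n = 1} I q 1 (C powr q)"
  unfolding one_step_def
proof (intro allI impI)
  fix S and y :: "nat set \<Rightarrow> 'a" assume S: "S \<subseteq> I"
  define V where "V = {u::complex. u ^ n = 1}"
  let ?W = "PiE I (\<lambda>_. V)"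
  have n0: "n > 0" using n by simp
  have V: "finite V" "card V = n" "V \<noteq> {}"
    using n0 card_roots_unity_eq[OF n0] finite_roots_unity[of n] by (auto simp: V_def intro: exI[of _ 1])
  have Vnorm: "cmod u = 1" if "u \<in> V" for u
    using that n0 power_eq_1_iff[of u n] by (auto simp: V_def)
  have finS: "finite S" using S I finite_subset by auto
  define lin where "lin z = (\<Sum>j\<in>S. z j *\<^sub>C y {j})" for z :: "nat \<Rightarrow> complex"
  have rot: "avg ?W (\<lambda>z. F (\<lambda>i\<in>I. c i * z i)) = avg ?W F" if "\<And>i. i \<in> I \<Longrightarrow> c i \<in> V" for c F
    by (rule avg_bij[OF bij_PiE_roots_unity_mult[OF V_def n0 that]])
  have lin_le: "norm (lin z) \<le> avg V (\<lambda>u. norm (tpoly id S y (\<lambda>i\<in>I. u * z i)))" for z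
  proof -
    have t: "tpoly id S y (\<lambda>i\<in>I. u * z i) = (\<Sum>A\<in>Pow S. u ^ card A *\<^sub>C chi id A z *\<^sub>C y A)" for u
    proof -
      have "chi id A (\<lambda>i\<in>I. u * z i) = u ^ card A * chi id A z" if "A \<in> Pow S" for A
      proof -
        have "chi id A (\<lambda>i\<in>I. u * z i) = (\<Prod>j\<in>A. u * z j)"
          unfolding chi_def using that S by (intro prod.cong) auto
        then show ?thesis by (simp add: chi_def prod.distrib)
      qed
      then show ?thesis unfolding tpoly_def by (intro sum.cong) (auto simp: scaleC_scaleC)
    qed
    have cnj_u: "cnj u = u ^ (n - 1)" if "u \<in> V" for u
    proof -
      have "u * u ^ (n - 1) = 1" using that n0 by (simp add: V_def power_eq_if)
      moreover have "u * cnj u = 1" using Vnorm[OF that] complex_norm_square[of u] by simp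
      ultimately have "u * cnj u = u * u ^ (n - 1)" by simp
      moreover have "u \<noteq> 0" using Vnorm[OF that] by auto
      ultimately show ?thesis by simp
    qed
    \<comment> \<open>Since \<open>cnj u = u ^ (n - 1)\<close>, the sum is one of powers
      \<open>u ^ (k - 1)\<close>, or of \<open>u ^ (n - 1)\<close> if \<open>k = 0\<close>. The
      lower bound on \<open>n\<close> keeps these exponents strictly between 0 and \<open>n\<close>
      unless \<open>k = 1\<close>, so only degree one survives.\<close>
    have s: "(\<Sum>u\<in>V. cnj u * u ^ k) = (if k = 1 then of_nat n else 0)" if k: "k \<le> card S" for k
    proof (cases "k = 1")
      case True
      have "(\<Sum>u\<in>V. cnj u * u ^ k) = (\<Sum>u\<in>V. 1)"
      proof (rule sum.cong[OF refl])
        fix u assume "u \<in> V"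
        then show "cnj u * u ^ k = 1"
          using Vnorm complex_norm_square[of u] True by (simp add: mult.commute)
      qed
      then show ?thesis using True V by simp
    next
      case False
      have kn: "k + 2 \<le> n" using k card_mono[OF I S] n by simp
      show ?thesis
      proof (cases "k = 0")
        case True
        have "(\<Sum>u\<in>V. cnj u * u ^ k) = (\<Sum>u\<in>V. u ^ (n - 1))" using True cnj_u by simp
        also have "\<dots> = 0" unfolding V_def using n by (intro sum_roots_unity_power) auto
        finally show ?thesis using True by simp
      next
        case k0: False
        have "cnj u * u ^ k = u ^ (k - 1)" if "u \<in> V" for u
        proof -
          have "u ^ k = u * u ^ (k - 1)" using k0 by (simp add: power_eq_if)
          moreover have "cnj u * u = 1" using Vnorm[OF that] complex_norm_square[of u] by (simp add: mult.commute)
          ultimately show ?thesis by (metis mult.assoc mult_1)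
        qed
        then have "(\<Sum>u\<in>V. cnj u * u ^ k) = (\<Sum>u\<in>V. u ^ (k - 1))" by simp
        also have "\<dots> = 0" unfolding V_def using k0 False kn by (intro sum_roots_unity_power) auto
        finally show ?thesis using False by simp
      qed
    qed
    have "(\<Sum>u\<in>V. cnj u *\<^sub>C tpoly id S y (\<lambda>i\<in>I. u * z i))
        = (\<Sum>u\<in>V. \<Sum>A\<in>Pow S. (cnj u * u ^ card A) *\<^sub>C chi id A z *\<^sub>C y A)"
      by (simp only: t scaleC_sum_right scaleC_scaleC mult.assoc)
    also have "\<dots> = (\<Sum>A\<in>Pow S. (\<Sum>u\<in>V. cnj u * u ^ card A) *\<^sub>C chi id A z *\<^sub>C y A)"
      by (subst sum.swap) (simp only: scaleC_sum_left)
    also have "\<dots> = (\<Sum>A\<in>Pow S. if card A = 1 then of_nat n *\<^sub>C chi id A z *\<^sub>C y A else 0)"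
      using s card_mono[OF finS] by (intro sum.cong) auto
    also have "\<dots> = (\<Sum>j\<in>S. of_nat n *\<^sub>C z j *\<^sub>C y {j})"
      unfolding sum_Pow_singletons[OF finS] by (simp add: chi_def)
    also have "\<dots> = real n *\<^sub>R lin z" by (simp add: lin_def scaleC_sum_right scaleR_scaleC)
    finally have lin_eq: "lin z = (1 / real (card V)) *\<^sub>R (\<Sum>u\<in>V. cnj u *\<^sub>C tpoly id S y (\<lambda>i\<in>I. u * z i))"
      using n0 V by simp
    have "norm (lin z) \<le> avg V (\<lambda>u. norm (cnj u *\<^sub>C tpoly id S y (\<lambda>i\<in>I. u * z i)))"
      unfolding lin_eq by (rule norm_sum_le_avg)
    also have "\<dots> = avg V (\<lambda>u. norm (tpoly id S y (\<lambda>i\<in>I. u * z i)))"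
      using Vnorm by (intro avg_cong) (simp add: norm_scaleC)
    finally show ?thesis .
  qed
  have "avg ?W (\<lambda>z. norm (lin z)) \<le> avg ?W (\<lambda>z. avg V (\<lambda>u. norm (tpoly id S y (\<lambda>i\<in>I. u * z i))))"
    by (intro avg_mono lin_le)
  also have "\<dots> = avg V (\<lambda>u. avg ?W (\<lambda>z. norm (tpoly id S y (\<lambda>i\<in>I. u * z i))))"
    by (rule avg_swap)
  also have "\<dots> = avg V (\<lambda>u. avg ?W (\<lambda>z. norm (tpoly id S y z)))"
    by (intro avg_cong rot[where F="\<lambda>z. norm (tpoly id S y z)"])
  also have "\<dots> = avg ?W (\<lambda>z. norm (tpoly id S y z))" using V by (simp add: avg_const)
  finally have lin_avg: "avg ?W (\<lambda>z. norm (lin z)) \<le> avg ?W (\<lambda>z. norm (tpoly id S y z))" .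
  have W: "finite ?W" "?W \<noteq> {}" using I V by (auto simp: finite_PiE PiE_eq_empty_iff)
  let ?Y = "(\<Sum>j\<in>S. norm (y {j}) powr q) powr (1 / q)"
  have "?Y = avg ?W (\<lambda>z. ?Y)" using W by (simp add: avg_const)
  \<comment> \<open>For each \<open>z\<close>, cotype is applied to the vectors
    \<open>z j *\<^sub>C y {j}\<close>, whose norms are those of \<open>y {j}\<close>. The signs can
    then be merged with the average over \<open>z\<close>.\<close>
  also have "\<dots> \<le> avg ?W (\<lambda>z. C * avg (signs S) (\<lambda>\<epsilon>. norm (\<Sum>j\<in>S. \<epsilon> j *\<^sub>R (z j *\<^sub>C y {j}))))"
  proof (rule avg_mono)
    fix z assume z: "z \<in> ?W"
    have "norm (z j *\<^sub>C y {j}) = norm (y {j})" if "j \<in> S" for j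
      using Vnorm[OF PiE_mem[OF z, of j]] that S by (auto simp: norm_scaleC)
    then have "?Y = (\<Sum>j\<in>S. norm (z j *\<^sub>C y {j}) powr q) powr (1 / q)" by simp
    also have "\<dots> \<le> C * avg (signs S) (\<lambda>\<epsilon>. norm (\<Sum>j\<in>S. \<epsilon> j *\<^sub>R (z j *\<^sub>C y {j})))"
      by (rule rc[OF finS])
    finally show "?Y \<le> C * avg (signs S) (\<lambda>\<epsilon>. norm (\<Sum>j\<in>S. \<epsilon> j *\<^sub>R (z j *\<^sub>C y {j})))" .
  qed
  also have "\<dots> = C * avg (signs S) (\<lambda>\<epsilon>. avg ?W (\<lambda>z. norm (\<Sum>j\<in>S. \<epsilon> j *\<^sub>R (z j *\<^sub>C y {j}))))"
    by (simp only: avg_cmult avg_swap[of ?W "signs S"])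
  also have "\<dots> = C * avg (signs S) (\<lambda>\<epsilon>. avg ?W (\<lambda>z. norm (lin z)))"
  proof (rule arg_cong[where f="(*) C"], rule avg_cong)
    fix \<epsilon> assume e: "\<epsilon> \<in> signs S"
    define c where "c i = (if i \<in> S then complex_of_real (\<epsilon> i) else 1)" for i
    have cV: "c i \<in> V" for i
      using PiE_mem[OF e, of i] n(2) by (auto simp: c_def V_def)
    have "(\<Sum>j\<in>S. \<epsilon> j *\<^sub>R (z j *\<^sub>C y {j})) = lin (\<lambda>i\<in>I. c i * z i)" for z
      unfolding lin_def using S by (intro sum.cong) (auto simp: c_def scaleR_scaleC scaleC_scaleC)
    then show "avg ?W (\<lambda>z. norm (\<Sum>j\<in>S. \<epsilon> j *\<^sub>R (z j *\<^sub>C y {j}))) = avg ?W (\<lambda>z. norm (lin z))"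
      using rot[OF cV, of "\<lambda>z. norm (lin z)"] by simp
  qed
  also have "\<dots> = C * avg ?W (\<lambda>z. norm (lin z))"
    using finS by (simp add: avg_const signs_finite_nonempty)
  also have "\<dots> \<le> C * avg ?W (\<lambda>z. norm (tpoly id S y z))"
    using lin_avg C by (intro mult_left_mono)
  finally have "?Y powr q \<le> (C * avg ?W (\<lambda>z. norm (tpoly id S y z))) powr q"
    using q by (intro powr_mono2) auto
  then show "(\<Sum>j\<in>S. norm (y {j}) powr q)
      \<le> C powr q * (avg (PiE I (\<lambda>_. {u. u ^ n = 1})) (\<lambda>z. norm (tpoly id S y z) powr 1)) powr (q / 1)"
    using q C unfolding V_def[symmetric] by (simp add: powr_powr powr_mult sum_nonneg)
qed

lemma power_powr: "(x ^ n) powr q = ((x::real) powr q) ^ n"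
  by (induction n) (simp_all add: powr_mult)

text \<open>Combines truncation, the one-step inequality and the induction on the degree.
  \<open>C\<close> is replaced by \<open>2 * C\<close> because the truncation halves a coefficient
  once for each variable that occurs. The bound is uniform in \<open>I\<close> and \<open>d\<close>,
  as the later averaging over \<open>d\<close> demands.\<close>

lemma torus_coeff_tetrahedral_sum:
  assumes q: "q \<ge> 1" and C: "C \<ge> 0" and p: "p \<ge> 1"
    and rc: "\<And>J (x :: nat \<Rightarrow> 'a::complex_banach). finite J \<Longrightarrow>
      (\<Sum>j\<in>J. norm (x j) powr q) powr (1 / q) \<le> C * avg (signs J) (\<lambda>\<epsilon>. norm (\<Sum>j\<in>J. \<epsilon> j *\<^sub>R x j))"
    and f: "f \<in> (torus_Hp p :: ((nat \<Rightarrow> complex) \<Rightarrow> 'a) set)"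
    and I: "finite I" and d: "\<And>i. i \<in> I \<Longrightarrow> d i \<ge> 1"
  shows "(\<Sum>A | A \<subseteq> I \<and> card A = k. norm (torus_coeff f (\<lambda>i. if i \<in> A then d i else 0)) powr q)
    \<le> (3 * (2 * C) powr q) ^ k * (\<integral>w. norm (f w) \<partial>torus) powr q"
proof -
  define n where "n = 2 * (card I + 2)"
  have n: "card I + 2 \<le> n" "even n" "n > 1" by (simp_all add: n_def)
  define V where "V = {u::complex. u ^ n = 1}"
  have V: "finite V" "V \<noteq> {}" "(\<Sum>v\<in>V. v) = 0" "\<And>v. v \<in> V \<Longrightarrow> cmod v = 1"
    using n sum_roots_unity[OF n(3)] finite_roots_unity[of n]
    by (auto simp: V_def intro: exI[of _ 1] dest: power_eq_1_iff)
  define y where "y A = (1 / 2) ^ card A *\<^sub>R torus_coeff f (\<lambda>i. if i \<in> A then d i else 0)" for A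
  let ?g = "\<lambda>A. norm (torus_coeff f (\<lambda>i. if i \<in> A then d i else 0)) powr q"
  let ?F = "{A. A \<subseteq> I \<and> card A = k}"
  have "(\<Sum>A\<in>?F. norm (y A) powr q)
      \<le> (3 * C powr q) ^ k * (avg (PiE I (\<lambda>_. V)) (\<lambda>z. norm (tpoly id I y z) powr 1)) powr (q / 1)"
    using V q
    by (intro tpoly_coefficients[OF I _ _ _ _ _ _ one_step_torus[OF q C I n(1,2) rc, folded V_def] order.refl]) auto
  also have "\<dots> \<le> (3 * C powr q) ^ k * (\<integral>w. norm (f w) \<partial>torus) powr q"
  proof -
    have "avg (PiE I (\<lambda>_. V)) (\<lambda>z. norm (tpoly id I y z)) \<le> (\<integral>w. norm (f w) \<partial>torus)"
      unfolding y_def by (rule torus_truncation[OF f p I _ V]) (rule d)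
    then show ?thesis using q by (intro mult_left_mono) (auto intro!: powr_mono2 avg_nonneg)
  qed
  finally have *: "(\<Sum>A\<in>?F. norm (y A) powr q) \<le> (3 * C powr q) ^ k * (\<integral>w. norm (f w) \<partial>torus) powr q" .
  have "?g A = (2 powr q) ^ k * norm (y A) powr q" if "A \<in> ?F" for A
  proof -
    have "norm (y A) powr q = ((1 / 2) ^ k) powr q * ?g A"
      using that by (simp add: y_def powr_mult)
    also have "((1 / 2::real) ^ k) powr q = ((1 / 2) powr q) ^ k"
      by (rule power_powr)
    finally have "(2 powr q) ^ k * norm (y A) powr q = ((2 * (1 / 2)) powr q) ^ k * ?g A"
      by (simp only: powr_mult power_mult_distrib mult.assoc)
    then show ?thesis by simp
  qed
  then have "(\<Sum>A\<in>?F. ?g A) = (2 powr q) ^ k * (\<Sum>A\<in>?F. norm (y A) powr q)"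
    by (simp add: sum_distrib_left)
  also have "\<dots> \<le> (2 powr q) ^ k * ((3 * C powr q) ^ k * (\<integral>w. norm (f w) \<partial>torus) powr q)"
    using * by (intro mult_left_mono) auto
  also have "\<dots> = (3 * (2 * C) powr q) ^ k * (\<integral>w. norm (f w) \<partial>torus) powr q"
    by (simp add: powr_mult power_mult_distrib mult_ac)
  finally show ?thesis .
qed

text \<open>Averaging over random exponents \<open>d i\<close> with geometric distribution reduces arbitrary
  multiindices to tetrahedral ones: \<open>\<alpha>\<close> agrees with \<open>d\<close> on its support with probability at least
  \<open>2 powr - |\<alpha>|\<close>.\<close>

lemma random_exponents:
  fixes g :: "(nat \<Rightarrow> int) \<Rightarrow> real"
  assumes I: "finite I" and F: "finite F" and g: "\<And>\<alpha>. g \<alpha> \<ge> 0"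
    and F\<alpha>: "\<And>\<alpha> i. \<alpha> \<in> F \<Longrightarrow> 0 \<le> \<alpha> i \<and> \<alpha> i \<le> int M" "\<And>\<alpha> i. \<alpha> \<in> F \<Longrightarrow> \<alpha> i \<noteq> 0 \<Longrightarrow> i \<in> I"
    and cardF: "\<And>\<alpha>. \<alpha> \<in> F \<Longrightarrow> card {i. \<alpha> i \<noteq> 0} = k"
    and bound: "\<And>d. (\<And>i. i \<in> I \<Longrightarrow> d i \<ge> 1) \<Longrightarrow>
      (\<Sum>A | A \<subseteq> I \<and> card A = k. g (\<lambda>i. if i \<in> A then d i else 0)) \<le> B"
    and M: "M \<ge> 1"
  shows "(\<Sum>\<alpha>\<in>F. (1 / 2) ^ nat (multiindex_size \<alpha>) * g \<alpha>) \<le> B"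
proof -
  \<comment> \<open>Normalisation of the geometric distribution cut off at \<open>M\<close>. As
    \<open>Z \<le> 1\<close>, the cutoff can only increase the probability of each value.\<close>
  define Z where "Z = (\<Sum>D\<in>{1..int M}. (1 / 2 :: real) ^ nat D)"
  have Zsum: "(\<Sum>D\<in>{1..int m}. (1 / 2 :: real) ^ nat D) = 1 - (1 / 2) ^ m" for m
  proof (induction m)
    case (Suc m)
    have "{1..int (Suc m)} = insert (int (Suc m)) {1..int m}" by auto
    then show ?case using Suc by (simp add: nat_add_distrib)
  qed simp
  have Z1: "Z \<le> 1" unfolding Z_def Zsum by simp
  have "(1 / 2 :: real) ^ M \<le> (1 / 2) ^ 1" using M by (intro power_decreasing) auto
  then have Z0: "Z > 0" unfolding Z_def Zsum by simp
  define w where "w D = (1 / 2) ^ nat D / Z" for D :: int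
  have wsum: "(\<Sum>D\<in>{1..int M}. w D) = 1"
    using Z0 by (simp add: w_def Z_def sum_divide_distrib[symmetric])
  have w0: "w D \<ge> 0" for D using Z0 by (simp add: w_def)
  have wge: "(1 / 2) ^ nat D \<le> w D" for D
    using Z0 Z1 by (simp add: w_def field_simps)
  let ?P = "PiE I (\<lambda>_. {1..int M})"
  have finP: "finite ?P" using I by (intro finite_PiE) auto
  define W where "W d = (\<Prod>i\<in>I. w (d i))" for d
  define s where "s \<alpha> = {i. \<alpha> i \<noteq> 0}" for \<alpha> :: "nat \<Rightarrow> int"
  have W0: "W d \<ge> 0" for d unfolding W_def by (intro prod_nonneg w0)
  have W1: "(\<Sum>d\<in>?P. W d) = 1"
    unfolding W_def using I wsum by (subst prod_sum_PiE[symmetric]) auto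
  have sI: "s \<alpha> \<subseteq> I" if "\<alpha> \<in> F" for \<alpha> using F\<alpha>(2)[OF that] by (auto simp: s_def)
  have hit: "(1 / 2) ^ nat (multiindex_size \<alpha>) \<le> (\<Sum>d\<in>?P. if \<forall>i\<in>s \<alpha>. d i = \<alpha> i then W d else 0)"
    if \<alpha>: "\<alpha> \<in> F" for \<alpha>
  proof -
    have fins: "finite (s \<alpha>)" using sI[OF \<alpha>] I finite_subset by auto
    define v where "v i D = (if i \<in> s \<alpha> \<and> D \<noteq> \<alpha> i then 0 else w D)" for i D
    have "(if \<forall>i\<in>s \<alpha>. d i = \<alpha> i then W d else 0) = (\<Prod>i\<in>I. v i (d i))" for d
    proof (cases "\<forall>i\<in>s \<alpha>. d i = \<alpha> i")
      case True
      then show ?thesis by (auto simp: W_def v_def intro!: prod.cong)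
    next
      case False
      then obtain i where "i \<in> s \<alpha>" "d i \<noteq> \<alpha> i" by auto
      then have "(\<Prod>i\<in>I. v i (d i)) = 0"
        using I sI[OF \<alpha>] by (intro prod_zero) (auto simp: v_def)
      then show ?thesis by (simp only: False if_False)
    qed
    then have "(\<Sum>d\<in>?P. if \<forall>i\<in>s \<alpha>. d i = \<alpha> i then W d else 0) = (\<Prod>i\<in>I. \<Sum>D\<in>{1..int M}. v i D)"
      using I by (subst prod_sum_PiE) auto
    also have "\<dots> = (\<Prod>i\<in>I. if i \<in> s \<alpha> then w (\<alpha> i) else 1)"
    proof (rule prod.cong[OF refl])
      fix i
      show "(\<Sum>D\<in>{1..int M}. v i D) = (if i \<in> s \<alpha> then w (\<alpha> i) else 1)"
      proof (cases "i \<in> s \<alpha>")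
        case True
        have "(\<Sum>D\<in>{1..int M}. v i D) = (\<Sum>D\<in>{1..int M}. if D = \<alpha> i then w D else 0)"
          using True by (intro sum.cong) (auto simp: v_def)
        moreover have "\<alpha> i \<in> {1..int M}" using F\<alpha>(1)[OF \<alpha>, of i] True by (auto simp: s_def)
        ultimately show ?thesis using True by simp
      qed (simp add: v_def wsum)
    qed
    also have "\<dots> = (\<Prod>i\<in>s \<alpha>. w (\<alpha> i))"
      using I sI[OF \<alpha>] by (simp add: prod.If_cases Int_absorb1)
    finally have "(\<Sum>d\<in>?P. if \<forall>i\<in>s \<alpha>. d i = \<alpha> i then W d else 0) = (\<Prod>i\<in>s \<alpha>. w (\<alpha> i))" .
    moreover have "(\<Prod>i\<in>s \<alpha>. (1 / 2 :: real) ^ nat (\<alpha> i)) \<le> (\<Prod>i\<in>s \<alpha>. w (\<alpha> i))"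
      by (intro prod_mono) (simp add: wge)
    moreover have "(\<Prod>i\<in>s \<alpha>. (1 / 2 :: real) ^ nat (\<alpha> i)) = (1 / 2) ^ nat (multiindex_size \<alpha>)"
    proof -
      have "nat (multiindex_size \<alpha>) = (\<Sum>i\<in>s \<alpha>. nat (\<alpha> i))"
      proof -
        have "int (\<Sum>i\<in>s \<alpha>. nat (\<alpha> i)) = (\<Sum>i\<in>s \<alpha>. \<alpha> i)"
          unfolding of_nat_sum using F\<alpha>(1)[OF \<alpha>] by (intro sum.cong) auto
        then show ?thesis unfolding multiindex_size_def s_def[symmetric] by linarith
      qed
      then show ?thesis by (simp add: power_sum)
    qed
    ultimately show ?thesis by simp
  qed
  \<comment> \<open>For fixed \<open>d\<close>, a multiindex that agrees with \<open>d\<close> on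
    its support is determined by that support. The sum thus becomes one over supports, to which the
    assumed bound applies.\<close>
  have le: "(\<Sum>\<alpha>\<in>F. if \<forall>i\<in>s \<alpha>. d i = \<alpha> i then g \<alpha> else 0) \<le> B" if d: "d \<in> ?P" for d
  proof -
    let ?F = "{\<alpha> \<in> F. \<forall>i\<in>s \<alpha>. d i = \<alpha> i}"
    have rep: "(\<lambda>i. if i \<in> s \<alpha> then d i else 0) = \<alpha>" if "\<alpha> \<in> ?F" for \<alpha>
      using that by (auto simp: fun_eq_iff s_def)
    have inj: "inj_on s ?F" by (rule inj_on_inverseI[of _ "\<lambda>A i. if i \<in> A then d i else 0"]) (rule rep)
    have "(\<Sum>\<alpha>\<in>F. if \<forall>i\<in>s \<alpha>. d i = \<alpha> i then g \<alpha> else 0) = (\<Sum>\<alpha>\<in>?F. g \<alpha>)"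
      using F by (simp add: sum.inter_filter)
    also have "\<dots> = (\<Sum>\<alpha>\<in>?F. g (\<lambda>i. if i \<in> s \<alpha> then d i else 0))"
      using rep by (intro sum.cong) auto
    also have "\<dots> = (\<Sum>A\<in>s ` ?F. g (\<lambda>i. if i \<in> A then d i else 0))"
      by (simp add: sum.reindex[OF inj])
    also have "\<dots> \<le> (\<Sum>A | A \<subseteq> I \<and> card A = k. g (\<lambda>i. if i \<in> A then d i else 0))"
      using I g cardF sI by (intro sum_mono2) (auto simp: s_def)
    also have "\<dots> \<le> B" using PiE_mem[OF d] by (intro bound) auto
    finally show ?thesis .
  qed
  have "(\<Sum>\<alpha>\<in>F. (1 / 2) ^ nat (multiindex_size \<alpha>) * g \<alpha>)
      \<le> (\<Sum>\<alpha>\<in>F. (\<Sum>d\<in>?P. if \<forall>i\<in>s \<alpha>. d i = \<alpha> i then W d else 0) * g \<alpha>)"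
    using hit g by (intro sum_mono mult_right_mono)
  also have "\<dots> = (\<Sum>\<alpha>\<in>F. \<Sum>d\<in>?P. W d * (if \<forall>i\<in>s \<alpha>. d i = \<alpha> i then g \<alpha> else 0))"
    by (simp add: sum_distrib_right if_distrib[of "\<lambda>x. x * _"] if_distrib[of "\<lambda>x. _ * x"] cong: if_cong)
  also have "\<dots> = (\<Sum>d\<in>?P. W d * (\<Sum>\<alpha>\<in>F. if \<forall>i\<in>s \<alpha>. d i = \<alpha> i then g \<alpha> else 0))"
    by (subst sum.swap) (simp add: sum_distrib_left)
  also have "\<dots> \<le> (\<Sum>d\<in>?P. W d * B)" using le W0 by (intro sum_mono mult_left_mono)
  also have "\<dots> = B" using W1 by (simp add: sum_distrib_right[symmetric])
  finally show ?thesis .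
qed

section \<open>Summation over all degrees\<close>

lemma geometric_sum_le:
  assumes K: "K \<ge> 1" and T: "T \<ge> 0" and h: "\<And>k. h k \<le> K ^ k * (T::real)"
  shows "(\<Sum>k\<le>N. (1 / (2 * K)) ^ k * h k) \<le> 2 * T"
proof -
  have "(\<Sum>k\<le>N. (1 / (2 * K)) ^ k * h k) \<le> (\<Sum>k\<le>N. (1 / 2) ^ k * T)"
  proof (rule sum_mono)
    fix k
    have "(1 / (2 * K)) ^ k * h k \<le> (1 / (2 * K)) ^ k * (K ^ k * T)"
      using h K by (intro mult_left_mono) auto
    also have "\<dots> = (1 / (2 * K) * K) ^ k * T" by (simp only: power_mult_distrib mult.assoc)
    also have "1 / (2 * K) * K = 1 / 2" using K by simp
    finally show "(1 / (2 * K)) ^ k * h k \<le> (1 / 2) ^ k * T" .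
  qed
  also have "\<dots> = (\<Sum>k\<le>N. (1 / 2) ^ k) * T" by (simp add: sum_distrib_right)
  also have "(\<Sum>k\<le>N. (1 / 2 :: real) ^ k) \<le> 2"
  proof -
    have "(\<Sum>k\<le>N. (1 / 2 :: real) ^ k) = 2 - (1 / 2) ^ N" by (induction N) auto
    then show ?thesis by simp
  qed
  finally show ?thesis using T by (simp add: mult_right_mono)
qed

lemma bounded_finite_sums:
  fixes g :: "'b \<Rightarrow> real"
  assumes g: "\<And>a. a \<in> A \<Longrightarrow> g a \<ge> 0" and q: "q \<ge> 1" and T: "T \<ge> 0"
    and le: "\<And>F. finite F \<Longrightarrow> F \<subseteq> A \<Longrightarrow> sum g F \<le> 2 * T powr q"
  shows "g summable_on A" "(\<Sum>\<^sub>\<infinity>a\<in>A. g a) powr (1 / q) \<le> 2 * T"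
proof -
  show sm: "g summable_on A"
    by (rule nonneg_bdd_above_summable_on[OF g]) (auto intro!: bdd_aboveI[of _ "2 * T powr q"] le)
  have "(\<Sum>\<^sub>\<infinity>a\<in>A. g a) \<le> 2 * T powr q" by (rule infsum_le_finite_sums[OF sm le])
  then have "(\<Sum>\<^sub>\<infinity>a\<in>A. g a) powr (1 / q) \<le> (2 * T powr q) powr (1 / q)"
    using q g by (intro powr_mono2) (auto intro: infsum_nonneg)
  also have "\<dots> = 2 powr (1 / q) * T" using q T by (simp add: powr_mult powr_powr)
  also have "\<dots> \<le> 2 powr 1 * T" using q T by (intro mult_right_mono powr_mono) auto
  finally show "(\<Sum>\<^sub>\<infinity>a\<in>A. g a) powr (1 / q) \<le> 2 * T" by simp
qed

lemma multiindices_bounded: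
  assumes "finite F" "F \<subseteq> nonneg_multiindices"
  obtains N M where "M \<ge> 1" "\<And>\<alpha> i. \<alpha> \<in> F \<Longrightarrow> 0 \<le> \<alpha> i \<and> \<alpha> i \<le> int M" "\<And>\<alpha> i. \<alpha> \<in> F \<Longrightarrow> \<alpha> i \<noteq> 0 \<Longrightarrow> i \<in> {..<N::nat}"
proof -
  define S where "S = (\<Union>\<alpha>\<in>F. {i. \<alpha> i \<noteq> 0})"
  have S: "finite S" using assms by (auto simp: S_def nonneg_multiindices_def int_multiindices_def)
  then obtain N where N: "S \<subseteq> {..<N}" by (meson finite_nat_iff_bounded)
  define M where "M = Suc (\<Sum>\<alpha>\<in>F. \<Sum>i\<in>S. nat (\<alpha> i))"
  have "\<alpha> i \<le> int M" if \<alpha>: "\<alpha> \<in> F" for \<alpha> i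
  proof (cases "i \<in> S")
    case True
    have "nat (\<alpha> i) \<le> (\<Sum>i\<in>S. nat (\<alpha> i))" using S True by (intro member_le_sum) auto
    also have "\<dots> \<le> (\<Sum>\<alpha>\<in>F. \<Sum>i\<in>S. nat (\<alpha> i))"
      using assms(1) \<alpha> by (intro member_le_sum[of \<alpha> F "\<lambda>\<alpha>. \<Sum>i\<in>S. nat (\<alpha> i)"]) auto
    finally have "nat (\<alpha> i) \<le> M" by (simp add: M_def)
    then show ?thesis by linarith
  next
    case False
    then have "\<alpha> i = 0" using \<alpha> by (auto simp: S_def)
    then show ?thesis by simp
  qed
  moreover have "0 \<le> \<alpha> i" if "\<alpha> \<in> F" for \<alpha> i using assms that by (auto simp: nonneg_multiindices_def)
  moreover have "i \<in> {..<N}" if "\<alpha> \<in> F" "\<alpha> i \<noteq> 0" for \<alpha> i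
    using N that unfolding S_def by blast
  moreover have "M \<ge> 1" by (simp add: M_def)
  ultimately show ?thesis using that[of M N] by blast
qed

lemma rademacher_cotype_imp_torus_inequality:
  assumes q: "q \<ge> 1" and p: "p \<ge> 1" and rc: "rademacher_cotype TYPE('a::complex_banach) q"
  shows "torus_inequality TYPE('a) q p"
proof -
  obtain C where C: "C \<ge> 1" and rc': "\<And>J (x :: nat \<Rightarrow> 'a). finite J \<Longrightarrow>
      (\<Sum>j\<in>J. norm (x j) powr q) powr (1 / q) \<le> C * avg (signs J) (\<lambda>\<epsilon>. norm (\<Sum>j\<in>J. \<epsilon> j *\<^sub>R x j))"
    using rc unfolding rademacher_cotype_def by blast
  define K where "K = 3 * (2 * C) powr q"
  have "1 \<le> (2 * C) powr q" using C q by (intro ge_one_powr_ge_zero) auto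
  then have K: "K \<ge> 1" by (simp add: K_def)
  \<comment> \<open>The factor \<open>1 / 2\<close> pays for the random exponents, with the power
    \<open>|\<alpha>|\<close>. The factor \<open>1 / (2 * K)\<close> pays for \<open>K ^ k\<close>
    and makes the sum over the support size \<open>k\<close> converge; this size is at most
    \<open>|\<alpha>|\<close> because nonzero entries are at least 1.\<close>
  define r where "r = (1 / 2) * (1 / (2 * K))"
  have r: "0 < r" "r < 1" using K by (auto simp: r_def field_simps)
  have main: "(\<lambda>\<alpha>. r powi multiindex_size \<alpha> * norm (torus_coeff f \<alpha>) powr q) summable_on nonneg_multiindices \<and>
      (\<Sum>\<^sub>\<infinity>\<alpha>\<in>nonneg_multiindices. r powi multiindex_size \<alpha> * norm (torus_coeff f \<alpha>) powr q) powr (1 / q)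
          \<le> 2 * Lp_norm torus p f" if f: "f \<in> torus_Hp p" for f :: "(nat \<Rightarrow> complex) \<Rightarrow> 'a"
  proof -
    interpret prob_space torus by (rule prob_space_torus)
    define T where "T = (\<integral>w. norm (f w) \<partial>torus)"
    have T0: "T \<ge> 0" unfolding T_def by (intro Bochner_Integration.integral_nonneg) auto
    have Tp: "T \<le> Lp_norm torus p f"
      unfolding T_def using f p by (intro Lp_bochner(2)) (auto simp: torus_Hp_def)
    let ?g = "\<lambda>\<alpha>. norm (torus_coeff f \<alpha>) powr q"
    have fin: "(\<Sum>\<alpha>\<in>F. r powi multiindex_size \<alpha> * ?g \<alpha>) \<le> 2 * T powr q"
      if F: "finite F" "F \<subseteq> nonneg_multiindices" for F
    proof -
      obtain N M where M: "M \<ge> 1" and F\<alpha>: "\<And>\<alpha> i. \<alpha> \<in> F \<Longrightarrow> 0 \<le> \<alpha> i \<and> \<alpha> i \<le> int M"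
        "\<And>\<alpha> i. \<alpha> \<in> F \<Longrightarrow> \<alpha> i \<noteq> 0 \<Longrightarrow> i \<in> {..<N::nat}"
        using multiindices_bounded[OF F] by metis
      define s where "s \<alpha> = card {i. \<alpha> i \<noteq> 0}" for \<alpha> :: "nat \<Rightarrow> int"
      define h where "h k = (\<Sum>\<alpha>\<in>{\<alpha>\<in>F. s \<alpha> = k}. (1 / 2) ^ nat (multiindex_size \<alpha>) * ?g \<alpha>)" for k
      have hk: "h k \<le> K ^ k * T powr q" for k
        unfolding h_def
      proof (rule random_exponents[where I="{..<N}" and M=M and k=k])
        fix d :: "nat \<Rightarrow> int" assume "\<And>i. i \<in> {..<N} \<Longrightarrow> d i \<ge> 1"
        then show "(\<Sum>A | A \<subseteq> {..<N} \<and> card A = k. ?g (\<lambda>i. if i \<in> A then d i else 0)) \<le> K ^ k * T powr q"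
          unfolding K_def T_def using C by (intro torus_coeff_tetrahedral_sum[OF q _ p rc' f]) auto
      qed (use F F\<alpha> M in \<open>auto simp: s_def\<close>)
      have sN: "s \<alpha> \<le> N" if "\<alpha> \<in> F" for \<alpha>
        unfolding s_def using F\<alpha>(2)[OF that] card_mono[of "{..<N}" "{i. \<alpha> i \<noteq> 0}"] by auto
      have size_le: "r powi multiindex_size \<alpha> \<le> (1 / (2 * K)) ^ s \<alpha> * (1 / 2) ^ nat (multiindex_size \<alpha>)"
        if \<alpha>: "\<alpha> \<in> F" for \<alpha>
      proof -
        have fins: "finite {i. \<alpha> i \<noteq> 0}"
          using F \<alpha> by (auto simp: nonneg_multiindices_def int_multiindices_def)
        have pos: "\<alpha> i \<ge> 1" if "i \<in> {i. \<alpha> i \<noteq> 0}" for i using F\<alpha>(1)[OF \<alpha>, of i] that by auto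
        have "int (s \<alpha>) = (\<Sum>i | \<alpha> i \<noteq> 0. 1)" by (simp add: s_def)
        also have "\<dots> \<le> multiindex_size \<alpha>" unfolding multiindex_size_def by (intro sum_mono pos)
        finally have le: "int (s \<alpha>) \<le> multiindex_size \<alpha>" .
        have "r powi multiindex_size \<alpha> = r ^ nat (multiindex_size \<alpha>)"
          using le by (simp add: power_int_def)
        also have "\<dots> = (1 / (2 * K)) ^ nat (multiindex_size \<alpha>) * (1 / 2) ^ nat (multiindex_size \<alpha>)"
          unfolding r_def power_mult_distrib by simp
        also have "\<dots> \<le> (1 / (2 * K)) ^ s \<alpha> * (1 / 2) ^ nat (multiindex_size \<alpha>)"
          using K le by (intro mult_right_mono power_decreasing) auto
        finally show ?thesis .
      qed
      have "(\<Sum>\<alpha>\<in>F. r powi multiindex_size \<alpha> * ?g \<alpha>)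
          \<le> (\<Sum>\<alpha>\<in>F. (1 / (2 * K)) ^ s \<alpha> * ((1 / 2) ^ nat (multiindex_size \<alpha>) * ?g \<alpha>))"
        using size_le by (intro sum_mono) (simp add: mult.assoc[symmetric] mult_right_mono)
      also have "\<dots> = (\<Sum>k\<le>N. \<Sum>\<alpha>\<in>{\<alpha>\<in>F. s \<alpha> = k}. (1 / (2 * K)) ^ s \<alpha> * ((1 / 2) ^ nat (multiindex_size \<alpha>) * ?g \<alpha>))"
        using F sN by (intro sum.group[symmetric]) auto
      also have "\<dots> = (\<Sum>k\<le>N. (1 / (2 * K)) ^ k * h k)"
        unfolding h_def sum_distrib_left by (intro sum.cong) auto
      also have "\<dots> \<le> 2 * T powr q" by (intro geometric_sum_le K hk) simp
      finally show ?thesis .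
    qed
    have nn: "r powi multiindex_size \<alpha> * ?g \<alpha> \<ge> 0" for \<alpha> using r by simp
    note * = bounded_finite_sums[OF nn q T0 fin]
    show ?thesis using *(1) order_trans[OF *(2)] Tp by simp
  qed
  show ?thesis unfolding torus_inequality_def
    by (rule exI[of _ 2], rule exI[of _ r]) (use r main in auto)
qed

section \<open>From cotype and K-convexity to the cube inequality\<close>

lemma Lp_norm_cong_AE:
  assumes "f \<in> Lp M p" "g \<in> Lp M p" "AE x in M. f x = g x"
  shows "Lp_norm M p f = Lp_norm M p g"
proof -
  have "(\<integral>x. norm (f x) powr p \<partial>M) = (\<integral>x. norm (g x) powr p \<partial>M)"
    using assms by (intro integral_cong_AE) (auto simp: Lp_def)
  then show ?thesis by (simp add: Lp_norm_def)
qed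

lemma rpoly_mono_set:
  assumes "finite I" "S \<subseteq> I"
  shows "rpoly S y = rpoly I (\<lambda>A. if A \<subseteq> S then y A else 0)"
  unfolding rpoly_def fun_eq_iff using assms
  by (auto intro!: sum.mono_neutral_cong_left split: if_splits)

lemma tpoly_of_real: "tpoly complex_of_real S y \<epsilon> = rpoly S y \<epsilon>"
  by (simp add: tpoly_def rpoly_def chi_def walsh_def scaleR_scaleC)

text \<open>Passes from an operator that is determined only almost everywhere to an inequality for
  polynomials. The absolute value is taken because the bound in the definition may be any real
  number.\<close>

lemma K_convex_rademacher_projection:
  assumes "K_convex TYPE('a::complex_banach)"
  obtains K where "K \<ge> 0" "\<And>I (y :: nat set \<Rightarrow> 'a). finite I \<Longrightarrow>
    Lp_norm cube 2 (rpoly I (\<lambda>A. if card A = 1 then y A else 0)) \<le> K * Lp_norm cube 2 (rpoly I y)"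
proof -
  obtain T :: "((nat \<Rightarrow> real) \<Rightarrow> 'a) \<Rightarrow> ((nat \<Rightarrow> real) \<Rightarrow> 'a)" and K where
    T: "\<forall>f \<in> Lp cube 2. T f \<in> Lp cube 2" and
    K: "\<forall>f \<in> Lp cube 2. Lp_norm cube 2 (T f) \<le> K * Lp_norm cube 2 f" and
    proj: "\<forall>F (x :: nat set \<Rightarrow> 'a). finite F \<and> (\<forall>A\<in>F. finite A) \<longrightarrow>
        (AE \<epsilon> in cube. T (\<lambda>\<eta>. \<Sum>A\<in>F. walsh A \<eta> *\<^sub>R x A) \<epsilon>
                         = (\<Sum>A \<in> {A\<in>F. card A = 1}. walsh A \<epsilon> *\<^sub>R x A))"
    using assms unfolding K_convex_def by (elim exE conjE) (rule that)
  have "Lp_norm cube 2 (rpoly I (\<lambda>A. if card A = 1 then y A else 0)) \<le> \<bar>K\<bar> * Lp_norm cube 2 (rpoly I y)"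
    if I: "finite I" for I and y :: "nat set \<Rightarrow> 'a"
  proof -
    let ?P = "rpoly I (\<lambda>A. if card A = 1 then y A else 0)"
    have f: "rpoly I y \<in> Lp cube 2" "?P \<in> Lp cube 2" by (intro rpoly_Lp I)+
    have "finite (Pow I) \<and> (\<forall>A\<in>Pow I. finite A)" using I finite_subset by auto
    from proj[rule_format, OF this, of y]
    have "AE \<epsilon> in cube. T (rpoly I y) \<epsilon> = (\<Sum>A \<in> {A\<in>Pow I. card A = 1}. walsh A \<epsilon> *\<^sub>R y A)"
      by (simp add: rpoly_def[abs_def])
    moreover have "?P \<epsilon> = (\<Sum>A \<in> {A\<in>Pow I. card A = 1}. walsh A \<epsilon> *\<^sub>R y A)" for \<epsilon>
      unfolding rpoly_def using I by (intro sum.mono_neutral_cong_right) auto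
    ultimately have "AE \<epsilon> in cube. ?P \<epsilon> = T (rpoly I y) \<epsilon>"
      by (elim eventually_mono) metis
    then have "Lp_norm cube 2 ?P = Lp_norm cube 2 (T (rpoly I y))"
      using f T by (intro Lp_norm_cong_AE) auto
    also have "\<dots> \<le> K * Lp_norm cube 2 (rpoly I y)" using K f by blast
    also have "\<dots> \<le> \<bar>K\<bar> * Lp_norm cube 2 (rpoly I y)"
      by (intro mult_right_mono) (auto simp: Lp_norm_def)
    finally show ?thesis .
  qed
  then show ?thesis using that[of "\<bar>K\<bar>"] by simp
qed

lemma rademacher_cotype_imp_cube_inequality:
  assumes q: "q \<ge> 2" and p: "p > 1" and rc: "rademacher_cotype TYPE('a::complex_banach) q"
    and Kc: "K_convex TYPE('a)"
  shows "cube_inequality TYPE('a) q p"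
proof -
  obtain C where C: "C \<ge> 1" and rc': "\<And>J (x :: nat \<Rightarrow> 'a). finite J \<Longrightarrow>
      (\<Sum>j\<in>J. norm (x j) powr q) powr (1 / q) \<le> C * avg (signs J) (\<lambda>\<epsilon>. norm (\<Sum>j\<in>J. \<epsilon> j *\<^sub>R x j))"
    using rc unfolding rademacher_cotype_def by blast
  obtain K where K: "K \<ge> 0" and proj: "\<And>I (y :: nat set \<Rightarrow> 'a). finite I \<Longrightarrow>
    Lp_norm cube 2 (rpoly I (\<lambda>A. if card A = 1 then y A else 0)) \<le> K * Lp_norm cube 2 (rpoly I y)"
    using K_convex_rademacher_projection[OF Kc] by metis
  obtain k where hyp: "\<And>I (y :: nat set \<Rightarrow> 'a). finite I \<Longrightarrow>
    (avg (signs I) (\<lambda>\<epsilon>. norm (rpoly I (\<lambda>A. (\<rho> ^ k) ^ card A *\<^sub>R y A) \<epsilon>) powr 2)) powr (1 / 2)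
    \<le> (avg (signs I) (\<lambda>\<epsilon>. norm (rpoly I y \<epsilon>) powr p)) powr (1 / p)"
    using rpoly_hypercontractive[OF p, where 'a='a] by blast
  \<comment> \<open>The maximum with 1 is taken because \<open>K\<close> is only known to be
    nonnegative, while the geometric summation assumes a ratio of at least 1.\<close>
  define L where "L = max 1 (3 * (C * K) powr q)"
  have L: "L \<ge> 1" by (simp add: L_def)
  \<comment> \<open>The exponent is 2 because K-convexity bounds the projection in L2. The induction
    on the degree admits it since \<open>2 \<le> q\<close>.\<close>
  have os: "one_step TYPE('a) complex_of_real {- 1, 1} I q 2 ((C * K) powr q)" if I: "finite I" for I :: "nat set"
    unfolding one_step_def
  proof (intro allI impI)
    fix S and y :: "nat set \<Rightarrow> 'a" assume S: "S \<subseteq> I"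
    have finS: "finite S" using S I finite_subset by auto
    have e2: "Lp_norm cube 2 (rpoly S y) = (avg (signs I) (\<lambda>\<epsilon>. norm (rpoly S y \<epsilon>) powr 2)) powr (1 / 2)"
      unfolding rpoly_mono_set[OF I S] by (rule rpoly_Lp(2)[OF I])
    have sing: "rpoly S (\<lambda>A. if card A = 1 then y A else 0) \<epsilon> = (\<Sum>j\<in>S. \<epsilon> j *\<^sub>R y {j})" for \<epsilon>
      using sum_Pow_singletons[OF finS, of "\<lambda>A. walsh A \<epsilon> *\<^sub>R y A"]
      by (simp add: rpoly_def walsh_def if_distrib cong: if_cong)
    have "(\<Sum>j\<in>S. norm (y {j}) powr q) powr (1 / q) \<le> C * avg (signs S) (\<lambda>\<epsilon>. norm (\<Sum>j\<in>S. \<epsilon> j *\<^sub>R y {j}))"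
      by (rule rc'[OF finS])
    also have "\<dots> \<le> C * Lp_norm cube 2 (rpoly S (\<lambda>A. if card A = 1 then y A else 0))"
    proof (rule mult_left_mono)
      have "avg (signs S) (\<lambda>\<epsilon>. norm (\<Sum>j\<in>S. \<epsilon> j *\<^sub>R y {j}) powr 1) powr (1 / 1)
          \<le> avg (signs S) (\<lambda>\<epsilon>. norm (\<Sum>j\<in>S. \<epsilon> j *\<^sub>R y {j}) powr 2) powr (1 / 2)"
        using finS by (intro avg_powr_mono_exponent) (auto simp: signs_finite_nonempty)
      then show "avg (signs S) (\<lambda>\<epsilon>. norm (\<Sum>j\<in>S. \<epsilon> j *\<^sub>R y {j}))
          \<le> Lp_norm cube 2 (rpoly S (\<lambda>A. if card A = 1 then y A else 0))"
        unfolding rpoly_Lp(2)[OF finS] sing by (simp add: avg_nonneg)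
    qed (use C in simp)
    also have "\<dots> \<le> C * (K * Lp_norm cube 2 (rpoly S y))"
      using C proj[OF finS] by (intro mult_left_mono) auto
    finally have "((\<Sum>j\<in>S. norm (y {j}) powr q) powr (1 / q)) powr q \<le> (C * K * Lp_norm cube 2 (rpoly S y)) powr q"
      using q by (intro powr_mono2) (auto simp: mult.assoc)
    then show "(\<Sum>j\<in>S. norm (y {j}) powr q) \<le> (C * K) powr q *
        (avg (PiE I (\<lambda>_. {- 1, 1})) (\<lambda>z. norm (tpoly complex_of_real S y z) powr 2)) powr (q / 2)"
      using q C K unfolding tpoly_of_real e2 by (simp add: powr_powr powr_mult sum_nonneg)
  qed
  \<comment> \<open>The first factor undoes the damping of the coefficients by which
    hypercontractivity replaces exponent \<open>p\<close> by 2; the second absorbs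
    \<open>L ^ n\<close> and leaves a geometric series.\<close>
  define r where "r = (\<rho> ^ k) powr q * (1 / (2 * L))"
  have "(\<rho> ^ k) powr q \<le> 1 powr q" using \<rho> q by (intro powr_mono2) (auto intro: power_le_one)
  moreover have "(\<rho> ^ k) powr q > 0" using \<rho> by simp
  moreover have "1 / (2 * L) > 0" "1 / (2 * L) < 1" using L by (auto simp: field_simps)
  ultimately have r: "0 < r" "r < 1"
    unfolding r_def using mult_mono[of "(\<rho> ^ k) powr q" 1 "1 / (2 * L)" "1 / (2 * L)"] by auto
  have main: "(\<lambda>A. r ^ card A * norm (walsh_coeff f A) powr q) summable_on {A. finite A} \<and>
      (\<Sum>\<^sub>\<infinity>A\<in>{A. finite A}. r ^ card A * norm (walsh_coeff f A) powr q) powr (1 / q) \<le> 2 * Lp_norm cube p f"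
    if f: "f \<in> Lp cube p" for f :: "(nat \<Rightarrow> real) \<Rightarrow> 'a"
  proof -
    define T where "T = Lp_norm cube p f"
    have T0: "T \<ge> 0" by (simp add: T_def Lp_norm_def)
    let ?g = "\<lambda>A. norm (walsh_coeff f A) powr q"
    have level: "(\<Sum>A | A \<subseteq> I \<and> card A = n. ((\<rho> ^ k) powr q) ^ n * ?g A) \<le> L ^ n * T powr q"
      if I: "finite I" for I n
    proof -
      define y where "y A = (\<rho> ^ k) ^ card A *\<^sub>R walsh_coeff f A" for A
      have "((\<rho> ^ k) powr q) ^ n * ?g A = norm (y A) powr q" if "card A = n" for A
      proof -
        have "norm (y A) powr q = ((\<rho> ^ k) ^ n) powr q * ?g A"
          using that \<rho> by (simp add: y_def powr_mult)
        also have "((\<rho> ^ k) ^ n) powr q = ((\<rho> ^ k) powr q) ^ n"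
          by (rule power_powr)
        finally show ?thesis by simp
      qed
      then have "(\<Sum>A | A \<subseteq> I \<and> card A = n. ((\<rho> ^ k) powr q) ^ n * ?g A) = (\<Sum>A | A \<subseteq> I \<and> card A = n. norm (y A) powr q)"
        by (intro sum.cong) auto
      also have "\<dots> \<le> (3 * (C * K) powr q) ^ n * (avg (signs I) (\<lambda>z. norm (tpoly complex_of_real I y z) powr 2)) powr (q / 2)"
        using q by (intro tpoly_coefficients[OF I _ _ _ _ _ _ os[OF I] order.refl]) auto
      also have "\<dots> \<le> L ^ n * T powr q"
      proof (intro mult_mono power_mono)
        have "(avg (signs I) (\<lambda>\<epsilon>. norm (rpoly I y \<epsilon>) powr 2)) powr (1 / 2)
            \<le> (avg (signs I) (\<lambda>\<epsilon>. norm (rpoly I (walsh_coeff f) \<epsilon>) powr p)) powr (1 / p)"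
          unfolding y_def by (rule hyp[OF I])
        also have "\<dots> \<le> T" unfolding T_def using p by (intro cube_truncation f I) auto
        finally have "((avg (signs I) (\<lambda>\<epsilon>. norm (rpoly I y \<epsilon>) powr 2)) powr (1 / 2)) powr q \<le> T powr q"
          using q by (intro powr_mono2) auto
        then show "(avg (signs I) (\<lambda>z. norm (tpoly complex_of_real I y z) powr 2)) powr (q / 2) \<le> T powr q"
          by (simp add: tpoly_of_real powr_powr)
      qed (auto simp: L_def)
      finally show ?thesis .
    qed
    have fin: "(\<Sum>A\<in>F. r ^ card A * ?g A) \<le> 2 * T powr q" if F: "finite F" "F \<subseteq> {A. finite A}" for F
    proof -
      have "finite (\<Union>F)" using F by auto
      then obtain N where N: "\<Union>F \<subseteq> {..<N}" by (meson finite_nat_iff_bounded)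
      define h where "h n = (\<Sum>A | A \<subseteq> {..<N} \<and> card A = n. ((\<rho> ^ k) powr q) ^ n * ?g A)" for n
      have "F \<subseteq> Pow {..<N}" using N by auto
      then have "(\<Sum>A\<in>F. r ^ card A * ?g A) \<le> (\<Sum>A\<in>Pow {..<N}. r ^ card A * ?g A)"
        using r by (intro sum_mono2) auto
      also have "\<dots> = (\<Sum>n\<le>N. \<Sum>A\<in>{A\<in>Pow {..<N}. card A = n}. r ^ card A * ?g A)"
        using card_mono[of "{..<N}"] by (intro sum.group[symmetric]) auto
      also have "\<dots> = (\<Sum>n\<le>N. (1 / (2 * L)) ^ n * h n)"
        unfolding h_def sum_distrib_left by (intro sum.cong) (auto simp: r_def power_mult_distrib power_divide mult_ac)
      also have "\<dots> \<le> 2 * T powr q"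
        unfolding h_def by (intro geometric_sum_le L level) auto
      finally show ?thesis .
    qed
    have nn: "r ^ card A * ?g A \<ge> 0" for A using r by simp
    have "q \<ge> 1" using q by simp
    note * = bounded_finite_sums[OF nn this T0 fin]
    show ?thesis using * by (simp add: T_def)
  qed
  show ?thesis unfolding cube_inequality_def
    by (rule exI[of _ 2], rule exI[of _ r]) (use r main in auto)
qed

theorem theorem3p5:
  fixes q :: real
  assumes "2 \<le> q"
  shows
    "(cotype TYPE('a::complex_banach) q \<longleftrightarrow> (\<exists>p\<ge>1. dirichlet_inequality TYPE('a) q p)) \<and>
     (cotype TYPE('a) q \<longleftrightarrow> (\<forall>p\<ge>1. dirichlet_inequality TYPE('a) q p)) \<and>
     (cotype TYPE('a) q \<longleftrightarrow> (\<exists>p\<ge>1. torus_inequality TYPE('a) q p)) \<and>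
     (cotype TYPE('a) q \<longleftrightarrow> (\<forall>p\<ge>1. torus_inequality TYPE('a) q p)) \<and>
     ((\<exists>p>1. cube_inequality TYPE('a) q p) \<longrightarrow> cotype TYPE('a) q) \<and>
     ((\<forall>p>1. cube_inequality TYPE('a) q p) \<longrightarrow> cotype TYPE('a) q) \<and>
     (K_convex TYPE('a) \<longrightarrow>
        (cotype TYPE('a) q \<longleftrightarrow> (\<exists>p>1. cube_inequality TYPE('a) q p)) \<and>
        (cotype TYPE('a) q \<longleftrightarrow> (\<forall>p>1. cube_inequality TYPE('a) q p)))"
proof -
  have q: "q \<ge> 1" using assms by simp
  have torus: "cotype TYPE('a) q \<longleftrightarrow> torus_inequality TYPE('a) q p" if "p \<ge> 1" for p
    using torus_inequality_imp_cotype[OF q that, where 'a='a]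
      rademacher_cotype_imp_torus_inequality[OF q that, where 'a='a]
      cotype_imp_rademacher_cotype[OF q, where 'a='a] by blast
  have dirichlet: "cotype TYPE('a) q \<longleftrightarrow> dirichlet_inequality TYPE('a) q p" if "p \<ge> 1" for p
    using torus[OF that] dirichlet_inequality_iff_torus_inequality[OF that, where 'a='a] by blast
  have cube: "cube_inequality TYPE('a) q p \<Longrightarrow> cotype TYPE('a) q" if "p > 1" for p
    using cube_inequality_imp_cotype[OF q, where 'a='a and p=p] that by simp
  have cube': "cotype TYPE('a) q \<Longrightarrow> K_convex TYPE('a) \<Longrightarrow> cube_inequality TYPE('a) q p" if "p > 1" for p
    using rademacher_cotype_imp_cube_inequality[OF assms that, where 'a='a] cotype_imp_rademacher_cotype[OF q, where 'a='a] by blast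
  \<comment> \<open>The ranges of \<open>p\<close> are nonempty, so the inequality for every
    \<open>p\<close> implies it for some \<open>p\<close>. Conversely one \<open>p\<close> gives
    cotype, which gives every \<open>p\<close> on the torus, and on the cube under
    K-convexity.\<close>
  have ex: "\<exists>p::real. p \<ge> 1" "\<exists>p::real. p > 1" by (auto intro: exI[of _ 1] exI[of _ 2])
  show ?thesis using torus dirichlet cube cube' ex by blast
qed

end
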